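(* Let $n\in\mathbb{N}^d$. (1) If a measurable set $\Omega\subset\mathbb{C}^d$ satisfies that $\Omega^c$ has finite Lebesgue measure, then the polyanalytic Toeplitz operator $T^{\mathcal{F}^2_n}_{\chi_\Omega}$ is an isomorphism on $\mathcal{F}^2_n(\mathbb{C}^d)$. (2) There is a real-valued, continuous $F\in L^\infty(\mathbb{C}^d)$ such that $\lim_{|z|\to\infty}|F(z)|$ does not exist, yet $T_F^{\mathcal{F}^2_n}$ is an isomorphism on $\mathcal{F}^2_n(\mathbb{C}^d)$.
   Context: $\mathbb{N}$ includes $0$. For $z=(x,\omega)\in\mathbb{R}^{2d}$, $(\pi(z)\psi)(t)=e^{2\pi i\omega\cdot t}\psi(t-x)$, and $V_\varphi\psi(z)=\langle\psi,\pi(z)\varphi\rangle_{L^2}$ for $\psi,\varphi\in L^2(\mathbb{R}^d)$. For $n=(n_1,\dots,n_d)\in\mathbb{N}^d$, $\varphi_n$ is the $L^2$-normalized Hermite function $\varphi_n(t)=\prod_{j=1}^d h_{n_j}(t_j)$, $h_k(s)=c_k e^{\pi s^2}\frac{d^k}{ds^k}e^{-2\pi s^2}$ with $c_k$ chosen so that $\|h_k\|_{L^2(\mathbb{R})}=1$; in particular $\varphi_0(t)=2^{d/4}e^{-\pi|t|^2}$. Let $\mathcal{A}:L^2(\mathbb{R}^{2d})\to L^2(\mathbb{C}^d,e^{-\pi|z|^2}dz)$ be the unitary operator $\mathcal{A}(f)(x+i\omega)=e^{-\pi i x\cdot\omega}e^{\frac{\pi}{2}(|x|^2+|\omega|^2)}f(x,-\omega)$.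 The (true) polyanalytic Bargmann-Fock space $\mathcal{F}^2_n(\mathbb{C}^d)$ is the closed subspace $\mathcal{A}(V_{\varphi_n}(L^2(\mathbb{R}^d)))$ of $L^2(\mathbb{C}^d,e^{-\pi|z|^2}dz)$ (for $n=0$ this is the Bargmann-Fock space of entire functions). With $\mathcal{P}_{\mathcal{F}^2_n}$ the orthogonal projection of $L^2(\mathbb{C}^d,e^{-\pi|z|^2}dz)$ onto $\mathcal{F}^2_n(\mathbb{C}^d)$, the polyanalytic Toeplitz operator with symbol $F\in L^\infty(\mathbb{C}^d)$ is $T_F^{\mathcal{F}^2_n}(H)=\mathcal{P}_{\mathcal{F}^2_n}(F\cdot H)$, $H\in\mathcal{F}^2_n(\mathbb{C}^d)$. $\chi_\Omega$ is the characteristic function of $\Omega$. An isomorphism is a bounded linear bijection (with bounded inverse). *)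

theory Defs
  imports "HOL-Analysis.Analysis"
begin

text \<open>
  An element of an \<open>L\<^sup>2\<close> space is represented by a square-integrable function; equality in
  \<open>L\<^sup>2\<close> is equality almost everywhere. Dimension \<open>d\<close> is \<open>CARD('n)\<close>.
\<close>

definition L2 :: "'a measure \<Rightarrow> ('a \<Rightarrow> complex) set" where
  "L2 M = {f \<in> borel_measurable M. integrable M (\<lambda>x. (cmod (f x))\<^sup>2)}"

definition Linf :: "'a measure \<Rightarrow> ('a \<Rightarrow> complex) set" where
  "Linf M = {f \<in> borel_measurable M. \<exists>C. AE x in M. cmod (f x) \<le> C}"

definition l2_inner :: "'a measure \<Rightarrow> ('a \<Rightarrow> complex) \<Rightarrow> ('a \<Rightarrow> complex) \<Rightarrow> complex" where
  "l2_inner M f g = (LINT x|M. f x * cnj (g x))"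

definition l2_norm :: "'a measure \<Rightarrow> ('a \<Rightarrow> complex) \<Rightarrow> real" where
  "l2_norm M f = sqrt (LINT x|M. (cmod (f x))\<^sup>2)"

definition ae_eq :: "'a measure \<Rightarrow> ('a \<Rightarrow> complex) \<Rightarrow> ('a \<Rightarrow> complex) \<Rightarrow> bool" where
  "ae_eq M f g \<longleftrightarrow> (AE x in M. f x = g x)"

text \<open>
  A representative of the orthogonal projection of \<open>f\<close> onto \<open>S\<close>. When \<open>S\<close> is a closed
  subspace of \<open>L2 M\<close> and \<open>f \<in> L2 M\<close>, it exists and is unique up to null sets.
\<close>

definition l2_proj :: "'a measure \<Rightarrow> ('a \<Rightarrow> complex) set \<Rightarrow> ('a \<Rightarrow> complex) \<Rightarrow> ('a \<Rightarrow> complex)" where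
  "l2_proj M S f = (SOME g. g \<in> S \<and> (\<forall>h\<in>S. l2_inner M (\<lambda>x. f x - g x) h = 0))"

text \<open>
  Operators on a subspace \<open>S\<close> of \<open>L2 M\<close>, understood modulo null functions; the first
  condition after \<open>T ` S \<subseteq> S\<close> says that \<open>T\<close> descends to classes.
\<close>

definition l2_bounded_linear ::
  "'a measure \<Rightarrow> ('a \<Rightarrow> complex) set \<Rightarrow> (('a \<Rightarrow> complex) \<Rightarrow> ('a \<Rightarrow> complex)) \<Rightarrow> bool" where
  "l2_bounded_linear M S T \<longleftrightarrow>
     T ` S \<subseteq> S \<and>
     (\<forall>f\<in>S. \<forall>g\<in>S. ae_eq M f g \<longrightarrow> ae_eq M (T f) (T g)) \<and>
     (\<forall>f\<in>S. \<forall>g\<in>S. ae_eq M (T (\<lambda>x. f x + g x)) (\<lambda>x. T f x + T g x)) \<and>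
     (\<forall>c. \<forall>f\<in>S. ae_eq M (T (\<lambda>x. c * f x)) (\<lambda>x. c * T f x)) \<and>
     (\<exists>C. \<forall>f\<in>S. l2_norm M (T f) \<le> C * l2_norm M f)"

text \<open>
  The conjuncts after the first: injectivity, surjectivity, boundedness of the inverse.
\<close>

definition l2_isomorphism ::
  "'a measure \<Rightarrow> ('a \<Rightarrow> complex) set \<Rightarrow> (('a \<Rightarrow> complex) \<Rightarrow> ('a \<Rightarrow> complex)) \<Rightarrow> bool" where
  "l2_isomorphism M S T \<longleftrightarrow>
     l2_bounded_linear M S T \<and>
     (\<forall>f\<in>S. \<forall>g\<in>S. ae_eq M (T f) (T g) \<longrightarrow> ae_eq M f g) \<and>
     (\<forall>g\<in>S. \<exists>f\<in>S. ae_eq M (T f) g) \<and>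
     (\<exists>C. \<forall>f\<in>S. l2_norm M f \<le> C * l2_norm M (T f))"

definition tf_shift ::
  "(real^'n) \<times> (real^'n) \<Rightarrow> (real^'n \<Rightarrow> complex) \<Rightarrow> (real^'n \<Rightarrow> complex)" where
  "tf_shift = (\<lambda>(x, \<omega>) \<psi> t. exp (2 * complex_of_real pi * \<i> * complex_of_real (\<omega> \<bullet> t)) * \<psi> (t - x))"

definition stft ::
  "(real^'n \<Rightarrow> complex) \<Rightarrow> (real^'n \<Rightarrow> complex) \<Rightarrow> (real^'n) \<times> (real^'n) \<Rightarrow> complex" where
  "stft \<phi> \<psi> z = l2_inner lebesgue \<psi> (tf_shift z \<phi>)"

definition hermite_raw :: "nat \<Rightarrow> real \<Rightarrow> real" where
  "hermite_raw k s = exp (pi * s\<^sup>2) * (deriv ^^ k) (\<lambda>u. exp (- 2 * pi * u\<^sup>2)) s"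

text \<open>
  The normalizing constant is taken positive. Its sign affects neither the space \<open>fock2\<close>
  nor the Toeplitz operators below.
\<close>

definition hermite :: "nat \<Rightarrow> real \<Rightarrow> real" where
  "hermite k s = hermite_raw k s / sqrt (LINT u|lebesgue. (hermite_raw k u)\<^sup>2)"

definition hermite_nd :: "nat^'n \<Rightarrow> real^'n \<Rightarrow> complex" where
  "hermite_nd n t = complex_of_real (\<Prod>j\<in>UNIV. hermite (n $ j) (t $ j))"

definition vec_Re :: "complex^'n \<Rightarrow> real^'n" where
  "vec_Re w = (\<chi> j. Re (w $ j))"

definition vec_Im :: "complex^'n \<Rightarrow> real^'n" where
  "vec_Im w = (\<chi> j. Im (w $ j))"

definition gauss :: "(complex^'n) measure" where
  "gauss = density lebesgue (\<lambda>z. ennreal (exp (- pi * (norm z)\<^sup>2)))"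

definition bargmann_map :: "((real^'n) \<times> (real^'n) \<Rightarrow> complex) \<Rightarrow> complex^'n \<Rightarrow> complex" where
  "bargmann_map f w =
     (let x = vec_Re w; \<omega> = vec_Im w in
      exp (- complex_of_real pi * \<i> * complex_of_real (x \<bullet> \<omega>)) *
      complex_of_real (exp (pi / 2 * ((norm x)\<^sup>2 + (norm \<omega>)\<^sup>2))) * f (x, - \<omega>))"

definition fock2 :: "nat^'n \<Rightarrow> (complex^'n \<Rightarrow> complex) set" where
  "fock2 n = {H \<in> L2 gauss. \<exists>\<psi>\<in>L2 lebesgue. ae_eq gauss H (bargmann_map (stft (hermite_nd n) \<psi>))}"

definition toeplitz ::
  "nat^'n \<Rightarrow> (complex^'n \<Rightarrow> complex) \<Rightarrow> (complex^'n \<Rightarrow> complex) \<Rightarrow> complex^'n \<Rightarrow> complex" where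
  "toeplitz n F H = l2_proj gauss (fock2 n) (\<lambda>z. F z * H z)"

end

theory Submission
  imports Defs "HOL-Probability.Probability" "HOL-Complex_Analysis.Complex_Analysis"
begin

text \<open>
  A Toeplitz operator is the compression of multiplication by its symbol \<open>F\<close> to the closed
  subspace \<open>S\<close> of polyanalytic functions. For \<open>0 \<le> F \<le> 1\<close> it is a positive operator, and by the
  Lax-Milgram argument it is an isomorphism as soon as it is coercive: the energy
  \<open>\<integral> F |H|\<^sup>2\<close> has to dominate a fixed multiple of \<open>\<integral> |H|\<^sup>2\<close> on \<open>S\<close>
  (\<open>l2_isomorphism_compression\<close>). For part (2) the symbol \<open>3/4 + cos |z| / 4\<close> oscillates forever
  but stays between \<open>1/2\<close> and \<open>1\<close>, so coercivity is immediate.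
  
  For part (1), coercivity of the characteristic function of \<open>\<Omega>\<close> fails only if some functions in
  \<open>S\<close> of norm one carry less and less mass on \<open>\<Omega>\<close>. Up to an explicit factor of modulus
  \<open>exp (\<pi> |z|\<^sup>2 / 2)\<close>, elements of \<open>S\<close> are short-time Fourier transforms, and by Moyal's identity
  (\<open>moyal\<close>, a consequence of Plancherel) this parametrizes \<open>S\<close> by \<open>L\<^sup>2(\<real>\<^sup>d)\<close> isometrically up to
  a constant. In this picture point evaluations are uniformly bounded and equicontinuous, so a
  subsequence converges pointwise, hence by dominated convergence in the mean on the complement of
  \<open>\<Omega>\<close>, which has finite measure. On \<open>\<Omega>\<close> the mass tends to zero anyway. Thus the subsequence is
  Cauchy, and its limit is a nonzero element of \<open>S\<close> supported in a set of finite measure.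
  
  Such an element does not exist (\<open>G_finite_support_imp_zero\<close>). Hermite functions decay like
  Gaussians, so along every line in a frequency direction the short-time Fourier transform is the
  restriction of an entire function and, unless it vanishes on the whole line, has only countably
  many zeros there. By Fubini, a nonempty open set of finite measure contains a point whose line
  meets the set in finite length (\<open>finite_measure_line\<close>), so the zeros on that line would have
  infinite length.
\<close>

section \<open>Square-integrable functions\<close>

definition sq_norm :: "'a measure \<Rightarrow> ('a \<Rightarrow> complex) \<Rightarrow> real" where
  "sq_norm M f = (LINT x|M. (cmod (f x))\<^sup>2)"

lemma l2_norm_eq: "l2_norm M f = sqrt (sq_norm M f)"
  by (simp add: l2_norm_def sq_norm_def)

lemma sq_norm_nonneg [simp]: "0 \<le> sq_norm M f"
  by (simp add: sq_norm_def)

lemma L2_measurable [measurable_dest]: "f \<in> L2 M \<Longrightarrow> f \<in> borel_measurable M"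
  by (simp add: L2_def)

lemma L2_integrable: "f \<in> L2 M \<Longrightarrow> integrable M (\<lambda>x. (cmod (f x))\<^sup>2)"
  by (simp add: L2_def)

lemma borel_measurable_cnj [measurable (raw)]:
  "f \<in> borel_measurable M \<Longrightarrow> (\<lambda>x. cnj (f x)) \<in> borel_measurable M"
  by (rule borel_measurable_continuous_on[of cnj]) (intro continuous_intros)

lemma cmod_add_square_le: "(cmod (a + b))\<^sup>2 \<le> 2 * (cmod a)\<^sup>2 + 2 * (cmod b)\<^sup>2"
proof -
  have "(cmod (a + b))\<^sup>2 \<le> (cmod a + cmod b)\<^sup>2"
    by (intro power_mono norm_triangle_ineq) auto
  also have "\<dots> \<le> 2 * (cmod a)\<^sup>2 + 2 * (cmod b)\<^sup>2"
    using zero_le_power2[of "cmod a - cmod b"] by (simp add: power2_eq_square algebra_simps)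
  finally show ?thesis .
qed

lemma L2_add:
  assumes "f \<in> L2 M" "g \<in> L2 M" shows "(\<lambda>x. f x + g x) \<in> L2 M"
proof -
  have [measurable]: "f \<in> borel_measurable M" "g \<in> borel_measurable M"
    using assms by (auto dest: L2_measurable)
  have "integrable M (\<lambda>x. 2 * (cmod (f x))\<^sup>2 + 2 * (cmod (g x))\<^sup>2)"
    using assms[THEN L2_integrable] by auto
  then have "integrable M (\<lambda>x. (cmod (f x + g x))\<^sup>2)"
    by (rule Bochner_Integration.integrable_bound) (auto intro!: cmod_add_square_le)
  then show ?thesis by (simp add: L2_def)
qed

lemma L2_mult_bounded:
  assumes "f \<in> L2 M" and [measurable]: "F \<in> borel_measurable M"
    and F: "\<And>x. cmod (F x) \<le> 1"
  shows "(\<lambda>x. F x * f x) \<in> L2 M"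
proof -
  have [measurable]: "f \<in> borel_measurable M"
    using assms by (auto dest: L2_measurable)
  have "integrable M (\<lambda>x. (cmod (F x * f x))\<^sup>2)"
  proof (rule Bochner_Integration.integrable_bound[OF L2_integrable[OF assms(1)]])
    show "AE x in M. norm ((cmod (F x * f x))\<^sup>2) \<le> norm ((cmod (f x))\<^sup>2)"
      using F by (auto simp: norm_mult intro!: power_mono mult_left_le_one_le)
  qed simp
  then show ?thesis by (simp add: L2_def)
qed

lemma L2_cmult: "f \<in> L2 M \<Longrightarrow> (\<lambda>x. c * f x) \<in> L2 M"
  by (auto simp: L2_def norm_mult power_mult_distrib)

lemma L2_diff: "f \<in> L2 M \<Longrightarrow> g \<in> L2 M \<Longrightarrow> (\<lambda>x. f x - g x) \<in> L2 M"
  using L2_add[of f M "\<lambda>x. -1 * g x"] L2_cmult[of g M "-1"] by simp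

lemma L2_zero: "(\<lambda>x. 0) \<in> L2 M"
  by (simp add: L2_def)

lemma L2_prod_integrable:
  assumes "f \<in> L2 M" "g \<in> L2 M"
  shows "integrable M (\<lambda>x. f x * cnj (g x))" "integrable M (\<lambda>x. cmod (f x) * cmod (g x))"
proof -
  have [measurable]: "f \<in> borel_measurable M" "g \<in> borel_measurable M"
    using assms by (auto dest: L2_measurable)
  have *: "integrable M (\<lambda>x. (cmod (f x))\<^sup>2 + (cmod (g x))\<^sup>2)"
    using assms by (auto dest: L2_integrable)
  have **: "a * b \<le> a\<^sup>2 + b\<^sup>2" if "0 \<le> a" "0 \<le> b" for a b :: real
    using sum_squares_bound[of a b] that mult_nonneg_nonneg[OF that] by linarith
  show "integrable M (\<lambda>x. f x * cnj (g x))"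
    by (rule Bochner_Integration.integrable_bound[OF *]) (simp_all add: norm_mult **)
  show "integrable M (\<lambda>x. cmod (f x) * cmod (g x))"
    by (rule Bochner_Integration.integrable_bound[OF *]) (simp_all add: norm_mult **)
qed

text \<open>
  The quadratic polynomial \<open>t \<mapsto> \<integral> (|f| - t |g|)\<^sup>2\<close> has no negative values; evaluate it at its
  minimum \<open>C / B\<close>.
\<close>

lemma L2_Cauchy_Schwarz:
  assumes "f \<in> L2 M" "g \<in> L2 M"
  shows "(LINT x|M. cmod (f x) * cmod (g x))\<^sup>2 \<le> sq_norm M f * sq_norm M g"
proof -
  define A B C where "A = sq_norm M f" and "B = sq_norm M g"
    and "C = (LINT x|M. cmod (f x) * cmod (g x))"
  have int: "integrable M (\<lambda>x. (cmod (f x))\<^sup>2)" "integrable M (\<lambda>x. (cmod (g x))\<^sup>2)"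
    "integrable M (\<lambda>x. cmod (f x) * cmod (g x))"
    using assms by (auto dest: L2_integrable intro: L2_prod_integrable)
  have quad: "0 \<le> A - 2 * t * C + t\<^sup>2 * B" for t
  proof -
    have "0 \<le> (LINT x|M. (cmod (f x) - t * cmod (g x))\<^sup>2)" by simp
    also have "\<dots> = (LINT x|M. (cmod (f x))\<^sup>2 - 2 * t * (cmod (f x) * cmod (g x)) + t\<^sup>2 * (cmod (g x))\<^sup>2)"
      by (intro Bochner_Integration.integral_cong) (auto simp: power2_eq_square algebra_simps)
    also have "\<dots> = A - 2 * t * C + t\<^sup>2 * B"
      using int by (simp add: A_def B_def C_def sq_norm_def)
    finally show ?thesis .
  qed
  have "C\<^sup>2 \<le> A * B"
  proof (cases "B = 0")
    case True
    have "C = 0"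
    proof (rule ccontr)
      assume "C \<noteq> 0"
      with quad[of "(A + 1) / (2 * C)"] True show False by simp
    qed
    with True show ?thesis by simp
  next
    case False
    moreover have "0 \<le> B" by (simp add: B_def)
    ultimately have "0 < B" by simp
    with quad[of "C / B"] show ?thesis
      by (simp add: power2_eq_square field_simps)
  qed
  then show ?thesis by (simp add: A_def B_def C_def)
qed

lemma l2_inner_Cauchy_Schwarz:
  assumes "f \<in> L2 M" "g \<in> L2 M"
  shows "(cmod (l2_inner M f g))\<^sup>2 \<le> sq_norm M f * sq_norm M g"
proof -
  have "cmod (l2_inner M f g) \<le> (LINT x|M. cmod (f x) * cmod (g x))"
    unfolding l2_inner_def
    by (rule order_trans[OF integral_norm_bound]) (simp add: norm_mult)
  then have "(cmod (l2_inner M f g))\<^sup>2 \<le> (LINT x|M. cmod (f x) * cmod (g x))\<^sup>2"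
    by (intro power_mono) auto
  with L2_Cauchy_Schwarz[OF assms] show ?thesis by linarith
qed

lemma sq_norm_add_le:
  assumes "f \<in> L2 M" "g \<in> L2 M"
  shows "sq_norm M (\<lambda>x. f x + g x) \<le> 2 * sq_norm M f + 2 * sq_norm M g"
proof -
  have "sq_norm M (\<lambda>x. f x + g x) \<le> (LINT x|M. 2 * (cmod (f x))\<^sup>2 + 2 * (cmod (g x))\<^sup>2)"
    unfolding sq_norm_def using assms[THEN L2_integrable] L2_add[OF assms, THEN L2_integrable]
    by (intro integral_mono cmod_add_square_le) auto
  also have "\<dots> = 2 * sq_norm M f + 2 * sq_norm M g"
    unfolding sq_norm_def using assms[THEN L2_integrable] by simp
  finally show ?thesis .
qed

lemma sq_norm_cmult: "sq_norm M (\<lambda>x. c * f x) = (cmod c)\<^sup>2 * sq_norm M f"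
  by (simp add: sq_norm_def norm_mult power_mult_distrib)

lemma sq_norm_diff_le:
  assumes "f \<in> L2 M" "g \<in> L2 M" "h \<in> L2 M"
  shows "sq_norm M (\<lambda>x. f x - h x) \<le> 2 * sq_norm M (\<lambda>x. f x - g x) + 2 * sq_norm M (\<lambda>x. g x - h x)"
  using sq_norm_add_le[of "\<lambda>x. f x - g x" M "\<lambda>x. g x - h x"] assms by (simp add: L2_diff)

lemma sq_norm_eq_0_iff:
  assumes "f \<in> L2 M" shows "sq_norm M f = 0 \<longleftrightarrow> (AE x in M. f x = 0)"
  unfolding sq_norm_def using assms
  by (subst integral_nonneg_eq_0_iff_AE) (auto dest: L2_integrable)

lemma nn_integral_sq_norm:
  assumes "f \<in> L2 M" shows "(\<integral>\<^sup>+x. ennreal ((cmod (f x))\<^sup>2) \<partial>M) = ennreal (sq_norm M f)"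
  unfolding sq_norm_def using assms by (subst nn_integral_eq_integral) (auto dest: L2_integrable)

text \<open>
  Functions are representatives of classes, so the topology of \<open>L\<^sup>2\<close> is spelled out in terms of
  squared norms; these keep all estimates below quadratic and free of roots.
\<close>

definition L2_Cauchy :: "'a measure \<Rightarrow> (nat \<Rightarrow> 'a \<Rightarrow> complex) \<Rightarrow> bool" where
  "L2_Cauchy M f \<longleftrightarrow> (\<forall>e>0. \<exists>K. \<forall>j\<ge>K. \<forall>k\<ge>K. sq_norm M (\<lambda>x. f j x - f k x) < e)"

text \<open>
  Riesz-Fischer. Choose a subsequence whose increments \<open>d i\<close> have squared norm at most \<open>(1/8)^i\<close>.
  Then \<open>\<Sum>i. 2^i |d i x|\<^sup>2\<close> has finite integral, so for almost every \<open>x\<close> the increments decay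
  geometrically and the subsequence converges. Fatou's lemma turns the pointwise limit into a limit
  in the mean of the whole sequence.
\<close>

lemma L2_complete:
  assumes f: "\<And>k. f k \<in> L2 M" and C: "L2_Cauchy M f"
  shows "\<exists>g\<in>L2 M. (\<lambda>k. sq_norm M (\<lambda>x. f k x - g x)) \<longlonglongrightarrow> 0"
proof -
  have [measurable]: "f k \<in> borel_measurable M" for k using f by (auto dest: L2_measurable)
  have "\<forall>i. \<exists>K. \<forall>j\<ge>K. \<forall>k\<ge>K. sq_norm M (\<lambda>x. f j x - f k x) < (1/8)^i"
    using C by (simp add: L2_Cauchy_def)
  then obtain K where K: "\<And>i j k. j \<ge> K i \<Longrightarrow> k \<ge> K i \<Longrightarrow> sq_norm M (\<lambda>x. f j x - f k x) < (1/8)^i"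
    by metis
  \<comment> \<open>Summing the indices makes a single \<open>r\<close> pass every threshold up to the current one.\<close>
  define r where "r i = (\<Sum>l\<le>i. K l) + i" for i
  have rK: "r i \<ge> K i" for i
    unfolding r_def using member_le_sum[of i "{..i}" K] by auto
  have rS: "r (Suc i) \<ge> K i" for i
    using rK[of i] by (simp add: r_def)
  have ri: "r i \<ge> i" for i by (simp add: r_def)
  define d where "d i x = f (r (Suc i)) x - f (r i) x" for i x
  have dL2: "d i \<in> L2 M" for i unfolding d_def using f by (intro L2_diff) auto
  have dle: "sq_norm M (d i) \<le> (1/8)^i" for i
    unfolding d_def using K[OF rS[of i] rK[of i]] by simp
  have [measurable]: "d i \<in> borel_measurable M" for i using dL2 by (auto dest: L2_measurable)
  have "(\<integral>\<^sup>+x. (\<Sum>i. ennreal (2^i * (cmod (d i x))\<^sup>2)) \<partial>M) = (\<Sum>i. \<integral>\<^sup>+x. ennreal (2^i * (cmod (d i x))\<^sup>2) \<partial>M)"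
    by (rule nn_integral_suminf) simp
  also have "\<dots> = (\<Sum>i. ennreal (2^i * sq_norm M (d i)))"
    using dL2 by (simp add: ennreal_mult nn_integral_cmult nn_integral_sq_norm)
  also have "\<dots> \<le> (\<Sum>i. ennreal ((1/4)^i))"
  proof (intro suminf_le ennreal_leI)
    fix i show "2^i * sq_norm M (d i) \<le> (1/4)^i"
      using mult_left_mono[OF dle[of i], of "2^i"] by (simp add: power_mult_distrib[symmetric])
  qed auto
  also have "\<dots> < \<infinity>"
    by (subst suminf_ennreal2) (auto intro!: summable_geometric)
  finally have fin: "(\<integral>\<^sup>+x. (\<Sum>i. ennreal (2^i * (cmod (d i x))\<^sup>2)) \<partial>M) < \<infinity>" .
  have "AE x in M. (\<Sum>i. ennreal (2^i * (cmod (d i x))\<^sup>2)) \<noteq> \<infinity>"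
    using fin by (intro nn_integral_PInf_AE) auto
  then have conv: "AE x in M. convergent (\<lambda>i. f (r i) x)"
  proof eventually_elim
    case (elim x)
    have "summable (\<lambda>i. 2^i * (cmod (d i x))\<^sup>2)"
      using elim by (intro summable_suminf_not_top) auto
    then have "bounded (range (\<lambda>i. 2^i * (cmod (d i x))\<^sup>2))"
      by (rule convergent_imp_bounded[OF summable_LIMSEQ_zero])
    then obtain B where B: "\<And>i. \<bar>2^i * (cmod (d i x))\<^sup>2\<bar> \<le> B" unfolding bounded_iff by auto
    have B0: "0 \<le> B" using B[of 0] by linarith
    have dB: "cmod (d i x) \<le> sqrt B * (sqrt (1/2))^i" for i
    proof -
      have "(cmod (d i x))\<^sup>2 \<le> B * (1/2)^i"
        using B[of i] by (simp add: field_simps power_one_over)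
      then have "cmod (d i x) \<le> sqrt (B * (1/2)^i)" by (rule real_le_rsqrt)
      then show ?thesis by (simp add: real_sqrt_mult real_sqrt_power)
    qed
    have "summable (\<lambda>i. sqrt B * (sqrt (1/2))^i)"
      by (intro summable_mult summable_geometric) (simp add: real_sqrt_lt_1_iff)
    then have "summable (\<lambda>i. d i x)"
      by (rule summable_comparison_test') (use dB in auto)
    then have "convergent (\<lambda>n. \<Sum>i<n. d i x)" by (simp add: summable_iff_convergent)
    moreover have "(\<Sum>i<n. d i x) = f (r n) x - f (r 0) x" for n
      unfolding d_def by (rule sum_lessThan_telescope)
    ultimately have "convergent (\<lambda>n. f (r n) x - f (r 0) x + f (r 0) x)"
      using convergent_add[OF _ convergent_const] by fastforce
    then show ?case by simp
  qed
  define g where "g x = lim (\<lambda>i. f (r i) x)" for x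
  have [measurable]: "g \<in> borel_measurable M"
    unfolding g_def by (rule borel_measurable_lim_metric) simp
  have lim: "AE x in M. (\<lambda>i. f (r i) x) \<longlonglongrightarrow> g x"
    using conv by eventually_elim (simp add: g_def convergent_LIMSEQ_iff)
  have bound: "(\<integral>\<^sup>+x. ennreal ((cmod (f j x - g x))\<^sup>2) \<partial>M) \<le> ennreal e"
    if N: "\<forall>j\<ge>N. \<forall>k\<ge>N. sq_norm M (\<lambda>x. f j x - f k x) < e" and j: "j \<ge> N" for e N j
  proof -
    have "(\<integral>\<^sup>+x. ennreal ((cmod (f j x - g x))\<^sup>2) \<partial>M) = (\<integral>\<^sup>+x. liminf (\<lambda>i. ennreal ((cmod (f j x - f (r i) x))\<^sup>2)) \<partial>M)"
    proof (rule nn_integral_cong_AE, use lim in eventually_elim)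
      case (elim x)
      have "(\<lambda>i. ennreal ((cmod (f j x - f (r i) x))\<^sup>2)) \<longlonglongrightarrow> ennreal ((cmod (f j x - g x))\<^sup>2)"
        using elim by (intro tendsto_ennrealI tendsto_intros)
      from lim_imp_Liminf[OF trivial_limit_sequentially this] show ?case by (rule sym)
    qed
    also have "\<dots> \<le> liminf (\<lambda>i. \<integral>\<^sup>+x. ennreal ((cmod (f j x - f (r i) x))\<^sup>2) \<partial>M)"
      by (rule nn_integral_liminf) simp
    also have "\<dots> \<le> ennreal e"
    proof (rule Liminf_le)
      show "\<forall>\<^sub>F i in sequentially. (\<integral>\<^sup>+x. ennreal ((cmod (f j x - f (r i) x))\<^sup>2) \<partial>M) \<le> ennreal e"
        using eventually_ge_at_top[of N]
      proof eventually_elim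
        case (elim i)
        have "r i \<ge> N" using ri[of i] elim by linarith
        then show ?case
          using N j f by (subst nn_integral_sq_norm) (simp_all add: L2_diff ennreal_leI less_imp_le)
      qed
    qed simp
    finally show ?thesis .
  qed
  obtain N where N: "\<forall>j\<ge>N. \<forall>k\<ge>N. sq_norm M (\<lambda>x. f j x - f k x) < 1"
    using C unfolding L2_Cauchy_def by (metis zero_less_one)
  have "(\<lambda>x. f N x - g x) \<in> L2 M"
    using bound[OF N order_refl] by (auto simp: L2_def less_top[symmetric] top_unique intro!: integrableI_bounded)
  then have gL2: "g \<in> L2 M" using L2_diff[OF f[of N], of "\<lambda>x. f N x - g x"] by simp
  moreover have "(\<lambda>k. sq_norm M (\<lambda>x. f k x - g x)) \<longlonglongrightarrow> 0"
  proof (rule LIMSEQ_I)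
    fix e :: real assume "0 < e"
    then obtain N where N: "\<forall>j\<ge>N. \<forall>k\<ge>N. sq_norm M (\<lambda>x. f j x - f k x) < e / 2"
      using C unfolding L2_Cauchy_def by (metis half_gt_zero)
    have "norm (sq_norm M (\<lambda>x. f j x - g x) - 0) < e" if "j \<ge> N" for j
    proof -
      have "ennreal (sq_norm M (\<lambda>x. f j x - g x)) \<le> ennreal (e / 2)"
        using bound[OF N that] f gL2 by (subst (asm) nn_integral_sq_norm) (auto intro: L2_diff)
      then show ?thesis using \<open>0 < e\<close> by (simp add: ennreal_le_iff)
    qed
    then show "\<exists>no. \<forall>n\<ge>no. norm (sq_norm M (\<lambda>x. f n x - g x) - 0) < e" by blast
  qed
  ultimately show ?thesis by blast
qed

section \<open>Compressions of positive symbols to closed subspaces\<close>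

definition L2_subspace :: "'a measure \<Rightarrow> ('a \<Rightarrow> complex) set \<Rightarrow> bool" where
  "L2_subspace M S \<longleftrightarrow> S \<subseteq> L2 M \<and> (\<lambda>x. 0) \<in> S
     \<and> (\<forall>f\<in>S. \<forall>g\<in>S. (\<lambda>x. f x + g x) \<in> S) \<and> (\<forall>c. \<forall>f\<in>S. (\<lambda>x. c * f x) \<in> S)"

definition L2_closed :: "'a measure \<Rightarrow> ('a \<Rightarrow> complex) set \<Rightarrow> bool" where
  "L2_closed M S \<longleftrightarrow> (\<forall>f. (\<forall>k. f k \<in> S) \<longrightarrow> L2_Cauchy M f
     \<longrightarrow> (\<exists>g\<in>S. (\<lambda>k. sq_norm M (\<lambda>x. f k x - g x)) \<longlonglongrightarrow> 0))"

lemma L2_subspaceD: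
  assumes "L2_subspace M S"
  shows "f \<in> S \<Longrightarrow> f \<in> L2 M" "(\<lambda>x. 0) \<in> S"
    "f \<in> S \<Longrightarrow> g \<in> S \<Longrightarrow> (\<lambda>x. f x + g x) \<in> S" "f \<in> S \<Longrightarrow> (\<lambda>x. c * f x) \<in> S"
  using assms by (auto simp: L2_subspace_def)

lemma L2_subspace_diff:
  assumes "L2_subspace M S" "f \<in> S" "g \<in> S" shows "(\<lambda>x. f x - g x) \<in> S"
  using L2_subspaceD(3)[OF assms(1,2) L2_subspaceD(4)[OF assms(1,3), of "-1"]] by simp

lemma l2_inner_diff_left:
  assumes "f \<in> L2 M" "g \<in> L2 M" "h \<in> L2 M"
  shows "l2_inner M (\<lambda>x. f x - g x) h = l2_inner M f h - l2_inner M g h"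
  unfolding l2_inner_def using L2_prod_integrable(1)[OF assms(1,3)] L2_prod_integrable(1)[OF assms(2,3)]
  by (simp add: left_diff_distrib)

lemma l2_inner_add_left:
  assumes "f \<in> L2 M" "g \<in> L2 M" "h \<in> L2 M"
  shows "l2_inner M (\<lambda>x. f x + g x) h = l2_inner M f h + l2_inner M g h"
  unfolding l2_inner_def using L2_prod_integrable(1)[OF assms(1,3)] L2_prod_integrable(1)[OF assms(2,3)]
  by (simp add: distrib_right)

lemma l2_inner_cmult_left: "l2_inner M (\<lambda>x. c * f x) h = c * l2_inner M f h"
  unfolding l2_inner_def by (simp add: mult.assoc)

lemma l2_inner_self: "l2_inner M f f = complex_of_real (sq_norm M f)"
  unfolding l2_inner_def sq_norm_def
  by (simp add: complex_norm_square[symmetric] flip: of_real_power)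

definition weighted_energy :: "'a measure \<Rightarrow> ('a \<Rightarrow> real) \<Rightarrow> ('a \<Rightarrow> complex) \<Rightarrow> real" where
  "weighted_energy M F f = (LINT x|M. F x * (cmod (f x))\<^sup>2)"

definition coercive_on :: "'a measure \<Rightarrow> ('a \<Rightarrow> complex) set \<Rightarrow> ('a \<Rightarrow> real) \<Rightarrow> real \<Rightarrow> bool" where
  "coercive_on M S F c \<longleftrightarrow> 0 < c \<and> (\<forall>f\<in>S. c * sq_norm M f \<le> weighted_energy M F f)"

lemma weighted_integrable:
  assumes "f \<in> L2 M" and [measurable]: "F \<in> borel_measurable M" and F: "\<And>x. 0 \<le> F x \<and> F x \<le> (1::real)"
  shows "integrable M (\<lambda>x. F x * (cmod (f x))\<^sup>2)"
proof -
  have [measurable]: "f \<in> borel_measurable M" using assms by (auto dest: L2_measurable)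
  show ?thesis
    by (rule Bochner_Integration.integrable_bound[OF L2_integrable[OF assms(1)]])
      (use F in \<open>auto simp: abs_mult intro!: mult_left_le_one_le\<close>)
qed

lemma weighted_energy_le:
  assumes "f \<in> L2 M" "F \<in> borel_measurable M" "\<And>x. 0 \<le> F x \<and> F x \<le> (1::real)"
  shows "weighted_energy M F f \<le> sq_norm M f" "0 \<le> weighted_energy M F f"
  unfolding weighted_energy_def sq_norm_def using assms
  by (auto intro!: integral_mono weighted_integrable L2_integrable mult_left_le_one_le integral_nonneg_AE)

text \<open>
  Lax-Milgram for the form \<open>\<integral> F f cnj h\<close>, by the direct method: the solution minimizes
  \<open>E f = \<integral> F |f|\<^sup>2 - 2 Re \<langle>k, f\<rangle>\<close> over \<open>S\<close>. For \<open>F = 1\<close> the lemma yields the orthogonal projection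
  of \<open>k\<close> onto \<open>S\<close>; for the symbol of a Toeplitz operator it yields a preimage of \<open>k\<close>.
\<close>

lemma weighted_representation:
  assumes S: "L2_subspace M S" and cl: "L2_closed M S"
    and F [measurable]: "F \<in> borel_measurable M" and F01: "\<And>x. 0 \<le> F x \<and> F x \<le> (1::real)"
    and coer: "coercive_on M S F c" and k: "k \<in> L2 M"
  shows "\<exists>f\<in>S. \<forall>h\<in>S. l2_inner M (\<lambda>x. complex_of_real (F x) * f x - k x) h = 0"
proof -
  have c: "0 < c" and coer: "\<And>f. f \<in> S \<Longrightarrow> c * sq_norm M f \<le> weighted_energy M F f"
    using coer by (auto simp: coercive_on_def)
  note SL = L2_subspaceD(1)[OF S]
  define E where "E f = (LINT x|M. F x * (cmod (f x))\<^sup>2 - 2 * Re (k x * cnj (f x)))" for f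
  define w where "w f h = l2_inner M (\<lambda>x. complex_of_real (F x) * f x - k x) h" for f h
  have FL2: "(\<lambda>x. complex_of_real (F x) * f x) \<in> L2 M" if "f \<in> L2 M" for f
    using that F01 by (intro L2_mult_bounded) auto
  have int1: "integrable M (\<lambda>x. F x * (cmod (f x))\<^sup>2)" if "f \<in> L2 M" for f
    using weighted_integrable[OF that F F01] .
  have int2: "integrable M (\<lambda>x. Re (f x * cnj (g x)))" if "f \<in> L2 M" "g \<in> L2 M" for f g
    using L2_prod_integrable(1)[OF that] by (rule integrable_Re)
  have kint: "integrable M (\<lambda>x. Re (k x * cnj (f x)))" if "f \<in> L2 M" for f
    using int2[OF k that] .
  have split: "(LINT x|M. A x - 2 * B x + C x) = (LINT x|M. A x) - 2 * (LINT x|M. B x) + (LINT x|M. C x)"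
    if "integrable M A" "integrable M B" "integrable M C" for A B C :: "'a \<Rightarrow> real"
    using that by simp
  have Elow: "- sq_norm M k / c \<le> E f" if "f \<in> S" for f
  proof -
    have f: "f \<in> L2 M" using SL that by auto
    have "E f = weighted_energy M F f - (LINT x|M. 2 * Re (k x * cnj (f x)))"
      unfolding E_def weighted_energy_def
      by (intro Bochner_Integration.integral_diff int1[OF f] integrable_mult_right kint[OF f])
    moreover have "(LINT x|M. 2 * Re (k x * cnj (f x))) \<le> (LINT x|M. c * (cmod (f x))\<^sup>2 + (cmod (k x))\<^sup>2 / c)"
    proof (rule integral_mono)
      fix x
      have "Re (k x * cnj (f x)) \<le> cmod (k x) * cmod (f x)"
        using complex_Re_le_cmod[of "k x * cnj (f x)"] by (simp add: norm_mult)
      moreover have "2 * (cmod (k x) * cmod (f x)) \<le> c * (cmod (f x))\<^sup>2 + (cmod (k x))\<^sup>2 / c"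
        using zero_le_power2[of "c * cmod (f x) - cmod (k x)"] c
        by (simp add: field_simps power2_eq_square)
      ultimately show "2 * Re (k x * cnj (f x)) \<le> c * (cmod (f x))\<^sup>2 + (cmod (k x))\<^sup>2 / c" by linarith
    qed (intro integrable_mult_right kint[OF f] Bochner_Integration.integrable_add integrable_divide
        L2_integrable[OF f] L2_integrable[OF k])+
    moreover have "(LINT x|M. c * (cmod (f x))\<^sup>2 + (cmod (k x))\<^sup>2 / c) = c * sq_norm M f + sq_norm M k / c"
      unfolding sq_norm_def using L2_integrable[OF f] L2_integrable[OF k] by simp
    ultimately show ?thesis using coer[OF that] by simp
  qed
  define m where "m = (INF f\<in>S. E f)"
  have bdd: "bdd_below (E ` S)" using Elow by (auto intro!: bdd_belowI[where m="- sq_norm M k / c"])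
  have m_le: "m \<le> E f" if "f \<in> S" for f
    unfolding m_def using bdd that by (rule cINF_lower)
  have Sne: "S \<noteq> {}" using L2_subspaceD(2)[OF S] by auto
  have "\<exists>f\<in>S. E f < m + 1 / real (Suc j)" for j
  proof -
    have "(INF f\<in>S. E f) < m + 1 / real (Suc j)" by (simp add: m_def)
    then show ?thesis using cINF_less_iff[OF Sne bdd] by blast
  qed
  then obtain f where fS: "\<And>j. f j \<in> S" and fE: "\<And>j. E (f j) < m + 1 / real (Suc j)" by metis
  have fL2: "f j \<in> L2 M" for j using SL fS by auto
  define e where "e f x = F x * (cmod (f x))\<^sup>2 - 2 * Re (k x * cnj (f x))" for f x
  have E_e: "E f = (LINT x|M. e f x)" for f by (simp add: E_def e_def)
  have eint: "integrable M (e f)" if "f \<in> L2 M" for f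
    unfolding e_def using int1[OF that] kint[OF that]
    by (intro Bochner_Integration.integrable_diff Bochner_Integration.integrable_mult_right)
  \<comment> \<open>The parallelogram law: it forces minimizing sequences to be Cauchy.\<close>
  have para: "E g + E h - 2 * E (\<lambda>x. 1/2 * (g x + h x)) = 1/2 * weighted_energy M F (\<lambda>x. g x - h x)"
    if "g \<in> L2 M" "h \<in> L2 M" for g h
  proof -
    have mid: "(\<lambda>x. 1/2 * (g x + h x)) \<in> L2 M" using that by (intro L2_cmult L2_add)
    have pw: "(F x * (cmod (g x))\<^sup>2 - 2 * Re (k x * cnj (g x))) + (F x * (cmod (h x))\<^sup>2 - 2 * Re (k x * cnj (h x)))
        - 2 * (F x * (cmod (1/2 * (g x + h x)))\<^sup>2 - 2 * Re (k x * cnj (1/2 * (g x + h x))))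
        = 1/2 * (F x * (cmod (g x - h x))\<^sup>2)" for x
    proof -
      have p1: "(cmod (1/2 * (g x + h x)))\<^sup>2 = 1/4 * (cmod (g x + h x))\<^sup>2"
        by (simp add: norm_mult power_mult_distrib power2_eq_square)
      have p2: "(cmod (g x + h x))\<^sup>2 = 2 * (cmod (g x))\<^sup>2 + 2 * (cmod (h x))\<^sup>2 - (cmod (g x - h x))\<^sup>2"
        by (simp only: cmod_power2) (simp add: power2_eq_square algebra_simps)
      have p3: "Re (k x * cnj (1/2 * (g x + h x))) = 1/2 * Re (k x * cnj (g x)) + 1/2 * Re (k x * cnj (h x))"
        by (simp add: algebra_simps)
      show ?thesis unfolding p1 p2 p3 by (simp add: algebra_simps)
    qed
    have "E g + E h - 2 * E (\<lambda>x. 1/2 * (g x + h x)) = (LINT x|M. e g x + e h x - 2 * e (\<lambda>x. 1/2 * (g x + h x)) x)"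
      unfolding E_e using eint[OF that(1)] eint[OF that(2)] eint[OF mid] by simp
    also have "\<dots> = (LINT x|M. 1/2 * (F x * (cmod (g x - h x))\<^sup>2))"
      by (rule Bochner_Integration.integral_cong) (use pw in \<open>simp_all only: e_def\<close>)
    also have "\<dots> = 1/2 * weighted_energy M F (\<lambda>x. g x - h x)"
      unfolding weighted_energy_def by simp
    finally show ?thesis .
  qed
  have dist: "sq_norm M (\<lambda>x. f i x - f j x) \<le> (2 / c) * (1 / real (Suc i) + 1 / real (Suc j))" for i j
  proof -
    have "(\<lambda>x. 1/2 * (f i x + f j x)) \<in> S"
      using fS by (intro L2_subspaceD(4)[OF S] L2_subspaceD(3)[OF S])
    from m_le[OF this] para[OF fL2[of i] fL2[of j]] fE[of i] fE[of j]
    have "1/2 * weighted_energy M F (\<lambda>x. f i x - f j x) \<le> 1 / real (Suc i) + 1 / real (Suc j)"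
      by linarith
    moreover have "c * sq_norm M (\<lambda>x. f i x - f j x) \<le> weighted_energy M F (\<lambda>x. f i x - f j x)"
      using fS by (intro coer L2_subspace_diff[OF S])
    moreover have "1/2 * a \<le> b \<Longrightarrow> y \<le> a \<Longrightarrow> y \<le> 2 * b" for a b y :: real by linarith
    ultimately have "c * sq_norm M (\<lambda>x. f i x - f j x) \<le> 2 * (1 / real (Suc i) + 1 / real (Suc j))"
      by blast
    then have "(1 / c) * (c * sq_norm M (\<lambda>x. f i x - f j x)) \<le> (1 / c) * (2 * (1 / real (Suc i) + 1 / real (Suc j)))"
      using c by (intro mult_left_mono) auto
    then show ?thesis using c by simp
  qed
  have "L2_Cauchy M f"
    unfolding L2_Cauchy_def
  proof (intro allI impI)
    fix e :: real assume "0 < e"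
    then obtain K where K: "inverse (real (Suc K)) < e * c / 4"
      using reals_Archimedean[of "e * c / 4"] c by auto
    have "sq_norm M (\<lambda>x. f i x - f j x) < e" if "i \<ge> K" "j \<ge> K" for i j
    proof -
      have "1 / real (Suc i) \<le> 1 / real (Suc K)" "1 / real (Suc j) \<le> 1 / real (Suc K)"
        using that by (auto simp: field_simps)
      then have "1 / real (Suc i) + 1 / real (Suc j) < e * c / 2"
        using K by (simp add: inverse_eq_divide)
      then have "(2 / c) * (1 / real (Suc i) + 1 / real (Suc j)) < (2 / c) * (e * c / 2)"
        using c by (intro mult_strict_left_mono) auto
      then show ?thesis using dist[of i j] c by simp
    qed
    then show "\<exists>K. \<forall>i\<ge>K. \<forall>j\<ge>K. sq_norm M (\<lambda>x. f i x - f j x) < e" by blast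
  qed
  then obtain g where gS: "g \<in> S" and lim: "(\<lambda>j. sq_norm M (\<lambda>x. f j x - g x)) \<longlonglongrightarrow> 0"
    using cl fS unfolding L2_closed_def by blast
  have gL2: "g \<in> L2 M" using SL gS by auto
  have "w g h = 0" if hS: "h \<in> S" for h
  proof -
    have hL2: "h \<in> L2 M" using SL hS by auto
    define A where "A = sq_norm M h + 1"
    have A: "A \<ge> 1" by (simp add: A_def)
    have small: "(cmod (w (f j) h))\<^sup>2 \<le> A * (1 / real (Suc j))" for j
    proof -
      define v where "v = w (f j) h"
      \<comment> \<open>Nearly optimal step for the competitor \<open>f j - t h\<close>: the linear gain \<open>2 |v|\<^sup>2 / A\<close> beats the
        quadratic cost, which is at most \<open>|v|\<^sup>2 / A\<close>.\<close>
      define t where "t = complex_of_real (1 / A) * v"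
      define p where "p x = f j x - t * h x" for x
      have pS: "p \<in> S" unfolding p_def
        using fS hS by (intro L2_subspace_diff[OF S] L2_subspaceD(4)[OF S])
      have pL2: "p \<in> L2 M" using pS SL by auto
      have resL2: "(\<lambda>x. complex_of_real (F x) * f j x - k x) \<in> L2 M"
        using fL2 k by (intro L2_diff FL2)
      have thL2: "(\<lambda>x. t * h x) \<in> L2 M" using hL2 by (rule L2_cmult)
      have pw: "F x * (cmod (p x))\<^sup>2 - 2 * Re (k x * cnj (p x)) =
         (F x * (cmod (f j x))\<^sup>2 - 2 * Re (k x * cnj (f j x)))
         - 2 * Re ((complex_of_real (F x) * f j x - k x) * cnj (t * h x)) + F x * (cmod (t * h x))\<^sup>2" for x
        unfolding p_def by (simp only: cmod_power2) (simp add: power2_eq_square algebra_simps)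
      note i = eint[OF fL2[of j], unfolded e_def] int2[OF resL2 thL2] int1[OF thL2]
      have "E p = E (f j) - 2 * (LINT x|M. Re ((complex_of_real (F x) * f j x - k x) * cnj (t * h x)))
          + weighted_energy M F (\<lambda>x. t * h x)"
        unfolding E_def pw weighted_energy_def using i by (intro split)
      also have "(LINT x|M. Re ((complex_of_real (F x) * f j x - k x) * cnj (t * h x))) = Re (v * cnj t)"
      proof -
        have "(LINT x|M. Re ((complex_of_real (F x) * f j x - k x) * cnj (t * h x)))
          = Re (LINT x|M. (complex_of_real (F x) * f j x - k x) * cnj (t * h x))"
          using L2_prod_integrable(1)[OF resL2 thL2] by (rule integral_Re)
        also have "(LINT x|M. (complex_of_real (F x) * f j x - k x) * cnj (t * h x)) = cnj t * v"
          unfolding v_def w_def l2_inner_def 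
          by (subst Bochner_Integration.integral_mult_right_zero[symmetric])
             (simp add: mult_ac)
        finally show ?thesis by (simp add: mult.commute)
      qed
      also have "Re (v * cnj t) = (cmod v)\<^sup>2 / A"
        unfolding t_def by (simp only: cmod_power2) (simp add: power2_eq_square add_divide_distrib)
      finally have "m \<le> E (f j) - 2 * ((cmod v)\<^sup>2 / A) + weighted_energy M F (\<lambda>x. t * h x)"
        using m_le[OF pS] by simp
      moreover have "weighted_energy M F (\<lambda>x. t * h x) \<le> (cmod v)\<^sup>2 / A"
      proof -
        have "weighted_energy M F (\<lambda>x. t * h x) \<le> sq_norm M (\<lambda>x. t * h x)"
          using weighted_energy_le(1)[OF thL2 F F01] .
        also have "\<dots> = (cmod v)\<^sup>2 / A * (sq_norm M h / A)"
          unfolding sq_norm_cmult using A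
          by (simp add: t_def norm_mult power_mult_distrib power2_eq_square norm_divide)
        also have "\<dots> \<le> (cmod v)\<^sup>2 / A * 1"
        proof (rule mult_left_mono)
          have "0 < A" using A by linarith
          moreover have "sq_norm M h \<le> A" by (simp add: A_def)
          ultimately show "sq_norm M h / A \<le> 1" by simp
          show "0 \<le> (cmod v)\<^sup>2 / A" using A by simp
        qed
        finally show ?thesis by simp
      qed
      ultimately have "(cmod v)\<^sup>2 / A \<le> 1 / real (Suc j)" using fE[of j] by linarith
      then show ?thesis using A by (simp add: v_def field_simps)
    qed
    have wdiff: "(cmod (w (f j) h - w g h))\<^sup>2 \<le> sq_norm M (\<lambda>x. f j x - g x) * sq_norm M h" for j
    proof -
      have "w (f j) h - w g h = l2_inner M (\<lambda>x. (complex_of_real (F x) * f j x - k x) - (complex_of_real (F x) * g x - k x)) h"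
        unfolding w_def using fL2 gL2 hL2 k by (intro l2_inner_diff_left[symmetric] L2_diff FL2)
      also have "(\<lambda>x. (complex_of_real (F x) * f j x - k x) - (complex_of_real (F x) * g x - k x)) =
           (\<lambda>x. complex_of_real (F x) * (f j x - g x))" by (auto simp: algebra_simps)
      finally have eq: "w (f j) h - w g h = l2_inner M (\<lambda>x. complex_of_real (F x) * (f j x - g x)) h" .
      have "(cmod (w (f j) h - w g h))\<^sup>2 \<le> sq_norm M (\<lambda>x. complex_of_real (F x) * (f j x - g x)) * sq_norm M h"
        unfolding eq by (rule l2_inner_Cauchy_Schwarz[OF FL2[OF L2_diff[OF fL2 gL2]] hL2])
      also have "sq_norm M (\<lambda>x. complex_of_real (F x) * (f j x - g x)) \<le> sq_norm M (\<lambda>x. f j x - g x)"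
        unfolding sq_norm_def
        using fL2 gL2 F01 L2_integrable[OF L2_diff[OF fL2 gL2]] L2_integrable[OF FL2[OF L2_diff[OF fL2 gL2]]]
        by (intro integral_mono) (auto simp: norm_mult intro!: power_mono mult_left_le_one_le)
      finally show ?thesis by (simp add: mult_right_mono)
    qed
    have "(\<lambda>j. 2 * (A * (1 / real (Suc j))) + 2 * (sq_norm M (\<lambda>x. f j x - g x) * sq_norm M h)) \<longlonglongrightarrow> 2 * (A * 0) + 2 * (0 * sq_norm M h)"
      using lim LIMSEQ_inverse_real_of_nat by (intro tendsto_intros) (simp add: inverse_eq_divide)
    moreover have "(cmod (w g h))\<^sup>2 \<le> 2 * (A * (1 / real (Suc j))) + 2 * (sq_norm M (\<lambda>x. f j x - g x) * sq_norm M h)" for j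
      using cmod_add_square_le[of "w (f j) h" "w g h - w (f j) h"] small[of j] wdiff[of j]
      by (simp add: norm_minus_commute)
    ultimately have "(cmod (w g h))\<^sup>2 \<le> 0"
      using LIMSEQ_le_const[of _ 0] by fastforce
    then show ?thesis by simp
  qed
  then show ?thesis using gS unfolding w_def by blast
qed

lemma ae_eqI_inner:
  assumes S: "L2_subspace M S" and f: "f \<in> S" and g: "g \<in> S"
    and eq: "\<And>h. h \<in> S \<Longrightarrow> l2_inner M f h = l2_inner M g h"
  shows "ae_eq M f g"
proof -
  let ?d = "\<lambda>x. f x - g x"
  have d: "?d \<in> S" using L2_subspace_diff[OF S f g] .
  note L = L2_subspaceD(1)[OF S]
  have "complex_of_real (sq_norm M ?d) = l2_inner M ?d ?d" by (simp add: l2_inner_self)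
  also have "\<dots> = 0" using eq[OF d] L f g d by (simp add: l2_inner_diff_left)
  finally have "AE x in M. ?d x = 0"
    using sq_norm_eq_0_iff[OF L[OF d]] by simp
  then show ?thesis by (simp add: ae_eq_def)
qed

text \<open>
  Write \<open>T\<close> for the compression. From \<open>\<langle>T f, h\<rangle> = \<langle>F f, h\<rangle>\<close> for \<open>h \<in> S\<close> one reads off
  \<open>c \<parallel>f\<parallel>\<^sup>2 \<le> \<langle>F f, f\<rangle> = \<langle>T f, f\<rangle> \<le> \<parallel>T f\<parallel> \<parallel>f\<parallel>\<close>, which gives injectivity and a bounded inverse, while
  surjectivity is the representation of \<open>\<langle>g, \<cdot>\<rangle>\<close> by the coercive form.
\<close>

lemma l2_isomorphism_compression:
  assumes S: "L2_subspace M S" and cl: "L2_closed M S"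
    and F [measurable]: "F \<in> borel_measurable M" and F01: "\<And>x. 0 \<le> F x \<and> F x \<le> (1::real)"
    and coer: "coercive_on M S F c"
  shows "l2_isomorphism M S (\<lambda>f. l2_proj M S (\<lambda>x. complex_of_real (F x) * f x))"
proof -
  define T where "T f = l2_proj M S (\<lambda>x. complex_of_real (F x) * f x)" for f
  have c: "0 < c" and coer': "\<And>f. f \<in> S \<Longrightarrow> c * sq_norm M f \<le> weighted_energy M F f"
    using coer by (auto simp: coercive_on_def)
  note L = L2_subspaceD(1)[OF S]
  have FL2: "(\<lambda>x. complex_of_real (F x) * f x) \<in> L2 M" if "f \<in> L2 M" for f
    using that F01 by (intro L2_mult_bounded) auto
  have coer1: "coercive_on M S (\<lambda>_. 1) 1"
    by (simp add: coercive_on_def weighted_energy_def sq_norm_def)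
  have proj: "T f \<in> S \<and> (\<forall>h\<in>S. l2_inner M (\<lambda>x. complex_of_real (F x) * f x - T f x) h = 0)"
    if "f \<in> S" for f
  proof -
    have "\<exists>g\<in>S. \<forall>h\<in>S. l2_inner M (\<lambda>x. complex_of_real 1 * g x - complex_of_real (F x) * f x) h = 0"
      by (rule weighted_representation[OF S cl _ _ coer1 FL2[OF L[OF that]]]) auto
    then obtain g where g: "g \<in> S" "\<forall>h\<in>S. l2_inner M (\<lambda>x. g x - complex_of_real (F x) * f x) h = 0"
      by auto
    have *: "l2_inner M (\<lambda>x. complex_of_real (F x) * f x - g x) h = 0" if h: "h \<in> S" for h
      using g h FL2 L \<open>f \<in> S\<close> by (simp add: l2_inner_diff_left)
    let ?P = "\<lambda>g. g \<in> S \<and> (\<forall>h\<in>S. l2_inner M (\<lambda>x. complex_of_real (F x) * f x - g x) h = 0)"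
    have "?P g" using * g(1) by blast
    then have "?P (SOME g. ?P g)" by (rule someI[where P="?P"])
    then show ?thesis unfolding T_def l2_proj_def .
  qed
  have TS: "T f \<in> S" if "f \<in> S" for f using proj[OF that] by simp
  have Tin: "l2_inner M (T f) h = l2_inner M (\<lambda>x. complex_of_real (F x) * f x) h" if "f \<in> S" "h \<in> S" for f h
  proof -
    have "l2_inner M (\<lambda>x. complex_of_real (F x) * f x - T f x) h = 0"
      using proj[OF that(1)] that(2) by blast
    then show ?thesis
      unfolding l2_inner_diff_left[OF FL2[OF L[OF that(1)]] L[OF TS[OF that(1)]] L[OF that(2)]] by simp
  qed
  have Fself: "l2_inner M (\<lambda>x. complex_of_real (F x) * f x) f = complex_of_real (weighted_energy M F f)" for f
    unfolding l2_inner_def weighted_energy_def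
    by (simp add: mult.assoc complex_norm_square[symmetric] flip: of_real_power of_real_mult integral_complex_of_real)
  have Fle: "sq_norm M (\<lambda>x. complex_of_real (F x) * f x) \<le> sq_norm M f" if "f \<in> S" for f
    unfolding sq_norm_def using that F01 L2_integrable[OF L[OF that]] L2_integrable[OF FL2[OF L[OF that]]]
    by (intro integral_mono) (auto simp: norm_mult intro!: power_mono mult_left_le_one_le)
  have up: "l2_norm M (T f) \<le> 1 * l2_norm M f" if f: "f \<in> S" for f
  proof -
    have "(sq_norm M (T f))\<^sup>2 = (cmod (l2_inner M (T f) (T f)))\<^sup>2" by (simp add: l2_inner_self)
    also have "\<dots> \<le> sq_norm M (\<lambda>x. complex_of_real (F x) * f x) * sq_norm M (T f)"
      unfolding Tin[OF f TS[OF f]] using f TS L FL2 by (intro l2_inner_Cauchy_Schwarz) auto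
    also have "\<dots> \<le> sq_norm M f * sq_norm M (T f)"
      using Fle[OF f] by (intro mult_right_mono) auto
    finally have "sq_norm M (T f) \<le> sq_norm M f"
      using sq_norm_nonneg[of M "T f"] sq_norm_nonneg[of M f]
      by (cases "sq_norm M (T f) = 0") (auto simp: power2_eq_square)
    then show ?thesis by (simp add: l2_norm_eq)
  qed
  have low: "l2_norm M f \<le> (1 / c) * l2_norm M (T f)" if f: "f \<in> S" for f
  proof -
    have "(c * sq_norm M f)\<^sup>2 \<le> (weighted_energy M F f)\<^sup>2"
      using coer'[OF f] c by (intro power_mono) auto
    also have "\<dots> = (cmod (l2_inner M (T f) f))\<^sup>2" using f by (simp add: Tin Fself)
    also have "\<dots> \<le> sq_norm M (T f) * sq_norm M f"
      using f TS L by (intro l2_inner_Cauchy_Schwarz) auto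
    finally have *: "c\<^sup>2 * sq_norm M f * sq_norm M f \<le> sq_norm M (T f) * sq_norm M f"
      by (simp add: power2_eq_square mult_ac)
    have "c\<^sup>2 * sq_norm M f \<le> sq_norm M (T f)"
      using * sq_norm_nonneg[of M "T f"] sq_norm_nonneg[of M f]
      by (cases "sq_norm M f = 0") auto
    then have "sqrt (c\<^sup>2 * sq_norm M f) \<le> sqrt (sq_norm M (T f))" by simp
    then show ?thesis using c by (simp add: l2_norm_eq real_sqrt_mult field_simps)
  qed
  have sub: "ae_eq M f g \<Longrightarrow> ae_eq M (T f) (T g)" if "f \<in> S" "g \<in> S" for f g
  proof (rule ae_eqI_inner[OF S TS[OF that(1)] TS[OF that(2)]])
    fix h assume eq: "ae_eq M f g" and h: "h \<in> S"
    have [measurable]: "f \<in> borel_measurable M" "g \<in> borel_measurable M" "h \<in> borel_measurable M"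
      using that h L by (auto dest: L2_measurable)
    show "l2_inner M (T f) h = l2_inner M (T g) h"
      unfolding Tin[OF that(1) h] Tin[OF that(2) h] unfolding l2_inner_def
      by (rule integral_cong_AE) (use eq in \<open>auto simp: ae_eq_def\<close>)
  qed
  have add: "ae_eq M (T (\<lambda>x. f x + g x)) (\<lambda>x. T f x + T g x)" if "f \<in> S" "g \<in> S" for f g
  proof (rule ae_eqI_inner[OF S])
    have fg: "(\<lambda>x. f x + g x) \<in> S" using L2_subspaceD(3)[OF S that] .
    then show "T (\<lambda>x. f x + g x) \<in> S" by (rule TS)
    show "(\<lambda>x. T f x + T g x) \<in> S" using L2_subspaceD(3)[OF S TS[OF that(1)] TS[OF that(2)]] .
    fix h assume h: "h \<in> S"
    show "l2_inner M (T (\<lambda>x. f x + g x)) h = l2_inner M (\<lambda>x. T f x + T g x) h"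
      unfolding Tin[OF fg h] using that h TS L FL2 by (simp add: l2_inner_add_left Tin distrib_left)
  qed
  have cm: "ae_eq M (T (\<lambda>x. a * f x)) (\<lambda>x. a * T f x)" if "f \<in> S" for a f
  proof (rule ae_eqI_inner[OF S])
    have af: "(\<lambda>x. a * f x) \<in> S" using L2_subspaceD(4)[OF S that] .
    then show "T (\<lambda>x. a * f x) \<in> S" by (rule TS)
    show "(\<lambda>x. a * T f x) \<in> S" using L2_subspaceD(4)[OF S TS[OF that]] .
    fix h assume h: "h \<in> S"
    have "(\<lambda>x. complex_of_real (F x) * (a * f x)) = (\<lambda>x. a * (complex_of_real (F x) * f x))"
      by (auto simp: mult_ac)
    then show "l2_inner M (T (\<lambda>x. a * f x)) h = l2_inner M (\<lambda>x. a * T f x) h"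
      unfolding Tin[OF af h] using that h by (simp add: l2_inner_cmult_left Tin)
  qed
  have inj: "ae_eq M (T f) (T g) \<Longrightarrow> ae_eq M f g" if "f \<in> S" "g \<in> S" for f g
  proof -
    assume eq: "ae_eq M (T f) (T g)"
    let ?d = "\<lambda>x. f x - g x"
    have d: "?d \<in> S" using L2_subspace_diff[OF S that] .
    have [measurable]: "T f \<in> borel_measurable M" "T g \<in> borel_measurable M"
      "f \<in> borel_measurable M" "g \<in> borel_measurable M"
      using that TS L by (auto dest: L2_measurable)
    have "complex_of_real (weighted_energy M F ?d) = l2_inner M (\<lambda>x. complex_of_real (F x) * f x - complex_of_real (F x) * g x) ?d"
      unfolding Fself[symmetric] by (simp add: right_diff_distrib)
    also have "\<dots> = l2_inner M (T f) ?d - l2_inner M (T g) ?d"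
      using that d L FL2 by (simp add: l2_inner_diff_left Tin)
    also have "l2_inner M (T f) ?d = l2_inner M (T g) ?d"
      unfolding l2_inner_def by (rule integral_cong_AE) (use eq in \<open>auto simp: ae_eq_def\<close>)
    finally have "c * sq_norm M ?d \<le> 0" using coer'[OF d] by simp
    then have "sq_norm M ?d = 0" using c sq_norm_nonneg[of M ?d] by (simp add: mult_le_0_iff)
    then show "ae_eq M f g" using sq_norm_eq_0_iff[OF L[OF d]] by (simp add: ae_eq_def)
  qed
  have surj: "\<exists>f\<in>S. ae_eq M (T f) g" if g: "g \<in> S" for g
  proof -
    obtain f where f: "f \<in> S" "\<forall>h\<in>S. l2_inner M (\<lambda>x. complex_of_real (F x) * f x - g x) h = 0"
      using weighted_representation[OF S cl F F01 coer L[OF g]] by auto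
    have "ae_eq M (T f) g"
      by (rule ae_eqI_inner[OF S TS[OF f(1)] g])
        (use f g L FL2 in \<open>simp add: Tin l2_inner_diff_left\<close>)
    then show ?thesis using f by blast
  qed
  have "T ` S \<subseteq> S" using TS by blast
  moreover have "\<exists>C. \<forall>f\<in>S. l2_norm M (T f) \<le> C * l2_norm M f" using up by blast
  ultimately have "l2_bounded_linear M S T"
    unfolding l2_bounded_linear_def using sub add cm by simp
  moreover have "\<exists>C. \<forall>f\<in>S. l2_norm M f \<le> C * l2_norm M (T f)" using low by blast
  ultimately have "l2_isomorphism M S T"
    unfolding l2_isomorphism_def using inj surj by simp
  then show ?thesis by (simp add: T_def[abs_def])
qed

section \<open>Continuity of translation\<close>

lemma lborel_integral_affine:
  fixes f :: "'a::euclidean_space \<Rightarrow> 'b::{banach, second_countable_topology}"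
  assumes c: "c \<noteq> 0"
  shows "integrable lborel (\<lambda>x. f (t + c *\<^sub>R x)) \<longleftrightarrow> integrable lborel f"
    and "(LINT x|lborel. f x) = \<bar>c\<bar> ^ DIM('a) *\<^sub>R (LINT x|lborel. f (t + c *\<^sub>R x))"
proof -
  have meas: "(\<lambda>x. f (t + c *\<^sub>R x)) \<in> borel_measurable borel \<longleftrightarrow> f \<in> borel_measurable borel"
  proof
    assume [measurable]: "(\<lambda>x. f (t + c *\<^sub>R x)) \<in> borel_measurable borel"
    have "(\<lambda>x. (\<lambda>y. f (t + c *\<^sub>R y)) ((1 / c) *\<^sub>R (x - t))) \<in> borel_measurable borel"
      by measurable
    then show "f \<in> borel_measurable borel" using c by simp
  next
    assume [measurable]: "f \<in> borel_measurable borel"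
    show "(\<lambda>x. f (t + c *\<^sub>R x)) \<in> borel_measurable borel" by measurable
  qed
  show int: "integrable lborel (\<lambda>x. f (t + c *\<^sub>R x)) \<longleftrightarrow> integrable lborel f"
  proof (cases "f \<in> borel_measurable borel")
    case [measurable]: True
    have "integrable lborel f \<longleftrightarrow> integrable (density (distr lborel borel (\<lambda>x. t + c *\<^sub>R x)) (\<lambda>_. \<bar>c\<bar>^DIM('a))) f"
      using lborel_affine[OF c, of t] by simp
    also have "\<dots> \<longleftrightarrow> integrable lborel (\<lambda>x. \<bar>c\<bar>^DIM('a) *\<^sub>R f (t + c *\<^sub>R x))"
      by (subst integrable_density) (auto simp: integrable_distr_eq)
    also have "\<dots> \<longleftrightarrow> integrable lborel (\<lambda>x. f (t + c *\<^sub>R x))"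
    proof
      assume "integrable lborel (\<lambda>x. \<bar>c\<bar>^DIM('a) *\<^sub>R f (t + c *\<^sub>R x))"
      then have "integrable lborel (\<lambda>x. inverse (\<bar>c\<bar>^DIM('a)) *\<^sub>R (\<bar>c\<bar>^DIM('a) *\<^sub>R f (t + c *\<^sub>R x)))"
        by (rule integrable_scaleR_right)
      then show "integrable lborel (\<lambda>x. f (t + c *\<^sub>R x))" using c by simp
    qed (rule integrable_scaleR_right)
    finally show ?thesis by simp
  next
    case False
    then show ?thesis using meas borel_measurable_integrable[of lborel f]
      borel_measurable_integrable[of lborel "\<lambda>x. f (t + c *\<^sub>R x)"] by auto
  qed
  show "(LINT x|lborel. f x) = \<bar>c\<bar> ^ DIM('a) *\<^sub>R (LINT x|lborel. f (t + c *\<^sub>R x))"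
  proof (cases "integrable lborel f")
    case True
    then have [measurable]: "f \<in> borel_measurable borel" using borel_measurable_integrable by force
    have "(LINT x|lborel. f x) = integral\<^sup>L (density (distr lborel borel (\<lambda>x. t + c *\<^sub>R x)) (\<lambda>_. \<bar>c\<bar>^DIM('a))) f"
      using lborel_affine[OF c, of t] by simp
    also have "\<dots> = \<bar>c\<bar> ^ DIM('a) *\<^sub>R (LINT x|lborel. f (t + c *\<^sub>R x))"
      by (subst integral_density) (auto simp: integral_distr)
    finally show ?thesis .
  next
    case False
    then show ?thesis using int by (simp add: not_integrable_integral_eq)
  qed
qed

lemma lborel_integral_translate:
  fixes f :: "'a::euclidean_space \<Rightarrow> 'b::{banach, second_countable_topology}"
  shows "integrable lborel (\<lambda>x. f (x - u)) \<longleftrightarrow> integrable lborel f"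
    and "(LINT x|lborel. f (x - u)) = (LINT x|lborel. f x)"
  using lborel_integral_affine[of 1 f "- u"] by simp_all

lemma lborel_nn_integral_affine:
  fixes f :: "'a::euclidean_space \<Rightarrow> ennreal"
  assumes c: "c \<noteq> 0" and [measurable]: "f \<in> borel_measurable borel"
  shows "(\<integral>\<^sup>+x. f x \<partial>lborel) = ennreal (\<bar>c\<bar> ^ DIM('a)) * (\<integral>\<^sup>+x. f (t + c *\<^sub>R x) \<partial>lborel)"
proof -
  have "(\<integral>\<^sup>+x. f x \<partial>lborel) = (\<integral>\<^sup>+x. f x \<partial>density (distr lborel borel (\<lambda>x. t + c *\<^sub>R x)) (\<lambda>_. \<bar>c\<bar>^DIM('a)))"
    using lborel_affine[OF c, of t] by simp
  also have "\<dots> = ennreal (\<bar>c\<bar> ^ DIM('a)) * (\<integral>\<^sup>+x. f (t + c *\<^sub>R x) \<partial>lborel)"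
    by (subst nn_integral_density) (auto simp: nn_integral_distr nn_integral_cmult)
  finally show ?thesis .
qed

lemma lborel_nn_integral_translate:
  fixes f :: "'a::euclidean_space \<Rightarrow> ennreal"
  assumes "f \<in> borel_measurable borel"
  shows "(\<integral>\<^sup>+x. f (x - u) \<partial>lborel) = (\<integral>\<^sup>+x. f x \<partial>lborel)"
  using lborel_nn_integral_affine[of 1 f "- u"] assms by simp

definition L1_shift_continuous :: "('a::euclidean_space \<Rightarrow> 'b::{banach, second_countable_topology}) \<Rightarrow> bool" where
  "L1_shift_continuous f \<longleftrightarrow> (\<forall>u. u \<longlonglongrightarrow> 0 \<longrightarrow>
     (\<lambda>k. LINT x|lborel. norm (f (x - u k) - f x)) \<longlonglongrightarrow> 0)"

text \<open>
  Shifts are isometries of \<open>L\<^sup>1\<close>, so continuity of translation passes to limits in the mean. It then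
  suffices to treat indicators of open sets: outer regularity extends the result to sets of finite
  measure, and linearity and density to all integrable functions.
\<close>

lemma L1_shift_continuous_approx:
  fixes f :: "'a::euclidean_space \<Rightarrow> 'b::{banach, second_countable_topology}"
  assumes f: "integrable lborel f"
    and approx: "\<And>e. 0 < e \<Longrightarrow> \<exists>g. integrable lborel g \<and> L1_shift_continuous g \<and> (LINT x|lborel. norm (g x - f x)) < e"
  shows "L1_shift_continuous f"
  unfolding L1_shift_continuous_def
proof (intro allI impI LIMSEQ_I)
  fix u :: "nat \<Rightarrow> 'a" and e :: real assume u: "u \<longlonglongrightarrow> 0" and e: "0 < e"
  obtain g where g: "integrable lborel g" "L1_shift_continuous g" and gf: "(LINT x|lborel. norm (g x - f x)) < e / 4"
    using approx[of "e / 4"] e by auto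
  have "(\<lambda>k. LINT x|lborel. norm (g (x - u k) - g x)) \<longlonglongrightarrow> 0"
    using g(2) u by (auto simp: L1_shift_continuous_def)
  from LIMSEQ_D[OF this, of "e / 4"] e obtain K
    where K: "\<And>k. k \<ge> K \<Longrightarrow> \<bar>LINT x|lborel. norm (g (x - u k) - g x)\<bar> < e / 4" by auto
  have "norm ((LINT x|lborel. norm (f (x - u k) - f x)) - 0) < e" if "k \<ge> K" for k
  proof -
    have sh: "integrable lborel (\<lambda>x. f (x - u k))" "integrable lborel (\<lambda>x. g (x - u k))"
      using f g by (simp_all add: lborel_integral_translate)
    have "(LINT x|lborel. norm (f (x - u k) - f x)) \<le>
       (LINT x|lborel. norm (g (x - u k) - f (x - u k)) + norm (g (x - u k) - g x) + norm (g x - f x))"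
    proof (rule integral_mono)
      fix x
      have "f (x - u k) - f x = - (g (x - u k) - f (x - u k)) + (g (x - u k) - g x) + (g x - f x)" by simp
      then show "norm (f (x - u k) - f x) \<le> norm (g (x - u k) - f (x - u k)) + norm (g (x - u k) - g x) + norm (g x - f x)"
        by (metis (no_types, lifting) add_mono_thms_linordered_semiring(3) norm_minus_cancel norm_triangle_ineq norm_triangle_le order_trans)
    qed (use f g sh in auto)
    also have "\<dots> = (LINT x|lborel. norm (g (x - u k) - f (x - u k))) + (LINT x|lborel. norm (g (x - u k) - g x))
        + (LINT x|lborel. norm (g x - f x))"
      using f g sh by simp
    also have "(LINT x|lborel. norm (g (x - u k) - f (x - u k))) = (LINT x|lborel. norm (g x - f x))"
      by (rule lborel_integral_translate(2)[of "\<lambda>x. norm (g x - f x)" "u k"])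
    finally show ?thesis using gf K[OF that] e by simp
  qed
  then show "\<exists>no. \<forall>k\<ge>no. norm ((LINT x|lborel. norm (f (x - u k) - f x)) - 0) < e" by blast
qed

text \<open>
  For an open set, \<open>indicator U (x - u k)\<close> is eventually \<open>1\<close> at every \<open>x \<in> U\<close>, so the overlap of
  \<open>U\<close> with its translates tends to the full measure; the \<open>L\<^sup>1\<close> distance is twice the defect.
\<close>

lemma L1_shift_continuous_open:
  fixes U :: "'a::euclidean_space set"
  assumes U: "open U" and fin: "emeasure lborel U < \<infinity>"
  shows "L1_shift_continuous (indicator U :: 'a \<Rightarrow> real)"
  unfolding L1_shift_continuous_def
proof (intro allI impI)
  fix u :: "nat \<Rightarrow> 'a" assume u: "u \<longlonglongrightarrow> 0"
  have [measurable]: "U \<in> sets borel" using U by simp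
  have int: "integrable lborel (indicator U :: 'a \<Rightarrow> real)" using fin by simp
  have ints: "integrable lborel (\<lambda>x. indicator U (x - u k) :: real)" for k
    using lborel_integral_translate(1)[of "indicator U :: 'a \<Rightarrow> real" "u k"] int by simp
  have intp: "integrable lborel (\<lambda>x. indicator U (x - u k) * indicator U x :: real)" for k
    by (rule Bochner_Integration.integrable_bound[OF int]) (auto simp: indicator_def)
  have "(\<lambda>k. LINT x|lborel. indicator U (x - u k) * indicator U x :: real) \<longlonglongrightarrow> (LINT x|lborel. indicator U x)"
  proof (rule integral_dominated_convergence[where w="indicator U"])
    show "AE x in lborel. (\<lambda>k. indicator U (x - u k) * indicator U x :: real) \<longlonglongrightarrow> indicator U x"
    proof (rule AE_I2)
      fix x
      show "(\<lambda>k. indicator U (x - u k) * indicator U x :: real) \<longlonglongrightarrow> indicator U x"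
      proof (cases "x \<in> U")
        case True
        have "(\<lambda>k. x - u k) \<longlonglongrightarrow> x - 0" using u by (intro tendsto_intros)
        then have "\<forall>\<^sub>F k in sequentially. x - u k \<in> U" using U True by (simp add: topological_tendstoD)
        then have "\<forall>\<^sub>F k in sequentially. indicator U (x - u k) * indicator U x = (indicator U x :: real)"
          by eventually_elim (use True in simp)
        then show ?thesis by (rule tendsto_eventually)
      qed simp
    qed
  qed (use int in \<open>auto simp: indicator_def\<close>)
  then have "(\<lambda>k. 2 * (LINT x|lborel. indicator U x) - 2 * (LINT x|lborel. indicator U (x - u k) * indicator U x :: real))
      \<longlonglongrightarrow> 2 * (LINT x|lborel. indicator U x) - 2 * (LINT x|lborel. indicator U x)"
    by (intro tendsto_intros)
  moreover have "(LINT x|lborel. norm (indicator U (x - u k) - indicator U x :: real)) =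
     2 * (LINT x|lborel. indicator U x) - 2 * (LINT x|lborel. indicator U (x - u k) * indicator U x)" for k
  proof -
    have "(LINT x|lborel. norm (indicator U (x - u k) - indicator U x :: real)) =
       (LINT x|lborel. indicator U (x - u k) + indicator U x - 2 * (indicator U (x - u k) * indicator U x))"
      by (intro Bochner_Integration.integral_cong) (auto simp: indicator_def)
    also have "\<dots> = (LINT x|lborel. indicator U (x - u k)) + (LINT x|lborel. indicator U x)
         - 2 * (LINT x|lborel. indicator U (x - u k) * indicator U x)"
      using int ints[of k] intp[of k]
      by (simp del: Bochner_Integration.integral_indicator integrable_indicator_iff)
    also have "(LINT x|lborel. indicator U (x - u k)) = (LINT x|lborel. indicator U x :: real)"
      by (rule lborel_integral_translate(2))
    finally show ?thesis by simp
  qed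
  ultimately show "(\<lambda>k. LINT x|lborel. norm (indicator U (x - u k) - indicator U x :: real)) \<longlonglongrightarrow> 0"
    by (simp del: Bochner_Integration.integral_indicator)
qed

lemma L1_shift_continuous_indicator:
  fixes A :: "'a::euclidean_space set"
  assumes A [measurable]: "A \<in> sets borel" and fin: "emeasure lborel A < \<infinity>"
  shows "L1_shift_continuous (indicator A :: 'a \<Rightarrow> real)"
proof (rule L1_shift_continuous_approx)
  show "integrable lborel (indicator A :: 'a \<Rightarrow> real)" using fin by simp
  fix e :: real assume "0 < e"
  then obtain U where U: "open U" "A \<subseteq> U" "emeasure lborel (U - A) < e"
    using outer_regular_lborel[OF A] by blast
  have [measurable]: "U \<in> sets borel" using U by simp
  have "emeasure lborel U = emeasure lborel A + emeasure lborel (U - A)"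
    using U by (subst plus_emeasure) (auto intro!: arg_cong[where f="emeasure lborel"])
  also have "\<dots> < \<infinity>" using fin U(3) by (auto simp: less_top[symmetric])
  finally have finU: "emeasure lborel U < \<infinity>" .
  have "(LINT x|lborel. norm (indicator U x - indicator A x :: real)) = (LINT x|lborel. indicator (U - A) x)"
    using U by (intro Bochner_Integration.integral_cong) (auto simp: indicator_def)
  also have "\<dots> = measure lborel (U - A)" by simp
  also have "\<dots> < e" using U(3) \<open>0 < e\<close>
    by (metis emeasure_eq_ennreal_measure ennreal_less_iff less_top measure_nonneg order_less_trans ennreal_less_top)
  finally have "(LINT x|lborel. norm (indicator U x - indicator A x :: real)) < e" .
  then show "\<exists>g. integrable lborel g \<and> L1_shift_continuous g \<and> (LINT x|lborel. norm (g x - indicator A x :: real)) < e"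
    using L1_shift_continuous_open[OF U(1) finU] finU by (intro exI[of _ "indicator U"]) auto
qed

lemma integrable_imp_L1_shift_continuous:
  fixes f :: "'a::euclidean_space \<Rightarrow> 'b::{banach, second_countable_topology}"
  assumes "integrable lborel f"
  shows "L1_shift_continuous f"
  using assms
proof induction
  case (base A c)
  have A: "L1_shift_continuous (indicator A :: 'a \<Rightarrow> real)"
    using base by (intro L1_shift_continuous_indicator) auto
  show ?case
    unfolding L1_shift_continuous_def
  proof (intro allI impI)
    fix u :: "nat \<Rightarrow> 'a" assume "u \<longlonglongrightarrow> 0"
    then have "(\<lambda>k. (LINT x|lborel. norm (indicator A (x - u k) - indicator A x :: real)) * norm c) \<longlonglongrightarrow> 0 * norm c"
      using A unfolding L1_shift_continuous_def by (intro tendsto_intros) blast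
    then show "(\<lambda>k. LINT x|lborel. norm (indicator A (x - u k) *\<^sub>R c - indicator A x *\<^sub>R c)) \<longlonglongrightarrow> 0"
      by (simp flip: scaleR_left_diff_distrib)
  qed
next
  case (add f g)
  show ?case
    unfolding L1_shift_continuous_def
  proof (intro allI impI)
    fix u :: "nat \<Rightarrow> 'a" assume "u \<longlonglongrightarrow> 0"
    then have *: "(\<lambda>k. (LINT x|lborel. norm (f (x - u k) - f x)) + (LINT x|lborel. norm (g (x - u k) - g x))) \<longlonglongrightarrow> 0 + 0"
      using add unfolding L1_shift_continuous_def by (intro tendsto_intros) blast+
    show "(\<lambda>k. LINT x|lborel. norm (f (x - u k) + g (x - u k) - (f x + g x))) \<longlonglongrightarrow> 0"
    proof (rule tendsto_sandwich[OF _ _ tendsto_const *[simplified]])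
      show "\<forall>\<^sub>F k in sequentially. (LINT x|lborel. norm (f (x - u k) + g (x - u k) - (f x + g x)))
          \<le> (LINT x|lborel. norm (f (x - u k) - f x)) + (LINT x|lborel. norm (g (x - u k) - g x))"
      proof (rule always_eventually, rule allI)
        fix k
        have sh: "integrable lborel (\<lambda>x. f (x - u k))" "integrable lborel (\<lambda>x. g (x - u k))"
          using add by (simp_all add: lborel_integral_translate)
        have "(LINT x|lborel. norm (f (x - u k) + g (x - u k) - (f x + g x)))
          \<le> (LINT x|lborel. norm (f (x - u k) - f x) + norm (g (x - u k) - g x))"
          using sh add by (intro integral_mono) (auto intro: norm_diff_triangle_ineq)
        then show "(LINT x|lborel. norm (f (x - u k) + g (x - u k) - (f x + g x)))
          \<le> (LINT x|lborel. norm (f (x - u k) - f x)) + (LINT x|lborel. norm (g (x - u k) - g x))"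
          using sh add by simp
      qed
    qed (auto intro!: always_eventually)
  qed
next
  case (lim f s)
  show ?case
  proof (rule L1_shift_continuous_approx)
    fix e :: real assume e: "0 < e"
    have [measurable]: "s i \<in> borel_measurable borel" "f \<in> borel_measurable borel" for i
      using lim borel_measurable_integrable[of lborel] by force+
    have "(\<lambda>i. LINT x|lborel. norm (s i x - f x)) \<longlonglongrightarrow> (LINT x|(lborel :: 'a measure). (0::real))"
    proof (rule integral_dominated_convergence[where w="\<lambda>x. 3 * norm (f x)"])
      show "AE x in lborel. (\<lambda>i. norm (s i x - f x)) \<longlonglongrightarrow> 0"
        using lim by (intro AE_I2) (auto intro!: tendsto_norm_zero LIM_zero)
      show "AE x in lborel. norm (norm (s i x - f x)) \<le> 3 * norm (f x)" for i
      proof (rule AE_I2)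
        fix x
        have "norm (s i x) \<le> 2 * norm (f x)" using lim by simp
        then show "norm (norm (s i x - f x)) \<le> 3 * norm (f x)"
          using norm_triangle_ineq4[of "s i x" "f x"] by simp
      qed
    qed (use lim in auto)
    from LIMSEQ_D[OF this e] obtain i where "norm ((LINT x|lborel. norm (s i x - f x)) - 0) < e"
      by auto
    then show "\<exists>g. integrable lborel g \<and> L1_shift_continuous g \<and> (LINT x|lborel. norm (g x - f x)) < e"
      using lim by (intro exI[of _ "s i"]) auto
  qed (use lim in simp)
qed

text \<open>
  The map \<open>a \<mapsto> |a| a\<close> is strongly monotone. It carries \<open>L\<^sup>2\<close> into \<open>L\<^sup>1\<close>, and this inequality
  brings continuity of translation back from \<open>L\<^sup>1\<close> to \<open>L\<^sup>2\<close>.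
\<close>

lemma norm_diff_square_le:
  fixes a b :: "'a::real_inner"
  shows "(norm (a - b))\<^sup>2 \<le> 2 * norm (norm a *\<^sub>R a - norm b *\<^sub>R b)"
proof (cases "a = b")
  case False
  have ab: "2 * (a \<bullet> b) = (norm a)\<^sup>2 + (norm b)\<^sup>2 - (norm (a - b))\<^sup>2"
    by (simp add: power2_norm_eq_inner inner_diff inner_commute)
  have "norm (a - b) * (norm (a - b))\<^sup>2 \<le> (norm a + norm b) * (norm (a - b))\<^sup>2"
    by (intro mult_right_mono norm_triangle_ineq4) simp
  also have "\<dots> \<le> (norm a + norm b) * (norm a - norm b)\<^sup>2 + (norm a + norm b) * (norm (a - b))\<^sup>2"
    by simp
  also have "\<dots> = 2 * ((norm a) ^ 3 + (norm b) ^ 3) - (norm a + norm b) * (2 * (a \<bullet> b))"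
    unfolding ab by (simp add: power2_eq_square power3_eq_cube algebra_simps)
  also have "\<dots> = 2 * ((norm a *\<^sub>R a - norm b *\<^sub>R b) \<bullet> (a - b))"
    by (simp add: inner_diff inner_commute[of b a] algebra_simps power3_eq_cube flip: power2_norm_eq_inner)
       (simp add: power2_eq_square)
  also have "\<dots> \<le> 2 * (norm (norm a *\<^sub>R a - norm b *\<^sub>R b) * norm (a - b))"
    using norm_cauchy_schwarz by auto
  finally have "norm (a - b) * (norm (a - b))\<^sup>2 \<le> norm (a - b) * (2 * norm (norm a *\<^sub>R a - norm b *\<^sub>R b))"
    by (simp add: mult_ac)
  then show ?thesis using False by simp
qed simp

lemma L2_shift:
  fixes f :: "'a::euclidean_space \<Rightarrow> complex"
  assumes "f \<in> L2 lborel"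
  shows "(\<lambda>x. f (x - u)) \<in> L2 lborel" "sq_norm lborel (\<lambda>x. f (x - u)) = sq_norm lborel f"
  using assms lborel_integral_translate[of "\<lambda>x. (cmod (f x))\<^sup>2" u]
  by (auto simp: L2_def sq_norm_def)

lemma L2_shift_continuous:
  fixes f :: "'a::euclidean_space \<Rightarrow> complex"
  assumes f: "f \<in> L2 lborel" and u: "u \<longlonglongrightarrow> 0"
  shows "(\<lambda>k. sq_norm lborel (\<lambda>x. f (x - u k) - f x)) \<longlonglongrightarrow> 0"
proof -
  have [measurable]: "f \<in> borel_measurable borel" using f by (auto simp: L2_def)
  let ?g = "\<lambda>x. norm (f x) *\<^sub>R f x"
  have g: "integrable lborel ?g"
    by (rule Bochner_Integration.integrable_bound[OF L2_integrable[OF f]]) (auto simp: power2_eq_square)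
  have "L1_shift_continuous ?g" using g by (rule integrable_imp_L1_shift_continuous)
  then have "(\<lambda>k. 2 * (LINT x|lborel. norm (?g (x - u k) - ?g x))) \<longlonglongrightarrow> 2 * 0"
    using u unfolding L1_shift_continuous_def by (intro tendsto_intros) blast
  then have *: "(\<lambda>k. 2 * (LINT x|lborel. norm (?g (x - u k) - ?g x))) \<longlonglongrightarrow> 0" by simp
  show ?thesis
  proof (rule tendsto_sandwich[OF _ _ tendsto_const *])
    show "\<forall>\<^sub>F k in sequentially. sq_norm lborel (\<lambda>x. f (x - u k) - f x) \<le> 2 * (LINT x|lborel. norm (?g (x - u k) - ?g x))"
    proof (rule always_eventually, rule allI)
      fix k
      have gs: "integrable lborel (\<lambda>x. ?g (x - u k))" using g lborel_integral_translate(1)[of ?g "u k"] by simp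
      have "sq_norm lborel (\<lambda>x. f (x - u k) - f x) \<le> (LINT x|lborel. 2 * norm (?g (x - u k) - ?g x))"
        unfolding sq_norm_def
        by (intro integral_mono norm_diff_square_le L2_integrable L2_diff L2_shift f
            integrable_mult_right integrable_norm Bochner_Integration.integrable_diff g gs)
      then show "sq_norm lborel (\<lambda>x. f (x - u k) - f x) \<le> 2 * (LINT x|lborel. norm (?g (x - u k) - ?g x))"
        by simp
    qed
  qed simp
qed

section \<open>The Fourier transform of the Gaussian\<close>

definition gaussian :: "'a::euclidean_space \<Rightarrow> real" where
  "gaussian x = exp (- pi * (norm x)\<^sup>2)"

definition fourier :: "('a::euclidean_space \<Rightarrow> complex) \<Rightarrow> 'a \<Rightarrow> complex" where
  "fourier f \<omega> = (LINT t|lborel. f t * cis (- 2 * pi * (\<omega> \<bullet> t)))"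

lemma borel_measurable_cis [measurable (raw)]:
  "f \<in> borel_measurable M \<Longrightarrow> (\<lambda>x. cis (f x)) \<in> borel_measurable M"
  by (rule borel_measurable_continuous_on[of cis]) (intro continuous_intros)

lemma gaussian_measurable [measurable]: "gaussian \<in> borel_measurable borel"
  unfolding gaussian_def by measurable

lemma gaussian_nonneg: "0 \<le> gaussian x"
  by (simp add: gaussian_def)

lemma gaussian_prod: "gaussian x = (\<Prod>b\<in>Basis. gaussian (x \<bullet> b))"
proof -
  have "(norm x)\<^sup>2 = x \<bullet> x" by (rule power2_norm_eq_inner)
  also have "\<dots> = (\<Sum>b\<in>Basis. (x \<bullet> b)\<^sup>2)"
    by (subst euclidean_inner) (simp add: power2_eq_square)
  finally have "(norm x)\<^sup>2 = (\<Sum>b\<in>Basis. (x \<bullet> b)\<^sup>2)" .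
  then show ?thesis by (simp add: gaussian_def sum_distrib_left exp_sum[symmetric] sum_negf)
qed

lemma cis_prod: "finite A \<Longrightarrow> cis (\<Sum>b\<in>A. f b) = (\<Prod>b\<in>A. cis (f b))"
  by (induction A rule: finite_induct) (auto simp flip: cis_mult)

text \<open>
  Lebesgue measure is the image of the product of its one-dimensional factors under the coordinates
  of the standard basis.
\<close>

lemma lborel_integral_prod:
  fixes f :: "'a::euclidean_space \<Rightarrow> real \<Rightarrow> complex"
  assumes "\<And>b. b \<in> Basis \<Longrightarrow> integrable lborel (f b)"
  shows "integrable lborel (\<lambda>x::'a. \<Prod>b\<in>Basis. f b (x \<bullet> b))"
    and "(LINT x|lborel. (\<Prod>b\<in>Basis. f b (x \<bullet> b))) = (\<Prod>b\<in>Basis. (LINT x|lborel. f b x))"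
proof -
  interpret product_sigma_finite "\<lambda>_::'a. lborel :: real measure" ..
  have [measurable]: "f b \<in> borel_measurable borel" if "b \<in> Basis" for b
    using borel_measurable_integrable[OF assms[OF that]] by simp
  have meas: "(\<lambda>x::'a. \<Prod>b\<in>Basis. f b (x \<bullet> b)) \<in> borel_measurable borel"
    by measurable
  have T: "(\<lambda>x. \<Sum>b\<in>Basis. x b *\<^sub>R b) \<in> measurable (\<Pi>\<^sub>M (b::'a)\<in>Basis. (lborel :: real measure)) borel"
    by simp
  have eq: "(\<Prod>b\<in>Basis. f b ((\<Sum>c\<in>Basis. x c *\<^sub>R c) \<bullet> b)) = (\<Prod>b\<in>Basis. f b (x b))" for x :: "'a \<Rightarrow> real"
    by (intro prod.cong refl) (simp add: inner_sum_left_Basis)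
  have D: "(lborel :: 'a measure) = distr (\<Pi>\<^sub>M (b::'a)\<in>Basis. lborel) borel (\<lambda>x. \<Sum>b\<in>Basis. x b *\<^sub>R b)"
    by (rule lborel_eq)
  show "integrable lborel (\<lambda>x::'a. \<Prod>b\<in>Basis. f b (x \<bullet> b))"
    unfolding D integrable_distr_eq[OF T meas] eq
    by (rule product_integrable_prod) (use assms in auto)
  show "(LINT x|lborel. (\<Prod>b\<in>Basis. f b (x \<bullet> b))) = (\<Prod>b\<in>Basis. (LINT x|lborel. f b x))"
    unfolding D integral_distr[OF T meas] eq
    by (rule product_integral_prod) (use assms in auto)
qed

text \<open>
  This is the characteristic function of the standard normal distribution, rescaled by
  \<open>sqrt (2 * pi)\<close>.
\<close>

lemma gaussian_fourier_real:
  fixes u :: real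
  shows "integrable lborel (\<lambda>x::real. gaussian x)"
    and "(LINT x|lborel. complex_of_real (gaussian x) * cis (- 2 * pi * (u * x))) = complex_of_real (gaussian u)"
proof -
  let ?c = "sqrt (2 * pi)"
  have c: "?c > 0" by simp
  have dens: "std_normal_density (?c * x) = gaussian x / ?c" for x
    by (simp add: std_normal_density_def gaussian_def power_mult_distrib)
  have int: "integrable lborel (\<lambda>x. std_normal_density x)" by simp
  then have "integrable lborel (\<lambda>x. std_normal_density (0 + ?c * x))"
    by (subst lborel_integrable_real_affine_iff) simp_all
  then have "integrable lborel (\<lambda>x. ?c * std_normal_density (0 + ?c * x))"
    by (rule integrable_mult_right)
  then show "integrable lborel (\<lambda>x::real. gaussian x)" by (simp add: dens)
  have "complex_of_real (exp (- (- ?c * u)\<^sup>2 / 2)) = char std_normal_distribution (- ?c * u)"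
    by (simp add: char_std_normal_distribution)
  also have "\<dots> = (LINT x|lborel. std_normal_density x *\<^sub>R iexp ((- ?c * u) * x))"
    unfolding char_def by (subst integral_density) auto
  also have "\<dots> = \<bar>?c\<bar> *\<^sub>R (LINT x|lborel. std_normal_density (0 + ?c * x) *\<^sub>R iexp ((- ?c * u) * (0 + ?c * x)))"
    by (rule lborel_integral_real_affine) simp
  also have "\<dots> = (LINT x|lborel. ?c *\<^sub>R (std_normal_density (0 + ?c * x) *\<^sub>R iexp ((- ?c * u) * (0 + ?c * x))))"
    unfolding integral_scaleR_right by simp
  also have "\<dots> = (LINT x|lborel. complex_of_real (gaussian x) * cis (- 2 * pi * (u * x)))"
  proof (intro Bochner_Integration.integral_cong refl)
    fix x
    have "(- ?c * u) * (0 + ?c * x) = - ((?c * ?c) * (u * x))" by (simp only: algebra_simps)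
    also have "\<dots> = - 2 * pi * (u * x)" by simp
    finally have *: "(- ?c * u) * (0 + ?c * x) = - 2 * pi * (u * x)" .
    have **: "?c *\<^sub>R (std_normal_density (0 + ?c * x) *\<^sub>R z) = complex_of_real (gaussian x) * z" for z :: complex
      using c by (simp add: dens scaleR_conv_of_real)
    show "?c *\<^sub>R (std_normal_density (0 + ?c * x) *\<^sub>R iexp ((- ?c * u) * (0 + ?c * x)))
       = complex_of_real (gaussian x) * cis (- 2 * pi * (u * x))"
      unfolding ** * cis_conv_exp by simp
  qed
  finally show "(LINT x|lborel. complex_of_real (gaussian x) * cis (- 2 * pi * (u * x))) = complex_of_real (gaussian u)"
    by (simp add: gaussian_def power_mult_distrib)
qed

lemma gaussian_integrable: "integrable lborel (gaussian :: 'a::euclidean_space \<Rightarrow> real)"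
  and fourier_gaussian: "fourier (\<lambda>x. complex_of_real (gaussian x)) u = complex_of_real (gaussian (u :: 'a))"
proof -
  have int: "integrable lborel (\<lambda>x. complex_of_real (gaussian x) * cis (a * x))" for a :: real
    by (rule Bochner_Integration.integrable_bound[OF gaussian_fourier_real(1)])
       (auto simp: norm_mult gaussian_nonneg)
  have eq: "complex_of_real (gaussian x) * cis (- 2 * pi * (u \<bullet> x)) =
     (\<Prod>b\<in>Basis. complex_of_real (gaussian (x \<bullet> b)) * cis (- 2 * pi * ((u \<bullet> b) * (x \<bullet> b))))" for u x :: 'a
  proof -
    have "- 2 * pi * (u \<bullet> x) = (\<Sum>b\<in>Basis. - 2 * pi * ((u \<bullet> b) * (x \<bullet> b)))"
      by (subst euclidean_inner[of u x]) (simp only: sum_distrib_left)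
    then have "cis (- 2 * pi * (u \<bullet> x)) = (\<Prod>b\<in>Basis. cis (- 2 * pi * ((u \<bullet> b) * (x \<bullet> b))))"
      by (simp only: cis_prod[OF finite_Basis])
    then show ?thesis by (subst gaussian_prod) (simp add: prod.distrib)
  qed
  have int': "integrable lborel (\<lambda>x::'a. complex_of_real (gaussian x) * cis (- 2 * pi * (u \<bullet> x)))" for u
    unfolding eq by (rule lborel_integral_prod(1)) (use int[of "- 2 * pi * (u \<bullet> b)" for b] in \<open>simp add: mult.assoc\<close>)
  have "integrable lborel (\<lambda>x::'a. complex_of_real (gaussian x))"
    using int'[of 0] by simp
  then show "integrable lborel (gaussian :: 'a \<Rightarrow> real)"
    by (simp add: complex_of_real_integrable_eq)
  have "fourier (\<lambda>x. complex_of_real (gaussian x)) u =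
      (\<Prod>b\<in>Basis. (LINT x|lborel. complex_of_real (gaussian x) * cis (- 2 * pi * ((u \<bullet> b) * x))))"
    unfolding fourier_def eq
    by (rule lborel_integral_prod(2)) (use int[of "- 2 * pi * (u \<bullet> b)" for b] in \<open>simp add: mult.assoc\<close>)
  also have "\<dots> = (\<Prod>b\<in>Basis. complex_of_real (gaussian (u \<bullet> b)))"
    by (intro prod.cong refl gaussian_fourier_real(2))
  also have "\<dots> = complex_of_real (gaussian u)" by (subst gaussian_prod[of u]) simp
  finally show "fourier (\<lambda>x. complex_of_real (gaussian x)) u = complex_of_real (gaussian u)" .
qed

lemma integral_gaussian: "(LINT x|lborel. gaussian (x :: 'a::euclidean_space)) = 1"
proof -
  have "complex_of_real (LINT x|lborel. gaussian (x :: 'a)) = fourier (\<lambda>x. complex_of_real (gaussian x)) (0 :: 'a)"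
    by (simp add: fourier_def)
  also have "\<dots> = 1" unfolding fourier_gaussian by (simp add: gaussian_def)
  finally show ?thesis by simp
qed

section \<open>Plancherel for integrable functions\<close>

lemma fourier_measurable:
  fixes f :: "'a::euclidean_space \<Rightarrow> complex"
  assumes [measurable]: "f \<in> borel_measurable borel"
  shows "fourier f \<in> borel_measurable borel"
proof -
  have "(\<lambda>\<omega>. LINT t|lborel. f t * cis (- 2 * pi * (\<omega> \<bullet> t))) \<in> borel_measurable lborel"
    by (rule lborel.borel_measurable_lebesgue_integral) measurable
  then show ?thesis by (simp add: fourier_def[abs_def])
qed

lemma fourier_bound: "cmod (fourier f \<omega>) \<le> (LINT t|lborel. cmod (f t))"
  unfolding fourier_def by (rule order_trans[OF integral_norm_bound]) (simp add: norm_mult)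

text \<open>
  Without damping, the double integral for \<open>|fourier f \<omega>|\<^sup>2\<close> may not be integrated over \<open>\<omega>\<close>. With
  the factor \<open>gaussian (e *\<^sub>R \<omega>)\<close> Fubini applies, the \<open>\<omega>\<close>-integral is a Gaussian of width \<open>e\<close> in
  \<open>s - t\<close>, and substituting \<open>t = s - e *\<^sub>R v\<close> leaves an average of autocorrelations of \<open>f\<close> at
  distances of order \<open>e\<close>.
\<close>

lemma fourier_energy_damped:
  fixes f :: "'a::euclidean_space \<Rightarrow> complex"
  assumes f: "integrable lborel f" and f2: "f \<in> L2 lborel" and e: "0 < e"
  shows "integrable lborel (\<lambda>\<omega>. gaussian (e *\<^sub>R \<omega>) * (cmod (fourier f \<omega>))\<^sup>2)"
    and "complex_of_real (LINT \<omega>|lborel. gaussian (e *\<^sub>R \<omega>) * (cmod (fourier f \<omega>))\<^sup>2)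
      = (LINT v|lborel. complex_of_real (gaussian v) * l2_inner lborel f (\<lambda>s. f (s - e *\<^sub>R v)))"
proof -
  let ?e = "\<lambda>\<omega> p. cis (- 2 * pi * (\<omega> \<bullet> (fst p - snd p)))"
  let ?k = "\<lambda>u. complex_of_real (gaussian ((1 / e) *\<^sub>R u) / e ^ DIM('a))"
  have [measurable]: "f \<in> borel_measurable borel" using borel_measurable_integrable[OF f] by simp
  note [measurable] = fourier_measurable
  define g where "g \<omega> = complex_of_real (gaussian (e *\<^sub>R \<omega>))" for \<omega> :: 'a
  have [measurable]: "g \<in> borel_measurable borel" unfolding g_def by measurable
  have gaussint: "integrable lborel (\<lambda>\<omega>::'a. gaussian (e *\<^sub>R \<omega>))"
    using lborel_integral_affine(1)[of e "gaussian :: 'a \<Rightarrow> real" 0] e gaussian_integrable by simp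
  have gint: "integrable lborel g" unfolding g_def using gaussint by (simp add: complex_of_real_integrable_eq)
  define B where "B = (LINT t|lborel. cmod (f t))"
  show dint: "integrable lborel (\<lambda>\<omega>. gaussian (e *\<^sub>R \<omega>) * (cmod (fourier f \<omega>))\<^sup>2)"
  proof (rule Bochner_Integration.integrable_bound)
    show "integrable lborel (\<lambda>\<omega>::'a. B\<^sup>2 * gaussian (e *\<^sub>R \<omega>))" using gaussint by simp
    have "(cmod (fourier f \<omega>))\<^sup>2 \<le> B\<^sup>2" for \<omega>
      unfolding B_def by (intro power_mono fourier_bound) simp
    then show "AE \<omega> in lborel. norm (gaussian (e *\<^sub>R \<omega>) * (cmod (fourier f \<omega>))\<^sup>2) \<le> norm (B\<^sup>2 * gaussian (e *\<^sub>R \<omega>))"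
      by (auto simp: abs_mult gaussian_nonneg mult.commute intro!: mult_left_mono)
  qed measurable
  define \<Phi> where "\<Phi> p = f (fst p) * cnj (f (snd p))" for p :: "'a \<times> 'a"
  have \<Phi>m [measurable]: "\<Phi> \<in> borel_measurable (borel \<Otimes>\<^sub>M borel)" unfolding \<Phi>_def by measurable
  have fc: "integrable lborel (\<lambda>t. cnj (f t))" using f by simp
  have \<Phi>: "integrable (lborel \<Otimes>\<^sub>M lborel) \<Phi>"
    unfolding \<Phi>_def
  proof (rule lborel_pair.Fubini_integrable)
    show "integrable lborel (\<lambda>x. LINT y|lborel. norm (f (fst (x, y)) * cnj (f (snd (x, y)))))"
      using f by (simp add: norm_mult)
    show "AE x in lborel. integrable lborel (\<lambda>y. f (fst (x, y)) * cnj (f (snd (x, y))))"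
      using fc by simp
  qed measurable
  have sq: "complex_of_real ((cmod (fourier f \<omega>))\<^sup>2) =
      (LINT p|(lborel \<Otimes>\<^sub>M lborel). \<Phi> p * ?e \<omega> p)" for \<omega>
  proof -
    have bd: "integrable (lborel \<Otimes>\<^sub>M lborel) (\<lambda>p. \<Phi> p * ?e \<omega> p)"
      by (rule Bochner_Integration.integrable_bound[OF \<Phi>]) (auto simp: norm_mult)
    have "(LINT p|(lborel \<Otimes>\<^sub>M lborel). \<Phi> p * ?e \<omega> p) =
       (LINT s|lborel. LINT t|lborel. \<Phi> (s, t) * cis (- 2 * pi * (\<omega> \<bullet> (fst (s, t) - snd (s, t)))))"
      by (rule lborel_pair.integral_fst'[OF bd, symmetric])
    also have "\<dots> = (LINT s|lborel. LINT t|lborel. (f s * cis (- 2 * pi * (\<omega> \<bullet> s))) * cnj (f t * cis (- 2 * pi * (\<omega> \<bullet> t))))"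
    proof (intro Bochner_Integration.integral_cong refl)
      fix s t
      have "cis (- 2 * pi * (\<omega> \<bullet> (s - t))) = cis (- 2 * pi * (\<omega> \<bullet> s)) * cnj (cis (- 2 * pi * (\<omega> \<bullet> t)))"
        by (simp add: cis_cnj cis_mult inner_diff_right algebra_simps)
      then show "\<Phi> (s, t) * cis (- 2 * pi * (\<omega> \<bullet> (fst (s, t) - snd (s, t)))) =
          (f s * cis (- 2 * pi * (\<omega> \<bullet> s))) * cnj (f t * cis (- 2 * pi * (\<omega> \<bullet> t)))"
        by (simp add: \<Phi>_def)
    qed
    also have "\<dots> = fourier f \<omega> * cnj (fourier f \<omega>)"
      unfolding fourier_def by (simp only: integral_mult_right_zero integral_mult_left_zero Bochner_Integration.integral_cnj)
    also have "\<dots> = complex_of_real ((cmod (fourier f \<omega>))\<^sup>2)"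
      by (rule complex_norm_square[symmetric])
    finally show ?thesis by simp
  qed
  interpret lp: pair_sigma_finite "lborel \<Otimes>\<^sub>M lborel :: ('a \<times> 'a) measure" "lborel :: 'a measure"
    by unfold_locales
  have triple: "integrable ((lborel \<Otimes>\<^sub>M lborel) \<Otimes>\<^sub>M lborel)
     (\<lambda>(p, \<omega>). \<Phi> p * (g \<omega> * ?e \<omega> p))"
  proof (rule lp.Fubini_integrable)
    have "(LINT \<omega>|lborel. norm (\<Phi> p * (g \<omega> * ?e \<omega> p))) = norm (\<Phi> p) * (LINT \<omega>|lborel. norm (g \<omega>))" for p
      by (simp add: norm_mult)
    then show "integrable (lborel \<Otimes>\<^sub>M lborel) (\<lambda>p. LINT \<omega>|lborel. norm (case (p, \<omega>) of (p, \<omega>) \<Rightarrow> \<Phi> p * (g \<omega> * ?e \<omega> p)))"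
      using \<Phi> by simp
    have "integrable lborel (\<lambda>\<omega>. \<Phi> p * (g \<omega> * ?e \<omega> p))" for p
      by (intro integrable_mult_right Bochner_Integration.integrable_bound[OF gint]) (auto simp: norm_mult)
    then show "AE p in lborel \<Otimes>\<^sub>M lborel. integrable lborel (\<lambda>\<omega>. case (p, \<omega>) of (p, \<omega>) \<Rightarrow> \<Phi> p * (g \<omega> * ?e \<omega> p))"
      by simp
  qed measurable
  have gft: "(LINT \<omega>|lborel. g \<omega> * cis (- 2 * pi * (\<omega> \<bullet> u))) = ?k u" for u
  proof -
    have "complex_of_real (gaussian ((1 / e) *\<^sub>R u)) = (LINT t|lborel. complex_of_real (gaussian t) * cis (- 2 * pi * (((1 / e) *\<^sub>R u) \<bullet> t)))"
      by (rule fourier_gaussian[symmetric, unfolded fourier_def])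
    also have "\<dots> = \<bar>e\<bar> ^ DIM('a) *\<^sub>R (LINT t|lborel. complex_of_real (gaussian (0 + e *\<^sub>R t)) * cis (- 2 * pi * (((1 / e) *\<^sub>R u) \<bullet> (0 + e *\<^sub>R t))))"
      using e by (intro lborel_integral_affine(2)) simp
    also have "\<dots> = e ^ DIM('a) *\<^sub>R (LINT \<omega>|lborel. g \<omega> * cis (- 2 * pi * (\<omega> \<bullet> u)))"
      using e by (simp add: g_def inner_commute)
    finally have "complex_of_real (gaussian ((1 / e) *\<^sub>R u)) = complex_of_real (e ^ DIM('a)) * (LINT \<omega>|lborel. g \<omega> * cis (- 2 * pi * (\<omega> \<bullet> u)))"
      by (simp only: scaleR_conv_of_real)
    moreover have "complex_of_real (e ^ DIM('a)) \<noteq> 0" using e by simp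
    ultimately show ?thesis unfolding of_real_divide by (metis nonzero_mult_div_cancel_left)
  qed
  have K: "integrable (lborel \<Otimes>\<^sub>M lborel) (\<lambda>p. \<Phi> p * ?k (fst p - snd p))"
    using lp.integrable_fst'[OF triple] by (simp only: prod.case integral_mult_right_zero gft)
  have "complex_of_real (LINT \<omega>|lborel. gaussian (e *\<^sub>R \<omega>) * (cmod (fourier f \<omega>))\<^sup>2)
     = (LINT \<omega>|lborel. g \<omega> * complex_of_real ((cmod (fourier f \<omega>))\<^sup>2))"
    by (simp add: g_def flip: integral_complex_of_real)
  also have "\<dots> = (LINT \<omega>|lborel. LINT p|(lborel \<Otimes>\<^sub>M lborel). \<Phi> p * (g \<omega> * ?e \<omega> p))"
    unfolding sq integral_mult_right_zero[symmetric] by (simp only: mult.left_commute)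
  also have "\<dots> = (LINT p|(lborel \<Otimes>\<^sub>M lborel). LINT \<omega>|lborel. \<Phi> p * (g \<omega> * ?e \<omega> p))"
    using lp.Fubini_integral[OF triple] .
  also have "\<dots> = (LINT p|(lborel \<Otimes>\<^sub>M lborel). \<Phi> p * ?k (fst p - snd p))"
    by (simp only: integral_mult_right_zero gft)
  also have "\<dots> = (LINT s|lborel. LINT t|lborel. f s * cnj (f t) * ?k (s - t))"
    by (subst lborel_pair.integral_fst'[OF K, symmetric]) (simp only: \<Phi>_def fst_conv snd_conv)
  also have "\<dots> = (LINT s|lborel. LINT v|lborel. f s * cnj (f (s - e *\<^sub>R v)) * complex_of_real (gaussian v))"
  proof (rule Bochner_Integration.integral_cong[OF refl])
    fix s
    have "(LINT t|lborel. f s * cnj (f t) * ?k (s - t))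
      = \<bar>- e\<bar> ^ DIM('a) *\<^sub>R (LINT v|lborel. f s * cnj (f (s + (- e) *\<^sub>R v)) * ?k (s - (s + (- e) *\<^sub>R v)))"
      using e by (intro lborel_integral_affine(2)) simp
    also have "\<dots> = (LINT v|lborel. e ^ DIM('a) *\<^sub>R (f s * cnj (f (s + (- e) *\<^sub>R v)) * ?k (s - (s + (- e) *\<^sub>R v))))"
      using e by (simp only: integral_scaleR_right abs_minus_cancel abs_of_pos)
    also have "\<dots> = (LINT v|lborel. f s * cnj (f (s - e *\<^sub>R v)) * complex_of_real (gaussian v))"
      using e by (intro Bochner_Integration.integral_cong refl) (simp add: scaleR_conv_of_real)
    finally show "(LINT t|lborel. f s * cnj (f t) * ?k (s - t))
      = (LINT v|lborel. f s * cnj (f (s - e *\<^sub>R v)) * complex_of_real (gaussian v))" .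
  qed
  also have "\<dots> = (LINT v|lborel. LINT s|lborel. f s * cnj (f (s - e *\<^sub>R v)) * complex_of_real (gaussian v))"
  proof (rule lborel_pair.Fubini_integral)
    have cs: "integrable lborel (\<lambda>s. f s * cnj (f (s - u)))" "integrable lborel (\<lambda>s. cmod (f s) * cmod (f (s - u)))"
      and le: "(LINT s|lborel. cmod (f s) * cmod (f (s - u))) \<le> sq_norm lborel f" for u
    proof -
      note sh = L2_shift[OF f2, of u]
      show "integrable lborel (\<lambda>s. f s * cnj (f (s - u)))" "integrable lborel (\<lambda>s. cmod (f s) * cmod (f (s - u)))"
        using L2_prod_integrable[OF f2 sh(1)] by auto
      have "(LINT s|lborel. cmod (f s) * cmod (f (s - u)))\<^sup>2 \<le> (sq_norm lborel f)\<^sup>2"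
        using L2_Cauchy_Schwarz[OF f2 sh(1)] sh(2) by (simp add: power2_eq_square)
      then show "(LINT s|lborel. cmod (f s) * cmod (f (s - u))) \<le> sq_norm lborel f"
        by (rule power2_le_imp_le) simp
    qed
    have sw: "integrable (lborel \<Otimes>\<^sub>M lborel) (\<lambda>(v, s). f s * cnj (f (s - e *\<^sub>R v)) * complex_of_real (gaussian v))"
    proof (rule lborel_pair.Fubini_integrable)
      have [simp]: "\<bar>gaussian v\<bar> = gaussian v" for v :: 'a by (simp add: gaussian_nonneg)
      show "integrable lborel (\<lambda>v. LINT s|lborel. norm (case (v, s) of (v, s) \<Rightarrow> f s * cnj (f (s - e *\<^sub>R v)) * complex_of_real (gaussian v)))"
      proof (rule Bochner_Integration.integrable_bound)
        show "integrable lborel (\<lambda>v::'a. sq_norm lborel f * gaussian v)" using gaussian_integrable[where 'a='a] by simp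
        show "AE v in lborel. norm (LINT s|lborel. norm (case (v, s) of (v, s) \<Rightarrow> f s * cnj (f (s - e *\<^sub>R v)) * complex_of_real (gaussian v))) \<le> norm (sq_norm lborel f * gaussian v)"
          using le by (intro AE_I2) (simp add: norm_mult abs_mult mult_right_mono gaussian_nonneg)
      qed measurable
      show "AE v in lborel. integrable lborel (\<lambda>s. case (v, s) of (v, s) \<Rightarrow> f s * cnj (f (s - e *\<^sub>R v)) * complex_of_real (gaussian v))"
        using cs by simp
    qed measurable
    show "integrable (lborel \<Otimes>\<^sub>M lborel) (\<lambda>(v, s). f s * cnj (f (s - e *\<^sub>R v)) * complex_of_real (gaussian v))"
      by (rule sw)
  qed
  also have "\<dots> = (LINT v|lborel. complex_of_real (gaussian v) * l2_inner lborel f (\<lambda>s. f (s - e *\<^sub>R v)))"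
    unfolding l2_inner_def by (simp add: mult.commute)
  finally show "complex_of_real (LINT \<omega>|lborel. gaussian (e *\<^sub>R \<omega>) * (cmod (fourier f \<omega>))\<^sup>2)
      = (LINT v|lborel. complex_of_real (gaussian v) * l2_inner lborel f (\<lambda>s. f (s - e *\<^sub>R v)))" .
qed

text \<open>
  Let the damping tend to zero: the left side increases to the energy of the Fourier transform, and
  by continuity of translation in \<open>L\<^sup>2\<close> the autocorrelations tend to \<open>\<parallel>f\<parallel>\<^sup>2\<close>.
\<close>

theorem plancherel:
  fixes f :: "'a::euclidean_space \<Rightarrow> complex"
  assumes f: "integrable lborel f" and f2: "f \<in> L2 lborel"
  shows "(\<integral>\<^sup>+\<omega>. ennreal ((cmod (fourier f \<omega>))\<^sup>2) \<partial>lborel) = ennreal (sq_norm lborel f)"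
proof -
  have [measurable]: "f \<in> borel_measurable borel" using borel_measurable_integrable[OF f] by simp
  note [measurable] = fourier_measurable
  define e where "e k = 1 / real (Suc k)" for k
  have e: "0 < e k" for k by (simp add: e_def)
  have e0: "e \<longlonglongrightarrow> 0" unfolding e_def using LIMSEQ_inverse_real_of_nat by (simp add: inverse_eq_divide)
  define I where "I k = (LINT \<omega>|lborel. gaussian (e k *\<^sub>R \<omega>) * (cmod (fourier f \<omega>))\<^sup>2)" for k
  have lim1: "(\<lambda>k. LINT v|lborel. complex_of_real (gaussian v) * l2_inner lborel f (\<lambda>s. f (s - e k *\<^sub>R v)))
     \<longlonglongrightarrow> (LINT v|(lborel::'a measure). complex_of_real (gaussian v) * complex_of_real (sq_norm lborel f))"
  proof (rule integral_dominated_convergence[where w="\<lambda>v. gaussian v * sq_norm lborel f"])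
    show "integrable lborel (\<lambda>v::'a. gaussian v * sq_norm lborel f)" using gaussian_integrable[where 'a='a] by simp
    show "(\<lambda>v. complex_of_real (gaussian v) * l2_inner lborel f (\<lambda>s. f (s - e k *\<^sub>R v))) \<in> borel_measurable lborel" for k
      unfolding l2_inner_def by measurable
    show "AE v in lborel. (\<lambda>k. complex_of_real (gaussian v) * l2_inner lborel f (\<lambda>s. f (s - e k *\<^sub>R v)))
       \<longlonglongrightarrow> complex_of_real (gaussian v) * complex_of_real (sq_norm lborel f)"
    proof (intro AE_I2 tendsto_mult tendsto_const)
      fix v :: 'a
      have "(\<lambda>k. e k *\<^sub>R v) \<longlonglongrightarrow> 0 *\<^sub>R v" using e0 by (intro tendsto_intros)
      then have u: "(\<lambda>k. e k *\<^sub>R v) \<longlonglongrightarrow> 0" by simp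
      have "(\<lambda>k. sqrt (sq_norm lborel (\<lambda>x. f (x - e k *\<^sub>R v) - f x) * sq_norm lborel f)) \<longlonglongrightarrow> sqrt (0 * sq_norm lborel f)"
        using L2_shift_continuous[OF f2 u] by (intro tendsto_intros)
      then have lim: "(\<lambda>k. sqrt (sq_norm lborel (\<lambda>x. f (x - e k *\<^sub>R v) - f x) * sq_norm lborel f)) \<longlonglongrightarrow> 0" by simp
      show "(\<lambda>k. l2_inner lborel f (\<lambda>s. f (s - e k *\<^sub>R v))) \<longlonglongrightarrow> complex_of_real (sq_norm lborel f)"
      proof (rule LIM_zero_cancel, rule Lim_null_comparison[OF _ lim], rule always_eventually, rule allI)
        fix k
        note sh = L2_shift(1)[OF f2, of "e k *\<^sub>R v"]
        have "l2_inner lborel f (\<lambda>s. f (s - e k *\<^sub>R v)) - complex_of_real (sq_norm lborel f) =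
           l2_inner lborel f (\<lambda>s. f (s - e k *\<^sub>R v) - f s)"
          unfolding l2_inner_self[symmetric] unfolding l2_inner_def
          using L2_prod_integrable(1)[OF f2 sh] L2_prod_integrable(1)[OF f2 f2]
          by (simp add: right_diff_distrib)
        moreover have "(cmod (l2_inner lborel f (\<lambda>s. f (s - e k *\<^sub>R v) - f s)))\<^sup>2 \<le>
            sq_norm lborel (\<lambda>x. f (x - e k *\<^sub>R v) - f x) * sq_norm lborel f"
          using l2_inner_Cauchy_Schwarz[OF f2 L2_diff[OF sh f2]] by (simp add: mult.commute)
        ultimately show "cmod (l2_inner lborel f (\<lambda>s. f (s - e k *\<^sub>R v)) - complex_of_real (sq_norm lborel f))
          \<le> sqrt (sq_norm lborel (\<lambda>x. f (x - e k *\<^sub>R v) - f x) * sq_norm lborel f)"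
          by (simp add: real_le_rsqrt)
      qed
    qed
    show "AE v in lborel. norm (complex_of_real (gaussian v) * l2_inner lborel f (\<lambda>s. f (s - e k *\<^sub>R v))) \<le> gaussian v * sq_norm lborel f" for k
    proof (rule AE_I2)
      fix v :: 'a
      note sh = L2_shift[OF f2, of "e k *\<^sub>R v"]
      have "(cmod (l2_inner lborel f (\<lambda>s. f (s - e k *\<^sub>R v))))\<^sup>2 \<le> (sq_norm lborel f)\<^sup>2"
        using l2_inner_Cauchy_Schwarz[OF f2 sh(1)] sh(2) by (simp add: power2_eq_square)
      then have "cmod (l2_inner lborel f (\<lambda>s. f (s - e k *\<^sub>R v))) \<le> sq_norm lborel f"
        by (rule power2_le_imp_le) simp
      then show "norm (complex_of_real (gaussian v) * l2_inner lborel f (\<lambda>s. f (s - e k *\<^sub>R v))) \<le> gaussian v * sq_norm lborel f"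
        by (simp add: norm_mult gaussian_nonneg mult_left_mono)
    qed
  qed measurable
  have eq: "(LINT v|(lborel::'a measure). complex_of_real (gaussian v) * complex_of_real (sq_norm lborel f)) = complex_of_real (sq_norm lborel f)"
    by (simp add: integral_gaussian)
  have "(\<lambda>k. complex_of_real (I k)) \<longlonglongrightarrow> complex_of_real (sq_norm lborel f)"
    unfolding I_def fourier_energy_damped(2)[OF f f2 e] using lim1 unfolding eq .
  then have "I \<longlonglongrightarrow> sq_norm lborel f" by (simp add: tendsto_of_real_iff)
  then have limI: "(\<lambda>k. ennreal (I k)) \<longlonglongrightarrow> ennreal (sq_norm lborel f)" by (rule tendsto_ennrealI)
  define G where "G k \<omega> = ennreal (gaussian (e k *\<^sub>R \<omega>) * (cmod (fourier f \<omega>))\<^sup>2)" for k and \<omega> :: 'a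
  have "(\<lambda>k. \<integral>\<^sup>+\<omega>. G k \<omega> \<partial>lborel) \<longlonglongrightarrow> (\<integral>\<^sup>+\<omega>. ennreal ((cmod (fourier f \<omega>))\<^sup>2) \<partial>lborel)"
  proof (rule nn_integral_LIMSEQ)
    show "incseq G"
    proof (intro incseq_SucI le_funI)
      fix k and \<omega> :: 'a
      have "e (Suc k) \<le> e k" by (simp add: e_def field_simps)
      then have "gaussian (e k *\<^sub>R \<omega>) \<le> gaussian (e (Suc k) *\<^sub>R \<omega>)"
        using e[of "Suc k"] e[of k] by (simp add: gaussian_def power_mult_distrib mult_right_mono power_mono)
      then show "G k \<omega> \<le> G (Suc k) \<omega>" unfolding G_def by (intro ennreal_leI mult_right_mono) auto
    qed
    show "G k \<in> borel_measurable lborel" for k unfolding G_def by measurable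
    show "(\<lambda>k. G k \<omega>) \<longlonglongrightarrow> ennreal ((cmod (fourier f \<omega>))\<^sup>2)" for \<omega> :: 'a
    proof -
      have "(\<lambda>k. exp (- pi * (norm (e k *\<^sub>R \<omega>))\<^sup>2) * (cmod (fourier f \<omega>))\<^sup>2) \<longlonglongrightarrow> exp (- pi * (norm (0 *\<^sub>R \<omega>))\<^sup>2) * (cmod (fourier f \<omega>))\<^sup>2"
        using e0 by (intro tendsto_intros)
      then show ?thesis unfolding G_def gaussian_def by (intro tendsto_ennrealI) simp
    qed
  qed
  moreover have "(\<integral>\<^sup>+\<omega>. G k \<omega> \<partial>lborel) = ennreal (I k)" for k
    unfolding G_def I_def by (rule nn_integral_eq_integral[OF fourier_energy_damped(1)[OF f f2 e]]) (simp add: gaussian_nonneg)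
  ultimately show ?thesis using limI LIMSEQ_unique by auto
qed

section \<open>Complex coordinates on phase space\<close>

text \<open>
  Such a map pulls boxes back to boxes with the same side lengths. It serves to identify Lebesgue
  measure on \<open>complex^'n\<close> with the product measure on position and frequency.
\<close>

lemma distr_lborel_basis_isometry:
  fixes T :: "'a::euclidean_space \<Rightarrow> 'b::euclidean_space"
  assumes [measurable]: "T \<in> borel_measurable borel"
    and inner: "\<And>x y. T x \<bullet> T y = x \<bullet> y" and bij: "bij_betw T Basis Basis"
  shows "distr lborel borel T = lborel"
proof (rule lborel_eqI[symmetric])
  fix l u :: 'b assume lu: "\<And>b. b \<in> Basis \<Longrightarrow> l \<bullet> b \<le> u \<bullet> b"
  define p where "p v = (\<Sum>b\<in>Basis. (v \<bullet> T b) *\<^sub>R b)" for v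
  have p: "p v \<bullet> b = v \<bullet> T b" if "b \<in> Basis" for v b
    using that unfolding p_def by simp
  have B: "Basis = T ` Basis" using bij by (simp add: bij_betw_def)
  have "T -` box l u = box (p l) (p u)"
    unfolding box_def by (subst B) (auto simp: p inner)
  then have "emeasure (distr lborel borel T) (box l u) = emeasure lborel (box (p l) (p u))"
    by (subst emeasure_distr) auto
  also have "\<dots> = ennreal (\<Prod>b\<in>Basis. (p u - p l) \<bullet> b)"
    using lu B by (subst emeasure_lborel_box) (auto simp: p)
  also have "(\<Prod>b\<in>Basis. (p u - p l) \<bullet> b) = (\<Prod>b\<in>Basis. (u - l) \<bullet> T b)"
    by (intro prod.cong refl) (simp add: p inner_diff_left)
  also have "\<dots> = (\<Prod>b\<in>Basis. (u - l) \<bullet> b)"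
    using prod.reindex_bij_betw[OF bij, of "\<lambda>b. (u - l) \<bullet> b"] .
  finally show "emeasure (distr lborel borel T) (box l u) = (\<Prod>b\<in>Basis. (u - l) \<bullet> b)" .
qed simp

definition vec_Complex :: "(real^'n) \<times> (real^'n) \<Rightarrow> complex^'n" where
  "vec_Complex z = (\<chi> j. Complex (fst z $ j) (snd z $ j))"

lemma vec_Re_Complex [simp]: "vec_Re (vec_Complex z) = fst z"
  and vec_Im_Complex [simp]: "vec_Im (vec_Complex z) = snd z"
  by (simp_all add: vec_Re_def vec_Im_def vec_Complex_def)

lemma norm_vec_Re_Im: "(norm (w :: complex^'n))\<^sup>2 = (norm (vec_Re w))\<^sup>2 + (norm (vec_Im w))\<^sup>2"
proof -
  have "w \<bullet> w = vec_Re w \<bullet> vec_Re w + vec_Im w \<bullet> vec_Im w"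
    unfolding inner_vec_def vec_Re_def vec_Im_def vec_lambda_beta inner_complex_def inner_real_def sum.distrib ..
  then show ?thesis unfolding power2_norm_eq_inner .
qed

lemma vec_Re_add: "vec_Re (v + w) = vec_Re v + vec_Re w"
  and vec_Im_add: "vec_Im (v + w) = vec_Im v + vec_Im w"
  unfolding vec_Re_def vec_Im_def by (rule vec_eq_iff[THEN iffD2], simp)+

lemma vec_Re_scaleR: "vec_Re (c *\<^sub>R w) = c *\<^sub>R vec_Re w"
  and vec_Im_scaleR: "vec_Im (c *\<^sub>R w) = c *\<^sub>R vec_Im w"
  unfolding vec_Re_def vec_Im_def by (rule vec_eq_iff[THEN iffD2], simp)+

lemma continuous_vec_Re [continuous_intros]: "continuous_on S vec_Re"
  and continuous_vec_Im [continuous_intros]: "continuous_on S vec_Im"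
  unfolding vec_Re_def[abs_def] vec_Im_def[abs_def] by (intro continuous_intros)+

lemma vec_Complex_measurable [measurable]: "vec_Complex \<in> borel_measurable borel"
proof -
  have eq: "(vec_Complex :: (real^'n) \<times> (real^'n) \<Rightarrow> _) =
      (\<lambda>z. \<chi> j. complex_of_real (fst z $ j) + \<i> * complex_of_real (snd z $ j))"
    by (auto simp: vec_Complex_def vec_eq_iff complex_eq_iff)
  show ?thesis
    unfolding eq by (rule borel_measurable_continuous_onI) (intro continuous_intros)
qed

lemma distr_vec_Complex: "distr lborel borel vec_Complex = (lborel :: (complex^'n) measure)"
proof (rule distr_lborel_basis_isometry)
  show "vec_Complex x \<bullet> vec_Complex y = x \<bullet> y" for x y :: "(real^'n) \<times> (real^'n)"
    unfolding vec_Complex_def inner_vec_def inner_prod_def inner_complex_def vec_lambda_beta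
      complex.sel inner_real_def sum.distrib ..
  have ax: "vec_Complex (axis i 1, 0) = axis i 1" "vec_Complex (0, axis i 1) = axis i \<i>" for i :: 'n
    by (auto simp: vec_Complex_def axis_def vec_eq_iff complex_eq_iff)
  have "vec_Complex ` (Basis :: ((real^'n) \<times> (real^'n)) set) = (Basis :: (complex^'n) set)"
    by (auto simp: Basis_prod_def Basis_vec_def Basis_complex_def image_Un image_image ax UNION_singleton_eq_range)
  moreover have "inj (vec_Complex :: (real^'n) \<times> (real^'n) \<Rightarrow> _)"
    by (rule injI) (metis prod_eqI vec_Re_Complex vec_Im_Complex)
  ultimately show "bij_betw vec_Complex (Basis :: ((real^'n) \<times> (real^'n)) set) (Basis :: (complex^'n) set)"
    by (auto simp: bij_betw_def intro: inj_on_subset)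
qed simp

lemma nn_integral_vec_Complex:
  assumes [measurable]: "f \<in> borel_measurable borel"
  shows "(\<integral>\<^sup>+w. f (w :: complex^'n) \<partial>lborel) = (\<integral>\<^sup>+x. \<integral>\<^sup>+\<omega>. f (vec_Complex (x, \<omega>)) \<partial>lborel \<partial>lborel)"
proof -
  have m: "(\<lambda>z. f (vec_Complex z)) \<in> borel_measurable (lborel \<Otimes>\<^sub>M lborel)"
    unfolding lborel_prod by measurable
  have "(\<integral>\<^sup>+w. f (w :: complex^'n) \<partial>lborel) = (\<integral>\<^sup>+w. f w \<partial>distr lborel borel vec_Complex)"
    by (simp add: distr_vec_Complex)
  also have "\<dots> = (\<integral>\<^sup>+z. f (vec_Complex z) \<partial>(lborel \<Otimes>\<^sub>M lborel))"
    unfolding lborel_prod by (subst nn_integral_distr) simp_all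
  also have "\<dots> = (\<integral>\<^sup>+x. \<integral>\<^sup>+\<omega>. f (vec_Complex (x, \<omega>)) \<partial>lborel \<partial>lborel)"
    using lborel.nn_integral_fst[OF m] by simp
  finally show ?thesis .
qed

lemma exp_half_square_integrable: "integrable lborel (\<lambda>t :: 'a::euclidean_space. exp (- (norm t)\<^sup>2 / 2))"
proof -
  have "integrable lborel (\<lambda>t :: 'a. gaussian (0 + (1 / sqrt (2 * pi)) *\<^sub>R t))"
    by (subst lborel_integral_affine(1)) (simp_all add: gaussian_integrable)
  moreover have "gaussian (0 + (1 / sqrt (2 * pi)) *\<^sub>R t) = exp (- (norm t)\<^sup>2 / 2)" for t :: 'a
    by (simp add: gaussian_def power_mult_distrib power_divide)
  ultimately show ?thesis by simp
qed

lemma L2_gaussian_bound: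
  fixes f :: "'a::euclidean_space \<Rightarrow> complex"
  assumes [measurable]: "f \<in> borel_measurable borel"
    and bd: "\<And>t. cmod (f t) \<le> K * exp (- (norm t)\<^sup>2 / 4)"
  shows "f \<in> L2 lborel"
proof -
  have "integrable lborel (\<lambda>t. (cmod (f t))\<^sup>2)"
  proof (rule Bochner_Integration.integrable_bound)
    show "integrable lborel (\<lambda>t :: 'a. K\<^sup>2 * exp (- (norm t)\<^sup>2 / 2))"
      using exp_half_square_integrable[where 'a='a] by simp
    have "(cmod (f t))\<^sup>2 \<le> (K * exp (- (norm t)\<^sup>2 / 4))\<^sup>2" for t
      by (intro power_mono bd) simp
    also have "(K * exp (- (norm t)\<^sup>2 / 4))\<^sup>2 = K\<^sup>2 * exp (- (norm t)\<^sup>2 / 2)" for t :: 'a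
      by (simp add: power_mult_distrib exp_double[symmetric])
    finally show "AE t in lborel. norm ((cmod (f t))\<^sup>2) \<le> norm (K\<^sup>2 * exp (- (norm t)\<^sup>2 / 2))"
      by simp
  qed measurable
  then show ?thesis by (simp add: L2_def)
qed

section \<open>Short-time Fourier transforms with rapidly decaying windows\<close>

text \<open>
  The argument depends on the Hermite window only through these properties. Continuity and decay
  make the transform continuous, bounded and entire in frequency directions; a nonzero window makes
  it injective.
\<close>

locale gaussian_window =
  fixes \<phi> :: "real^'n \<Rightarrow> complex" and C :: real
  assumes continuous: "continuous_on UNIV \<phi>"
    and decay: "\<And>t. cmod (\<phi> t) \<le> C * exp (- (norm t)\<^sup>2)"
    and nonzero: "0 < sq_norm lborel \<phi>"
begin

lemma window_measurable [measurable]: "\<phi> \<in> borel_measurable borel"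
  using continuous by (rule borel_measurable_continuous_onI)

lemma C_nonneg: "0 \<le> C"
  using order_trans[OF norm_ge_zero decay[of 0]] by simp

text \<open>
  Uniformity in \<open>x\<close> provides the dominating function for continuity of the transform; the factor
  \<open>exp (a * norm t)\<close> provides the exponential moments for its entire extension.
\<close>

lemma window_shift_bound:
  assumes "norm x \<le> R"
  shows "exp (a * norm t) * cmod (\<phi> (t - x)) \<le> C * exp (R\<^sup>2 + a\<^sup>2) * exp (- (norm t)\<^sup>2 / 4)"
proof -
  have "norm t \<le> norm (t - x) + norm x" using norm_triangle_ineq[of "t - x" x] by simp
  then have "(norm t)\<^sup>2 \<le> (norm (t - x) + norm x)\<^sup>2" by (intro power_mono) auto
  also have "\<dots> \<le> 2 * (norm (t - x))\<^sup>2 + 2 * (norm x)\<^sup>2"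
    using zero_le_power2[of "norm (t - x) - norm x"] by (simp add: power2_eq_square algebra_simps)
  also have "(norm x)\<^sup>2 \<le> R\<^sup>2" using assms by (intro power_mono) auto
  finally have 1: "- (norm (t - x))\<^sup>2 \<le> - (norm t)\<^sup>2 / 2 + R\<^sup>2" by simp
  have 2: "a * norm t \<le> (norm t)\<^sup>2 / 4 + a\<^sup>2"
    using zero_le_power2[of "norm t / 2 - a"] by (simp add: power2_eq_square algebra_simps)
  have "exp (a * norm t) * cmod (\<phi> (t - x)) \<le> exp (a * norm t) * (C * exp (- (norm (t - x))\<^sup>2))"
    by (intro mult_left_mono decay) simp
  also have "\<dots> = C * exp (a * norm t - (norm (t - x))\<^sup>2)" by (simp add: exp_diff exp_minus field_simps)
  also have "\<dots> \<le> C * exp (R\<^sup>2 + a\<^sup>2 + (- (norm t)\<^sup>2 / 4))"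
    using 1 2 C_nonneg by (intro mult_left_mono) auto
  also have "\<dots> = C * exp (R\<^sup>2 + a\<^sup>2) * exp (- (norm t)\<^sup>2 / 4)" by (simp only: exp_add mult.assoc)
  finally show ?thesis .
qed

lemma weighted_window_L2: "(\<lambda>t. complex_of_real (exp (a * norm t)) * \<phi> (t - x)) \<in> L2 lborel"
proof (rule L2_gaussian_bound)
  show "cmod (complex_of_real (exp (a * norm t)) * \<phi> (t - x)) \<le> C * exp ((norm x)\<^sup>2 + a\<^sup>2) * exp (- (norm t)\<^sup>2 / 4)" for t
    using window_shift_bound[OF order_refl, of a t x] by (simp add: norm_mult)
qed measurable

lemma window_L2: "\<phi> \<in> L2 lborel"
  using weighted_window_L2[of 0 0] by simp

lemma tf_shift_eq: "tf_shift (x, \<omega>) \<phi> t = cis (2 * pi * (\<omega> \<bullet> t)) * \<phi> (t - x)"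
  by (simp add: tf_shift_def cis_conv_exp mult_ac)

lemma norm_tf_shift: "cmod (tf_shift z \<phi> t) = cmod (\<phi> (t - fst z))"
  by (cases z) (simp add: tf_shift_eq norm_mult)

lemma tf_shift_measurable [measurable]: "tf_shift z \<phi> \<in> borel_measurable borel"
  by (cases z) (simp add: tf_shift_eq[abs_def])

lemma tf_shift_L2: "tf_shift z \<phi> \<in> L2 lborel"
  and tf_shift_norm: "sq_norm lborel (tf_shift z \<phi>) = sq_norm lborel \<phi>"
proof -
  show "tf_shift z \<phi> \<in> L2 lborel"
    using L2_shift(1)[OF window_L2, of "fst z"] by (simp add: L2_def norm_tf_shift)
  show "sq_norm lborel (tf_shift z \<phi>) = sq_norm lborel \<phi>"
    using L2_shift(2)[OF window_L2, of "fst z"] by (simp add: sq_norm_def norm_tf_shift)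
qed

text \<open>
  The transform with respect to Borel measure, where Fubini's theorem is available; see
  \<open>stft_eq_V\<close> for the comparison with Lebesgue measurable representatives.
\<close>

definition V :: "(real^'n \<Rightarrow> complex) \<Rightarrow> (real^'n) \<times> (real^'n) \<Rightarrow> complex" where
  "V \<psi> z = l2_inner lborel \<psi> (tf_shift z \<phi>)"

lemma V_fourier: "V \<psi> (x, \<omega>) = fourier (\<lambda>t. \<psi> t * cnj (\<phi> (t - x))) \<omega>"
  unfolding V_def l2_inner_def fourier_def
  by (intro Bochner_Integration.integral_cong refl) (simp add: tf_shift_eq cis_cnj)

lemma V_add: "\<psi> \<in> L2 lborel \<Longrightarrow> \<eta> \<in> L2 lborel \<Longrightarrow> V (\<lambda>t. \<psi> t + \<eta> t) z = V \<psi> z + V \<eta> z"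
  unfolding V_def by (intro l2_inner_add_left tf_shift_L2)

lemma V_diff: "\<psi> \<in> L2 lborel \<Longrightarrow> \<eta> \<in> L2 lborel \<Longrightarrow> V (\<lambda>t. \<psi> t - \<eta> t) z = V \<psi> z - V \<eta> z"
  unfolding V_def by (intro l2_inner_diff_left tf_shift_L2)

lemma V_cmult: "V (\<lambda>t. c * \<psi> t) z = c * V \<psi> z"
  unfolding V_def by (rule l2_inner_cmult_left)

lemma V_bound: "\<psi> \<in> L2 lborel \<Longrightarrow> (cmod (V \<psi> z))\<^sup>2 \<le> sq_norm lborel \<psi> * sq_norm lborel \<phi>"
  unfolding V_def using l2_inner_Cauchy_Schwarz[OF _ tf_shift_L2] by (simp add: tf_shift_norm)

text \<open>
  With \<open>tf_shift_continuous\<close> this says that the transforms of a bounded set are equicontinuous.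
\<close>

lemma V_diff_bound:
  assumes "\<psi> \<in> L2 lborel"
  shows "(cmod (V \<psi> z - V \<psi> z'))\<^sup>2 \<le> sq_norm lborel \<psi> * sq_norm lborel (\<lambda>t. tf_shift z \<phi> t - tf_shift z' \<phi> t)"
proof -
  have "V \<psi> z - V \<psi> z' = l2_inner lborel \<psi> (\<lambda>t. tf_shift z \<phi> t - tf_shift z' \<phi> t)"
    unfolding V_def l2_inner_def
    using L2_prod_integrable(1)[OF assms tf_shift_L2[of z]] L2_prod_integrable(1)[OF assms tf_shift_L2[of z']]
    by (simp add: right_diff_distrib)
  then show ?thesis using l2_inner_Cauchy_Schwarz[OF assms L2_diff[OF tf_shift_L2 tf_shift_L2]] by simp
qed

lemma tf_shift_continuous:
  assumes z: "z \<longlonglongrightarrow> z0"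
  shows "(\<lambda>k. sq_norm lborel (\<lambda>t. tf_shift (z k) \<phi> t - tf_shift z0 \<phi> t)) \<longlonglongrightarrow> 0"
proof -
  have zx: "(\<lambda>k. fst (z k)) \<longlonglongrightarrow> fst z0" and zw: "(\<lambda>k. snd (z k)) \<longlonglongrightarrow> snd z0"
    using z by (auto intro: tendsto_fst tendsto_snd)
  have "bounded (range (\<lambda>k. fst (z k)))" using zx by (rule convergent_imp_bounded)
  then obtain R0 where "\<And>k. norm (fst (z k)) \<le> R0" by (auto simp: bounded_iff)
  define R where "R = max R0 (norm (fst z0))"
  have R: "norm (fst (z k)) \<le> R" "norm (fst z0) \<le> R" for k
    unfolding R_def using \<open>\<And>k. norm (fst (z k)) \<le> R0\<close>[of k] by auto
  let ?K = "C * exp (R\<^sup>2)"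
  have "(\<lambda>k. LINT t|lborel. (cmod (tf_shift (z k) \<phi> t - tf_shift z0 \<phi> t))\<^sup>2) \<longlonglongrightarrow> (LINT t|(lborel :: (real^'n) measure). 0)"
  proof (rule integral_dominated_convergence[where w="\<lambda>t. (2 * ?K)\<^sup>2 * exp (- (norm t)\<^sup>2 / 2)"])
    show "integrable lborel (\<lambda>t :: real^'n. (2 * ?K)\<^sup>2 * exp (- (norm t)\<^sup>2 / 2))"
      using exp_half_square_integrable[where 'a="real^'n"] by simp
    show "AE t in lborel. norm ((cmod (tf_shift (z k) \<phi> t - tf_shift z0 \<phi> t))\<^sup>2) \<le> (2 * ?K)\<^sup>2 * exp (- (norm t)\<^sup>2 / 2)" for k
    proof (rule AE_I2)
      fix t
      have "cmod (tf_shift (z k) \<phi> t - tf_shift z0 \<phi> t) \<le> cmod (\<phi> (t - fst (z k))) + cmod (\<phi> (t - fst z0))"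
        using norm_triangle_ineq4 by (metis norm_tf_shift)
      also have "\<dots> \<le> ?K * exp (- (norm t)\<^sup>2 / 4) + ?K * exp (- (norm t)\<^sup>2 / 4)"
        using window_shift_bound[OF R(1), of 0 t k] window_shift_bound[OF R(2), of 0 t] by (intro add_mono) auto
      finally have "(cmod (tf_shift (z k) \<phi> t - tf_shift z0 \<phi> t))\<^sup>2 \<le> (2 * ?K * exp (- (norm t)\<^sup>2 / 4))\<^sup>2"
        by (intro power_mono) auto
      also have "\<dots> = (2 * ?K)\<^sup>2 * exp (- (norm t)\<^sup>2 / 2)"
        by (simp add: power_mult_distrib exp_double[symmetric])
      finally show "norm ((cmod (tf_shift (z k) \<phi> t - tf_shift z0 \<phi> t))\<^sup>2) \<le> (2 * ?K)\<^sup>2 * exp (- (norm t)\<^sup>2 / 2)"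
        by simp
    qed
    show "AE t in lborel. (\<lambda>k. (cmod (tf_shift (z k) \<phi> t - tf_shift z0 \<phi> t))\<^sup>2) \<longlonglongrightarrow> 0"
    proof (rule AE_I2)
      fix t
      have "isCont \<phi> (t - fst z0)" using continuous by (simp add: continuous_on_eq_continuous_at)
      then have "(\<lambda>k. \<phi> (t - fst (z k))) \<longlonglongrightarrow> \<phi> (t - fst z0)"
        by (rule isCont_tendsto_compose) (intro tendsto_intros zx)
      moreover have "(\<lambda>k. cis (2 * pi * (snd (z k) \<bullet> t))) \<longlonglongrightarrow> cis (2 * pi * (snd z0 \<bullet> t))"
      proof (rule continuous_on_tendsto_compose[of UNIV cis])
        show "(\<lambda>k. 2 * pi * (snd (z k) \<bullet> t)) \<longlonglongrightarrow> 2 * pi * (snd z0 \<bullet> t)" by (intro tendsto_intros zw)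
      qed (auto intro: continuous_intros)
      ultimately have "(\<lambda>k. cis (2 * pi * (snd (z k) \<bullet> t)) * \<phi> (t - fst (z k))) \<longlonglongrightarrow> cis (2 * pi * (snd z0 \<bullet> t)) * \<phi> (t - fst z0)"
        by (intro tendsto_mult)
      then have "(\<lambda>k. tf_shift (z k) \<phi> t) \<longlonglongrightarrow> tf_shift z0 \<phi> t"
        using tf_shift_eq[of "fst z" "snd z" t for z] by simp
      then have "(\<lambda>k. (cmod (tf_shift (z k) \<phi> t - tf_shift z0 \<phi> t))\<^sup>2) \<longlonglongrightarrow> 0\<^sup>2"
        by (intro tendsto_power tendsto_norm_zero LIM_zero)
      then show "(\<lambda>k. (cmod (tf_shift (z k) \<phi> t - tf_shift z0 \<phi> t))\<^sup>2) \<longlonglongrightarrow> 0" by simp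
    qed
  qed measurable
  then show ?thesis by (simp add: sq_norm_def)
qed

lemma V_continuous:
  assumes "\<psi> \<in> L2 lborel" shows "continuous_on UNIV (V \<psi>)"
proof (rule continuous_on_sequentiallyI)
  fix u :: "nat \<Rightarrow> (real^'n) \<times> (real^'n)" and a assume "u \<longlonglongrightarrow> a"
  then have "(\<lambda>k. sqrt (sq_norm lborel \<psi> * sq_norm lborel (\<lambda>t. tf_shift (u k) \<phi> t - tf_shift a \<phi> t))) \<longlonglongrightarrow> sqrt (sq_norm lborel \<psi> * 0)"
    by (intro tendsto_intros tf_shift_continuous)
  then have lim: "(\<lambda>k. sqrt (sq_norm lborel \<psi> * sq_norm lborel (\<lambda>t. tf_shift (u k) \<phi> t - tf_shift a \<phi> t))) \<longlonglongrightarrow> 0" by simp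
  show "(\<lambda>k. V \<psi> (u k)) \<longlonglongrightarrow> V \<psi> a"
    by (rule LIM_zero_cancel, rule Lim_null_comparison[OF _ lim])
      (intro always_eventually allI real_le_rsqrt V_diff_bound[OF assms])
qed

text \<open>
  Moyal's identity: for fixed \<open>x\<close> the transform is the Fourier transform of \<open>\<psi>\<close> times a shifted
  window, so Plancherel followed by Tonelli in \<open>x\<close> and \<open>t\<close> factors the energy.
\<close>

lemma moyal:
  assumes \<psi>: "\<psi> \<in> L2 lborel"
  shows "(\<integral>\<^sup>+x. \<integral>\<^sup>+\<omega>. ennreal ((cmod (V \<psi> (x, \<omega>)))\<^sup>2) \<partial>lborel \<partial>lborel) = ennreal (sq_norm lborel \<phi> * sq_norm lborel \<psi>)"
proof -
  have [measurable]: "\<psi> \<in> borel_measurable borel" using \<psi> by (auto simp: L2_def)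
  define f where "f x t = \<psi> t * cnj (\<phi> (t - x))" for x t
  have fint: "integrable lborel (f x)" for x
    unfolding f_def using L2_prod_integrable(1)[OF \<psi> L2_shift(1)[OF window_L2]] .
  have bd: "cmod (\<phi> t) \<le> C" for t
    using decay[of t] C_nonneg mult_left_mono[of "exp (- (norm t)\<^sup>2)" 1 C] by simp
  have fL2: "f x \<in> L2 lborel" for x
  proof -
    have "integrable lborel (\<lambda>t. (cmod (f x t))\<^sup>2)"
    proof (rule Bochner_Integration.integrable_bound)
      show "integrable lborel (\<lambda>t. C\<^sup>2 * (cmod (\<psi> t))\<^sup>2)" using L2_integrable[OF \<psi>] by simp
      show "AE t in lborel. norm ((cmod (f x t))\<^sup>2) \<le> norm (C\<^sup>2 * (cmod (\<psi> t))\<^sup>2)"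
      proof (rule AE_I2)
        fix t
        have "(cmod (\<phi> (t - x)))\<^sup>2 \<le> C\<^sup>2" by (intro power_mono bd) simp
        from mult_left_mono[OF this, of "(cmod (\<psi> t))\<^sup>2"]
        show "norm ((cmod (f x t))\<^sup>2) \<le> norm (C\<^sup>2 * (cmod (\<psi> t))\<^sup>2)"
          by (simp add: f_def norm_mult power_mult_distrib mult.commute)
      qed
    qed (unfold f_def, measurable)
    moreover have "f x \<in> borel_measurable lborel" unfolding f_def by measurable
    ultimately show ?thesis by (simp add: L2_def)
  qed
  have Vf: "V \<psi> (x, \<omega>) = fourier (f x) \<omega>" for x \<omega>
    unfolding V_fourier f_def ..
  have refl: "(\<integral>\<^sup>+x. ennreal ((cmod (\<phi> (t - x)))\<^sup>2) \<partial>lborel) = ennreal (sq_norm lborel \<phi>)" for t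
    using lborel_nn_integral_affine[of "-1" "\<lambda>x. ennreal ((cmod (\<phi> x))\<^sup>2)" t] nn_integral_sq_norm[OF window_L2]
    by simp
  have "(\<integral>\<^sup>+x. \<integral>\<^sup>+\<omega>. ennreal ((cmod (V \<psi> (x, \<omega>)))\<^sup>2) \<partial>lborel \<partial>lborel) = (\<integral>\<^sup>+x. ennreal (sq_norm lborel (f x)) \<partial>lborel)"
    by (simp only: Vf plancherel[OF fint fL2])
  also have "\<dots> = (\<integral>\<^sup>+x. \<integral>\<^sup>+t. ennreal ((cmod (\<psi> t))\<^sup>2 * (cmod (\<phi> (t - x)))\<^sup>2) \<partial>lborel \<partial>lborel)"
    unfolding nn_integral_sq_norm[OF fL2, symmetric] by (simp add: f_def norm_mult power_mult_distrib)
  also have "\<dots> = (\<integral>\<^sup>+t. \<integral>\<^sup>+x. ennreal ((cmod (\<psi> t))\<^sup>2 * (cmod (\<phi> (t - x)))\<^sup>2) \<partial>lborel \<partial>lborel)"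
    by (rule lborel_pair.Fubini') measurable
  also have "\<dots> = (\<integral>\<^sup>+t. ennreal ((cmod (\<psi> t))\<^sup>2) * ennreal (sq_norm lborel \<phi>) \<partial>lborel)"
    by (simp add: ennreal_mult nn_integral_cmult refl)
  also have "\<dots> = ennreal (sq_norm lborel \<phi> * sq_norm lborel \<psi>)"
    by (subst nn_integral_multc) (simp_all add: nn_integral_sq_norm[OF \<psi>] ennreal_mult mult.commute)
  finally show ?thesis .
qed

end

section \<open>Finite-measure supports and entire functions\<close>

text \<open>
  Average over a small ball \<open>Q\<close> inside \<open>W\<close> the length in which the line through \<open>w\<close> in direction
  \<open>e\<close> meets \<open>W\<close>. By Fubini this is \<open>\<integral>\<^sub>W\<close> of the length of \<open>{s. v - s *\<^sub>R e \<in> Q}\<close>, at most the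
  diameter of \<open>Q\<close>, so the average is finite.
\<close>

lemma finite_measure_line:
  fixes W :: "'a::euclidean_space set"
  assumes W: "open W" and fin: "emeasure lborel W < \<infinity>" and e: "norm e = 1" and w0: "w0 \<in> W"
  shows "\<exists>w\<in>W. emeasure lborel {s. w + s *\<^sub>R e \<in> W} < \<infinity>"
proof (rule ccontr)
  assume "\<not> ?thesis"
  then have inf: "emeasure lborel {s. w + s *\<^sub>R e \<in> W} = \<infinity>" if "w \<in> W" for w
    using that by (auto simp: less_top[symmetric])
  obtain r where r: "0 < r" "ball w0 r \<subseteq> W" using W w0 by (auto simp: open_contains_ball)
  let ?Q = "ball w0 r"
  have [measurable]: "W \<in> sets borel" using W by simp
  have sl [measurable]: "{s. w + s *\<^sub>R e \<in> W} \<in> sets borel" for w by measurable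
  define p q :: "'a \<Rightarrow> ennreal" where "p = indicator ?Q" and "q = indicator W"
  have pq: "indicator ?Q = p" "indicator W = q" by (simp_all add: p_def q_def)
  have [measurable]: "p \<in> borel_measurable borel" "q \<in> borel_measurable borel"
    unfolding p_def q_def by (intro borel_measurable_indicator, simp)+
  have "\<infinity> * emeasure lborel ?Q = (\<integral>\<^sup>+w. \<infinity> * indicator ?Q w \<partial>lborel)"
    by (simp add: nn_integral_cmult_indicator)
  also have "\<dots> = (\<integral>\<^sup>+w. indicator ?Q w * emeasure lborel {s. w + s *\<^sub>R e \<in> W} \<partial>lborel)"
    using inf r by (intro nn_integral_cong) (auto simp: indicator_def)
  also have "\<dots> = (\<integral>\<^sup>+w. \<integral>\<^sup>+s. indicator ?Q w * indicator W (w + s *\<^sub>R e) \<partial>lborel \<partial>lborel)"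
  proof (rule nn_integral_cong)
    fix w
    have "emeasure lborel {s. w + s *\<^sub>R e \<in> W} = (\<integral>\<^sup>+s. indicator W (w + s *\<^sub>R e) \<partial>lborel)"
    proof -
      have eq: "(\<lambda>s. indicator W (w + s *\<^sub>R e) :: ennreal) = indicator {s. w + s *\<^sub>R e \<in> W}"
        by (auto simp: indicator_def)
      show ?thesis unfolding eq using sl[of w] by simp
    qed
    then show "indicator ?Q w * emeasure lborel {s. w + s *\<^sub>R e \<in> W} = (\<integral>\<^sup>+s. indicator ?Q w * indicator W (w + s *\<^sub>R e) \<partial>lborel)"
      by (simp add: nn_integral_cmult)
  qed
  also have "\<dots> = (\<integral>\<^sup>+s. \<integral>\<^sup>+w. indicator ?Q w * indicator W (w + s *\<^sub>R e) \<partial>lborel \<partial>lborel)"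
    unfolding pq by (rule lborel_pair.Fubini') measurable
  also have "\<dots> = (\<integral>\<^sup>+s. \<integral>\<^sup>+v. indicator ?Q (v - s *\<^sub>R e) * indicator W v \<partial>lborel \<partial>lborel)"
  proof (rule nn_integral_cong)
    fix s
    have "(\<integral>\<^sup>+w. indicator ?Q w * indicator W (w + s *\<^sub>R e) \<partial>lborel) = (\<integral>\<^sup>+v. indicator ?Q (v - s *\<^sub>R e) * indicator W ((v - s *\<^sub>R e) + s *\<^sub>R e) \<partial>lborel)"
      unfolding pq by (rule lborel_nn_integral_translate[symmetric]) measurable
    then show "(\<integral>\<^sup>+w. indicator ?Q w * indicator W (w + s *\<^sub>R e) \<partial>lborel) = (\<integral>\<^sup>+v. indicator ?Q (v - s *\<^sub>R e) * indicator W v \<partial>lborel)"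
      by simp
  qed
  also have "\<dots> = (\<integral>\<^sup>+v. \<integral>\<^sup>+s. indicator ?Q (v - s *\<^sub>R e) * indicator W v \<partial>lborel \<partial>lborel)"
    unfolding pq by (rule lborel_pair.Fubini') measurable
  also have "\<dots> \<le> (\<integral>\<^sup>+v. ennreal (2 * r) * indicator W v \<partial>lborel)"
  proof (rule nn_integral_mono)
    fix v
    let ?a = "(v - w0) \<bullet> e"
    have "(\<integral>\<^sup>+s. indicator ?Q (v - s *\<^sub>R e) * indicator W v \<partial>lborel) \<le> (\<integral>\<^sup>+s. indicator {?a - r .. ?a + r} s * indicator W v \<partial>lborel)"
    proof (intro nn_integral_mono mult_right_mono)
      fix s
      have "s \<in> {?a - r .. ?a + r}" if "v - s *\<^sub>R e \<in> ?Q"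
      proof -
        have "\<bar>(v - s *\<^sub>R e - w0) \<bullet> e\<bar> \<le> norm (v - s *\<^sub>R e - w0) * norm e" by (rule Cauchy_Schwarz_ineq2)
        also have "\<dots> < r" using that e by (simp add: dist_norm norm_minus_commute)
        also have "(v - s *\<^sub>R e - w0) \<bullet> e = ?a - s"
          using e by (simp add: inner_diff_left norm_eq_1)
        finally show ?thesis by auto
      qed
      then show "indicator ?Q (v - s *\<^sub>R e) \<le> (indicator {?a - r .. ?a + r} s :: ennreal)"
        by (auto simp: indicator_def)
    qed simp
    also have "\<dots> = ennreal (2 * r) * indicator W v"
      using r by (simp add: nn_integral_multc)
    finally show "(\<integral>\<^sup>+s. indicator ?Q (v - s *\<^sub>R e) * indicator W v \<partial>lborel) \<le> ennreal (2 * r) * indicator W v" .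
  qed
  also have "\<dots> = ennreal (2 * r) * emeasure lborel W"
    by (simp add: nn_integral_cmult_indicator)
  also have "\<dots> < \<infinity>" using fin by (simp add: ennreal_mult_less_top)
  finally have "\<infinity> * emeasure lborel ?Q < \<infinity>" .
  moreover have "emeasure lborel ?Q \<noteq> 0"
  proof -
    have "0 < unit_ball_vol (real DIM('a))" by simp
    from less_imp_neq[OF this, symmetric] r show ?thesis by (simp add: emeasure_ball)
  qed
  ultimately show False by (simp add: ennreal_top_mult)
qed

lemma weighted_energy_diff_le:
  assumes "f \<in> L2 M" "g \<in> L2 M" "h \<in> L2 M" "F \<in> borel_measurable M" and F: "\<And>x. 0 \<le> F x \<and> F x \<le> (1::real)"
  shows "weighted_energy M F (\<lambda>x. f x - h x) \<le> 2 * weighted_energy M F (\<lambda>x. f x - g x) + 2 * weighted_energy M F (\<lambda>x. g x - h x)"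
proof -
  note i = weighted_integrable[OF L2_diff[OF assms(1,3)] assms(4) F] weighted_integrable[OF L2_diff[OF assms(1,2)] assms(4) F]
    weighted_integrable[OF L2_diff[OF assms(2,3)] assms(4) F]
  have "weighted_energy M F (\<lambda>x. f x - h x) \<le> (LINT x|M. 2 * (F x * (cmod (f x - g x))\<^sup>2) + 2 * (F x * (cmod (g x - h x))\<^sup>2))"
    unfolding weighted_energy_def
  proof (rule integral_mono)
    fix x
    have "(cmod (f x - h x))\<^sup>2 \<le> 2 * (cmod (f x - g x))\<^sup>2 + 2 * (cmod (g x - h x))\<^sup>2"
      using cmod_add_square_le[of "f x - g x" "g x - h x"] by simp
    from mult_left_mono[OF this, of "F x"] F[of x]
    show "F x * (cmod (f x - h x))\<^sup>2 \<le> 2 * (F x * (cmod (f x - g x))\<^sup>2) + 2 * (F x * (cmod (g x - h x))\<^sup>2)"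
      by (simp add: algebra_simps)
  qed (use i in auto)
  also have "\<dots> = 2 * weighted_energy M F (\<lambda>x. f x - g x) + 2 * weighted_energy M F (\<lambda>x. g x - h x)"
    unfolding weighted_energy_def using i by simp
  finally show ?thesis .
qed

context gaussian_window
begin

text \<open>
  Complexify the frequency parameter: expanding \<open>exp (z * c t)\<close> under the integral gives an
  everywhere convergent power series, because the shifted window has exponential moments of every
  order against \<open>\<psi>\<close>.
\<close>

lemma V_line_entire:
  assumes \<psi>: "\<psi> \<in> L2 lborel"
  shows "\<exists>g. g holomorphic_on UNIV \<and> (\<forall>s. V \<psi> (x, \<omega> + s *\<^sub>R e) = g (complex_of_real s))"
proof -
  have [measurable]: "\<psi> \<in> borel_measurable borel" using \<psi> by (auto simp: L2_def)
  define F where "F t = \<psi> t * cnj (\<phi> (t - x)) * cis (- 2 * pi * (\<omega> \<bullet> t))" for t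
  define c where "c t = \<i> * complex_of_real (- 2 * pi * (e \<bullet> t))" for t
  define g where "g z = (LINT t|lborel. F t * exp (z * c t))" for z
  have [measurable]: "F \<in> borel_measurable borel" "c \<in> borel_measurable borel"
    unfolding F_def c_def by measurable
  have cb: "cmod (c t) \<le> 2 * pi * norm e * norm t" for t
    using Cauchy_Schwarz_ineq2[of e t] by (simp add: c_def norm_mult abs_mult)
  define D where "D a t = exp (a * norm t) * cmod (F t)" for a t
  have D: "integrable lborel (D a)" for a
  proof -
    have "integrable lborel (\<lambda>t. cmod (\<psi> t * cnj (complex_of_real (exp (a * norm t)) * \<phi> (t - x))))"
      by (intro integrable_norm L2_prod_integrable(1)[OF \<psi>] weighted_window_L2)
    then show ?thesis by (simp add: D_def[abs_def] F_def norm_mult mult_ac)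
  qed
  define b where "b k = (LINT t|lborel. F t * (c t ^ k /\<^sub>R fact k))" for k
  have sums: "(\<lambda>k. b k * z ^ k) sums g z" for z
  proof -
    define a where "a = cmod z * (2 * pi * norm e)"
    define f where "f k t = F t * ((z * c t) ^ k /\<^sub>R fact k)" for k t
    have [measurable]: "f k \<in> borel_measurable borel" for k unfolding f_def by measurable
    have nf: "norm (f k t) = cmod (F t) * (cmod (z * c t) ^ k /\<^sub>R fact k)" for k t
      by (simp add: f_def norm_mult norm_power)
    have zc: "cmod (z * c t) \<le> a * norm t" for t
      using mult_left_mono[OF cb[of t], of "cmod z"] by (simp add: norm_mult a_def mult_ac)
    have fsum: "(\<lambda>k. norm (f k t)) sums (cmod (F t) * exp (cmod (z * c t)))" for t
      unfolding nf by (intro sums_mult exp_converges)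
    have le: "cmod (F t) * exp (cmod (z * c t)) \<le> D a t" for t
      using zc[of t] by (simp add: D_def mult.commute mult_left_mono)
    have part: "(\<Sum>k<n. norm (f k t)) \<le> D a t" for n t
      using sum_le_suminf[OF sums_summable[OF fsum[of t]], of "{..<n}"] sums_unique[OF fsum[of t]] le[of t] by simp
    have one: "norm (f k t) \<le> D a t" for k t
      using part[where n="Suc k" and t=t] sum_nonneg[of "{..<k}" "\<lambda>k. norm (f k t)"] by simp
    have fi: "integrable lborel (f k)" for k
      by (rule Bochner_Integration.integrable_bound[OF D[of a]]) (use one in \<open>auto intro!: AE_I2 order_trans[OF one]\<close>)
    have "summable (\<lambda>k. LINT t|lborel. norm (f k t))"
    proof (rule summableI_nonneg_bounded)
      fix n
      have "(\<Sum>k<n. LINT t|lborel. norm (f k t)) = (LINT t|lborel. (\<Sum>k<n. norm (f k t)))"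
        using fi by simp
      also have "\<dots> \<le> (LINT t|lborel. D a t)"
        using fi D part by (intro integral_mono) auto
      finally show "(\<Sum>k<n. LINT t|lborel. norm (f k t)) \<le> (LINT t|lborel. D a t)" .
    qed simp
    then have "(\<lambda>k. integral\<^sup>L lborel (f k)) sums (LINT t|lborel. (\<Sum>k. f k t))"
      by (intro sums_integral fi AE_I2 sums_summable[OF fsum])
    moreover have "(\<Sum>k. f k t) = F t * exp (z * c t)" for t
      unfolding f_def by (intro sums_unique[symmetric] sums_mult exp_converges)
    moreover have "integral\<^sup>L lborel (f k) = b k * z ^ k" for k
      unfolding f_def b_def by (subst integral_mult_left_zero[symmetric]) (simp add: power_mult_distrib mult_ac scaleR_conv_of_real)
    ultimately show ?thesis by (simp add: g_def)
  qed
  have "g holomorphic_on UNIV"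
  proof -
    have "g holomorphic_on ball 0 r" for r
      by (rule power_series_holomorphic[where a=b]) (use sums in simp)
    then have "g field_differentiable at w" for w
      by (rule holomorphic_on_imp_differentiable_at[where s="ball 0 (norm w + 1)"]) auto
    then show ?thesis by (simp add: holomorphic_on_def field_differentiable_at_within)
  qed
  moreover have "V \<psi> (x, \<omega> + s *\<^sub>R e) = g (complex_of_real s)" for s
    unfolding V_fourier fourier_def g_def
  proof (rule Bochner_Integration.integral_cong[OF refl])
    fix t
    have "cis (- 2 * pi * ((\<omega> + s *\<^sub>R e) \<bullet> t)) = cis (- 2 * pi * (\<omega> \<bullet> t)) * cis (s * (- 2 * pi * (e \<bullet> t)))"
      unfolding cis_mult by (simp add: inner_add_left algebra_simps)
    also have "cis (s * (- 2 * pi * (e \<bullet> t))) = exp (complex_of_real s * c t)"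
      unfolding cis_conv_exp c_def by (simp add: mult_ac)
    finally show "\<psi> t * cnj (\<phi> (t - x)) * cis (- 2 * pi * ((\<omega> + s *\<^sub>R e) \<bullet> t)) = F t * exp (complex_of_real s * c t)"
      by (simp add: F_def)
  qed
  ultimately show ?thesis by blast
qed

text \<open>
  The transform in the coordinates of the Bargmann-Fock space; the sign of the frequency is the one
  in \<open>bargmann_map\<close>.
\<close>

definition G :: "(real^'n \<Rightarrow> complex) \<Rightarrow> complex^'n \<Rightarrow> complex" where
  "G \<psi> w = V \<psi> (vec_Re w, - vec_Im w)"

lemma G_add: "\<psi> \<in> L2 lborel \<Longrightarrow> \<eta> \<in> L2 lborel \<Longrightarrow> G (\<lambda>t. \<psi> t + \<eta> t) w = G \<psi> w + G \<eta> w"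
  and G_diff: "\<psi> \<in> L2 lborel \<Longrightarrow> \<eta> \<in> L2 lborel \<Longrightarrow> G (\<lambda>t. \<psi> t - \<eta> t) w = G \<psi> w - G \<eta> w"
  and G_cmult: "G (\<lambda>t. c * \<psi> t) w = c * G \<psi> w"
  by (simp_all add: G_def V_add V_diff V_cmult)

lemma G_continuous: "\<psi> \<in> L2 lborel \<Longrightarrow> continuous_on UNIV (G \<psi>)"
  unfolding G_def[abs_def]
  by (rule continuous_on_compose2[OF V_continuous]) (auto intro!: continuous_intros)

lemma G_measurable: "\<psi> \<in> L2 lborel \<Longrightarrow> G \<psi> \<in> borel_measurable borel"
  by (intro borel_measurable_continuous_onI G_continuous)

lemma G_nn_integral:
  assumes \<psi>: "\<psi> \<in> L2 lborel"
  shows "(\<integral>\<^sup>+w. ennreal ((cmod (G \<psi> w))\<^sup>2) \<partial>lborel) = ennreal (sq_norm lborel \<phi> * sq_norm lborel \<psi>)"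
proof -
  have [measurable]: "G \<psi> \<in> borel_measurable borel" by (rule G_measurable[OF \<psi>])
  have [measurable]: "V \<psi> \<in> borel_measurable borel" by (intro borel_measurable_continuous_onI V_continuous \<psi>)
  have "continuous_on UNIV (\<lambda>\<omega>. V \<psi> (x, \<omega>))" for x
    by (rule continuous_on_compose2[OF V_continuous[OF \<psi>]]) (auto intro!: continuous_intros)
  then have Vx [measurable]: "(\<lambda>\<omega>. V \<psi> (x, \<omega>)) \<in> borel_measurable borel" for x
    by (rule borel_measurable_continuous_onI)
  have "(\<integral>\<^sup>+w. ennreal ((cmod (G \<psi> w))\<^sup>2) \<partial>lborel) = (\<integral>\<^sup>+x. \<integral>\<^sup>+\<omega>. ennreal ((cmod (V \<psi> (x, - \<omega>)))\<^sup>2) \<partial>lborel \<partial>lborel)"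
  proof -
    have m: "(\<lambda>w. ennreal ((cmod (G \<psi> w))\<^sup>2)) \<in> borel_measurable borel" by measurable
    show ?thesis using nn_integral_vec_Complex[OF m] by (simp add: G_def)
  qed
  also have "\<dots> = (\<integral>\<^sup>+x. \<integral>\<^sup>+\<omega>. ennreal ((cmod (V \<psi> (x, \<omega>)))\<^sup>2) \<partial>lborel \<partial>lborel)"
  proof (rule nn_integral_cong)
    fix x
    show "(\<integral>\<^sup>+\<omega>. ennreal ((cmod (V \<psi> (x, - \<omega>)))\<^sup>2) \<partial>lborel) = (\<integral>\<^sup>+\<omega>. ennreal ((cmod (V \<psi> (x, \<omega>)))\<^sup>2) \<partial>lborel)"
      by (subst lborel_nn_integral_affine[of "-1" "\<lambda>\<omega>. ennreal ((cmod (V \<psi> (x, \<omega>)))\<^sup>2)" 0]) simp_all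
  qed
  finally show ?thesis by (simp add: moyal[OF \<psi>])
qed

lemma G_L2: "\<psi> \<in> L2 lborel \<Longrightarrow> G \<psi> \<in> L2 lebesgue"
  and G_sq_norm: "\<psi> \<in> L2 lborel \<Longrightarrow> sq_norm lebesgue (G \<psi>) = sq_norm lborel \<phi> * sq_norm lborel \<psi>"
proof -
  assume \<psi>: "\<psi> \<in> L2 lborel"
  note [measurable] = G_measurable[OF \<psi>]
  have "integrable lborel (\<lambda>w. (cmod (G \<psi> w))\<^sup>2)"
    by (rule integrableI_bounded) (simp_all add: G_nn_integral[OF \<psi>])
  then have GL: "G \<psi> \<in> L2 lborel" by (simp add: L2_def)
  then show "G \<psi> \<in> L2 lebesgue" by (simp add: L2_def integrable_completion measurable_completion)
  have "ennreal (sq_norm lborel (G \<psi>)) = ennreal (sq_norm lborel \<phi> * sq_norm lborel \<psi>)"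
    using nn_integral_sq_norm[OF GL] G_nn_integral[OF \<psi>] by simp
  moreover have "sq_norm lebesgue (G \<psi>) = sq_norm lborel (G \<psi>)"
    unfolding sq_norm_def by (rule integral_completion) measurable
  ultimately show "sq_norm lebesgue (G \<psi>) = sq_norm lborel \<phi> * sq_norm lborel \<psi>" by simp
qed

text \<open>
  An uncertainty principle: on a suitable line in a frequency direction, the transform is nonzero at
  one point and nonzero only on a set of finite length. Its zeros would then have infinite length,
  but a nonzero entire function has countably many of them.
\<close>

lemma G_finite_support_imp_zero:
  assumes \<psi>: "\<psi> \<in> L2 lborel" and fin: "emeasure lborel {w. G \<psi> w \<noteq> 0} < \<infinity>"
  shows "G \<psi> w = 0"
proof (rule ccontr)
  assume "G \<psi> w \<noteq> 0"
  define W where "W = {w. G \<psi> w \<noteq> 0}"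
  have W: "open W"
    unfolding W_def by (rule open_Collect_neq[OF G_continuous[OF \<psi>] continuous_on_const])
  define i :: 'n where "i = undefined"
  define e :: "complex^'n" where "e = vec_Complex (0, axis i 1)"
  have "(norm e)\<^sup>2 = 1" by (simp add: norm_vec_Re_Im e_def norm_axis_1)
  then have e: "norm e = 1" by (metis real_sqrt_abs abs_norm_cancel real_sqrt_one)
  have "w \<in> W" using \<open>G \<psi> w \<noteq> 0\<close> by (simp add: W_def)
  then obtain v where v: "v \<in> W" "emeasure lborel {s. v + s *\<^sub>R e \<in> W} < \<infinity>"
    using finite_measure_line[OF W _ e] fin by (auto simp: W_def)
  obtain g where g: "g holomorphic_on UNIV"
    "\<And>s. V \<psi> (vec_Re v, - vec_Im v + s *\<^sub>R (- axis i 1)) = g (complex_of_real s)"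
    using V_line_entire[OF \<psi>] by blast
  have Gg: "G \<psi> (v + s *\<^sub>R e) = g (complex_of_real s)" for s
    using g(2)[of s] by (simp add: G_def vec_Re_add vec_Im_add vec_Re_scaleR vec_Im_scaleR e_def)
  have g0: "g 0 \<noteq> 0" using Gg[of 0] v(1) by (simp add: W_def)
  have "countable {z\<in>UNIV. g z = 0}"
  proof (cases "g constant_on UNIV")
    case True
    then have "{z\<in>UNIV. g z = 0} = {}" using g0 by (auto simp: constant_on_def)
    then show ?thesis by simp
  next
    case False
    then show ?thesis by (intro holomorphic_countable_zeros g(1)) auto
  qed
  moreover have "complex_of_real ` {s. G \<psi> (v + s *\<^sub>R e) = 0} \<subseteq> {z\<in>UNIV. g z = 0}" by (auto simp: Gg)
  ultimately have "countable (complex_of_real ` {s. G \<psi> (v + s *\<^sub>R e) = 0})" by (rule countable_subset[rotated])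
  then have cnt: "countable {s. G \<psi> (v + s *\<^sub>R e) = 0}" by (rule countable_image_inj_on) (simp add: inj_on_def)
  then have "emeasure lborel {s. G \<psi> (v + s *\<^sub>R e) = 0} = 0" by (rule emeasure_lborel_countable)
  moreover have "{s. v + s *\<^sub>R e \<in> W} \<union> {s. G \<psi> (v + s *\<^sub>R e) = 0} = UNIV" by (auto simp: W_def)
  moreover have "{s. v + s *\<^sub>R e \<in> W} \<in> sets lborel"
  proof -
    have "open ((\<lambda>s. v + s *\<^sub>R e) -` W)" by (intro open_vimage W continuous_intros)
    then show ?thesis by (simp add: vimage_def)
  qed
  moreover have "{s. G \<psi> (v + s *\<^sub>R e) = 0} \<in> sets lborel"
    using cnt by (simp add: sets.countable)
  ultimately have "emeasure lborel (UNIV :: real set) \<le> emeasure lborel {s. v + s *\<^sub>R e \<in> W} + 0"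
    by (metis emeasure_subadditive)
  then show False using v(2) by simp
qed

text \<open>
  Arzela-Ascoli without compactness of the domain: a diagonal sequence converges on a countable
  dense set, and equicontinuity extends the convergence to all points.
\<close>

lemma V_pointwise_convergent_subsequence:
  assumes \<psi>: "\<And>k. \<psi> k \<in> L2 lborel" and B: "\<And>k. sq_norm lborel (\<psi> k) \<le> B"
  shows "\<exists>r :: nat \<Rightarrow> nat. strict_mono r \<and> (\<forall>z. convergent (\<lambda>k. V (\<psi> (r k)) z))"
proof -
  obtain D :: "((real^'n) \<times> (real^'n)) set" where D: "countable D" "\<And>X. open X \<Longrightarrow> X \<noteq> {} \<Longrightarrow> \<exists>d\<in>D. d \<in> X"
    using countable_dense_setE by blast
  have B0: "0 \<le> B" using order_trans[OF sq_norm_nonneg B[of 0]] .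
  have bd: "norm (V (\<psi> k) z) \<le> sqrt (B * sq_norm lborel \<phi>)" for k z
    using V_bound[OF \<psi>[of k], of z] mult_right_mono[OF B[of k], of "sq_norm lborel \<phi>"]
    by (intro real_le_rsqrt) simp
  obtain r :: "nat \<Rightarrow> nat" where r: "strict_mono r" and conv: "\<And>d. d \<in> D \<Longrightarrow> \<exists>l. (\<lambda>k. V (\<psi> (r k)) d) \<longlonglongrightarrow> l"
    using function_convergent_subsequence[OF D(1), of "\<lambda>k. V (\<psi> k)"] bd by blast
  have "convergent (\<lambda>k. V (\<psi> (r k)) z)" for z
  proof (rule Cauchy_convergent, rule CauchyI)
    fix \<epsilon> :: real assume \<epsilon>: "0 < \<epsilon>"
    have "\<exists>d. d \<in> D \<and> dist z d < 1 / real (Suc k)" for k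
      using D(2)[of "ball z (1 / real (Suc k))"] by auto
    then have "\<forall>k. \<exists>d. d \<in> D \<and> dist z d < 1 / real (Suc k)" by blast
    from choice[OF this] obtain d where d: "\<And>k. d k \<in> D" "\<And>k. dist z (d k) < 1 / real (Suc k)" by blast
    have "d \<longlonglongrightarrow> z"
    proof (rule metric_tendsto_imp_tendsto[OF LIMSEQ_inverse_real_of_nat])
      show "\<forall>\<^sub>F k in sequentially. dist (d k) z \<le> dist (inverse (real (Suc k))) 0"
        using d(2) by (intro always_eventually allI) (auto simp: dist_commute inverse_eq_divide intro!: less_imp_le)
    qed
    then have "(\<lambda>k. B * sq_norm lborel (\<lambda>t. tf_shift (d k) \<phi> t - tf_shift z \<phi> t)) \<longlonglongrightarrow> B * 0"
      by (intro tendsto_intros tf_shift_continuous)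
    from LIMSEQ_D[OF this, of "(\<epsilon> / 3)\<^sup>2"] \<epsilon>
    obtain m where m: "\<bar>B * sq_norm lborel (\<lambda>t. tf_shift (d m) \<phi> t - tf_shift z \<phi> t)\<bar> < (\<epsilon> / 3)\<^sup>2" by auto
    have near: "norm (V (\<psi> k) (d m) - V (\<psi> k) z) < \<epsilon> / 3" for k
    proof -
      have "(cmod (V (\<psi> k) (d m) - V (\<psi> k) z))\<^sup>2 \<le> sq_norm lborel (\<psi> k) * sq_norm lborel (\<lambda>t. tf_shift (d m) \<phi> t - tf_shift z \<phi> t)"
        by (rule V_diff_bound[OF \<psi>])
      also have "\<dots> \<le> B * sq_norm lborel (\<lambda>t. tf_shift (d m) \<phi> t - tf_shift z \<phi> t)"
        by (intro mult_right_mono B) simp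
      also have "\<dots> < (\<epsilon> / 3)\<^sup>2" using m by simp
      finally show ?thesis by (rule power_less_imp_less_base) (use \<epsilon> in simp)
    qed
    have "Cauchy (\<lambda>k. V (\<psi> (r k)) (d m))" using conv[OF d(1)] by (auto intro: LIMSEQ_imp_Cauchy)
    from CauchyD[OF this, of "\<epsilon> / 3"] \<epsilon> obtain M
      where M: "\<And>j k. j \<ge> M \<Longrightarrow> k \<ge> M \<Longrightarrow> norm (V (\<psi> (r j)) (d m) - V (\<psi> (r k)) (d m)) < \<epsilon> / 3" by auto
    have tri: "norm (- a + b + c) \<le> norm a + norm b + norm c" for a b c :: complex
      using norm_triangle_ineq[of "- a + b" c] norm_triangle_ineq[of "- a" b] by simp
    have "norm (V (\<psi> (r j)) z - V (\<psi> (r k)) z) < \<epsilon>" if "j \<ge> M" "k \<ge> M" for j k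
    proof -
      have "norm (V (\<psi> (r j)) z - V (\<psi> (r k)) z) \<le> norm (V (\<psi> (r j)) (d m) - V (\<psi> (r j)) z)
          + norm (V (\<psi> (r j)) (d m) - V (\<psi> (r k)) (d m)) + norm (V (\<psi> (r k)) (d m) - V (\<psi> (r k)) z)"
        using tri[of "V (\<psi> (r j)) (d m) - V (\<psi> (r j)) z" "V (\<psi> (r j)) (d m) - V (\<psi> (r k)) (d m)"
            "V (\<psi> (r k)) (d m) - V (\<psi> (r k)) z"] by simp
      then show ?thesis using near[of "r j"] near[of "r k"] M[OF that] by linarith
    qed
    then show "\<exists>M. \<forall>j\<ge>M. \<forall>k\<ge>M. norm (V (\<psi> (r j)) z - V (\<psi> (r k)) z) < \<epsilon>" by blast
  qed
  with r show ?thesis by blast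
qed

end

section \<open>Concentration of energy\<close>

lemma weighted_energy_cmult: "weighted_energy M F (\<lambda>x. c * f x) = (cmod c)\<^sup>2 * weighted_energy M F f"
  unfolding weighted_energy_def
  by (subst integral_mult_right_zero[symmetric]) (simp add: norm_mult power_mult_distrib mult.left_commute)

lemma weighted_energy_indicator_split:
  assumes f: "f \<in> L2 M" and [measurable]: "A \<in> sets M"
  shows "weighted_energy M (indicator A) f + weighted_energy M (indicator (- A)) f = sq_norm M f"
proof -
  have [measurable]: "f \<in> borel_measurable M" using f by (rule L2_measurable)
  have m: "(indicator (- A) :: 'a \<Rightarrow> real) \<in> borel_measurable M"
  proof -
    have "(indicator (- A) :: 'a \<Rightarrow> real) = (\<lambda>x. 1 - indicator A x)" by (auto simp: indicator_def)
    then show ?thesis by simp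
  qed
  have "sq_norm M f = (LINT x|M. indicator A x * (cmod (f x))\<^sup>2 + indicator (- A) x * (cmod (f x))\<^sup>2)"
    unfolding sq_norm_def by (intro Bochner_Integration.integral_cong refl) (auto simp: indicator_def)
  also have "\<dots> = weighted_energy M (indicator A) f + weighted_energy M (indicator (- A)) f"
    unfolding weighted_energy_def
    by (intro Bochner_Integration.integral_add weighted_integrable f m) (auto simp: indicator_def)
  finally show ?thesis by simp
qed

lemma L2_CauchyI:
  assumes N: "0 < N" and le: "\<And>j k. N * sq_norm M (\<lambda>x. f j x - f k x) \<le> \<delta> j + \<delta> k" and \<delta>: "\<delta> \<longlonglongrightarrow> (0::real)"
  shows "L2_Cauchy M f"
  unfolding L2_Cauchy_def
proof (intro allI impI)
  fix e :: real assume "0 < e"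
  then have "0 < N * e / 2" using N by simp
  from LIMSEQ_D[OF \<delta> this] obtain K where K: "\<And>k. k \<ge> K \<Longrightarrow> \<bar>\<delta> k\<bar> < N * e / 2" by auto
  have "sq_norm M (\<lambda>x. f j x - f k x) < e" if "j \<ge> K" "k \<ge> K" for j k
  proof -
    have "N * sq_norm M (\<lambda>x. f j x - f k x) < N * e"
      using le[of j k] K[OF that(1)] K[OF that(2)] by linarith
    then show ?thesis using N by simp
  qed
  then show "\<exists>K. \<forall>j\<ge>K. \<forall>k\<ge>K. sq_norm M (\<lambda>x. f j x - f k x) < e" by blast
qed

context gaussian_window
begin

text \<open>
  Suppose that normalized \<open>\<psi> k\<close> have transforms whose energy on \<open>\<Omega>\<close> tends to zero. A subsequence of
  the transforms converges pointwise, hence in the mean on the complement of \<open>\<Omega>\<close> by dominated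
  convergence. So it is Cauchy everywhere, and by Moyal's identity the \<open>\<psi> (r k)\<close> converge to some
  \<open>\<xi> \<noteq> 0\<close> whose transform vanishes almost everywhere on \<open>\<Omega>\<close>, contradicting
  \<open>G_finite_support_imp_zero\<close>.
\<close>

lemma G_energy_coercive:
  assumes \<Omega> [measurable]: "\<Omega> \<in> sets (lebesgue :: (complex^'n) measure)" and fin: "emeasure lebesgue (- \<Omega>) < \<infinity>"
  shows "\<exists>c>0. \<forall>\<psi>\<in>L2 lborel. c * sq_norm lebesgue (G \<psi>) \<le> weighted_energy lebesgue (indicator \<Omega>) (G \<psi>)"
proof (rule ccontr)
  assume contra: "\<not> ?thesis"
  define N where "N = sq_norm lborel \<phi>"
  define E where "E = weighted_energy lebesgue (indicator \<Omega> :: complex^'n \<Rightarrow> real)"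
  define E' where "E' = weighted_energy lebesgue (indicator (- \<Omega>) :: complex^'n \<Rightarrow> real)"
  have N: "0 < N" using nonzero by (simp add: N_def)
  have \<Omega>c [measurable]: "- \<Omega> \<in> sets lebesgue" using \<Omega> by (simp add: Compl_in_sets_lebesgue)
  have im: "(indicator \<Omega> :: complex^'n \<Rightarrow> real) \<in> borel_measurable lebesgue"
    "(indicator (- \<Omega>) :: complex^'n \<Rightarrow> real) \<in> borel_measurable lebesgue" by measurable
  have i01: "0 \<le> (indicator A x :: real) \<and> indicator A x \<le> (1::real)" for A :: "(complex^'n) set" and x by (simp add: indicator_def)
  note Esplit = weighted_energy_indicator_split[OF _ \<Omega>, folded E_def E'_def]
  note Ele = weighted_energy_le(1)[OF _ im(1) i01, folded E_def]
  note Enn = weighted_energy_le(2)[OF _ im(1) i01, folded E_def]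
  note Etri = weighted_energy_diff_le[OF _ _ _ im(1) i01, folded E_def]
  note E'tri = weighted_energy_diff_le[OF _ _ _ im(2) i01, folded E'_def]
  have "\<exists>\<psi>\<in>L2 lborel. sq_norm lborel \<psi> = 1 \<and> E (G \<psi>) < N * (1 / real (Suc k))" for k
  proof -
    have "\<not> (\<forall>\<psi>\<in>L2 lborel. 1 / real (Suc k) * sq_norm lebesgue (G \<psi>) \<le> E (G \<psi>))"
      using contra unfolding E_def by (metis of_nat_0_less_iff zero_less_Suc zero_less_divide_1_iff)
    then obtain \<eta> where \<eta>: "\<eta> \<in> L2 lborel" and lt: "E (G \<eta>) < 1 / real (Suc k) * (N * sq_norm lborel \<eta>)"
      by (auto simp: G_sq_norm N_def not_le)
    have pos: "0 < sq_norm lborel \<eta>"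
    proof (rule ccontr)
      assume "\<not> 0 < sq_norm lborel \<eta>"
      then have "sq_norm lborel \<eta> = 0" using sq_norm_nonneg[of lborel \<eta>] by linarith
      then show False using lt Enn[OF G_L2[OF \<eta>]] by simp
    qed
    define a where "a = complex_of_real (1 / sqrt (sq_norm lborel \<eta>))"
    have a2: "(cmod a)\<^sup>2 = 1 / sq_norm lborel \<eta>" using pos by (simp add: a_def norm_divide power_divide)
    have "E (G (\<lambda>t. a * \<eta> t)) = E (G \<eta>) / sq_norm lborel \<eta>"
      by (simp add: E_def G_cmult[abs_def] weighted_energy_cmult a2)
    also have "\<dots> < (1 / real (Suc k) * (N * sq_norm lborel \<eta>)) / sq_norm lborel \<eta>"
      using lt pos by (intro divide_strict_right_mono)
    also have "\<dots> = N * (1 / real (Suc k))" using pos by simp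
    finally have "E (G (\<lambda>t. a * \<eta> t)) < N * (1 / real (Suc k))" .
    moreover have "sq_norm lborel (\<lambda>t. a * \<eta> t) = 1" using pos by (simp add: sq_norm_cmult a2)
    ultimately show ?thesis using L2_cmult[OF \<eta>, of a] by blast
  qed
  then obtain \<psi> where \<psi>: "\<And>k. \<psi> k \<in> L2 lborel" and \<psi>1: "\<And>k. sq_norm lborel (\<psi> k) = 1"
    and \<psi>E: "\<And>k. E (G (\<psi> k)) < N * (1 / real (Suc k))" by metis
  obtain r :: "nat \<Rightarrow> nat" where r: "strict_mono r" and conv: "\<And>z. convergent (\<lambda>k. V (\<psi> (r k)) z)"
    using V_pointwise_convergent_subsequence[of \<psi> 1] \<psi> \<psi>1 by auto
  define \<eta> where "\<eta> k = \<psi> (r k)" for k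
  define g where "g k = G (\<eta> k)" for k
  have \<eta>: "\<eta> k \<in> L2 lborel" for k using \<psi> by (simp add: \<eta>_def)
  have \<eta>1: "sq_norm lborel (\<eta> k) = 1" for k using \<psi>1 by (simp add: \<eta>_def)
  have gL2: "g k \<in> L2 lebesgue" for k using G_L2[OF \<eta>] by (simp add: g_def)
  have [measurable]: "g k \<in> borel_measurable lebesgue" for k using gL2 by (rule L2_measurable)
  have \<eta>E: "E (g k) \<le> N * (1 / real (Suc k))" for k
  proof -
    have "E (g k) < N * (1 / real (Suc (r k)))" using \<psi>E[of "r k"] by (simp add: g_def \<eta>_def)
    also have "\<dots> \<le> N * (1 / real (Suc k))"
      using seq_suble[OF r, of k] N by (intro mult_left_mono divide_left_mono) auto
    finally show ?thesis by simp
  qed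
  have E0: "(\<lambda>k. E (g k)) \<longlonglongrightarrow> 0"
  proof (rule tendsto_sandwich[OF _ _ tendsto_const])
    have "(\<lambda>k. N * (1 / real (Suc k))) \<longlonglongrightarrow> N * 0"
      using LIMSEQ_inverse_real_of_nat by (intro tendsto_intros) (simp add: inverse_eq_divide)
    then show "(\<lambda>k. N * (1 / real (Suc k))) \<longlonglongrightarrow> 0" by simp
  qed (use \<eta>E Enn[OF gL2] in \<open>auto intro!: always_eventually\<close>)
  have gconv: "convergent (\<lambda>k. g k w)" for w
    using conv by (simp add: g_def \<eta>_def G_def)
  \<comment> \<open>Cut off to the complement of \<open>\<Omega>\<close>, where boundedness makes the limit square-integrable.\<close>
  define L where "L w = indicator (- \<Omega>) w * lim (\<lambda>k. g k w)" for w
  have glim: "(\<lambda>k. g k w) \<longlonglongrightarrow> lim (\<lambda>k. g k w)" for w using gconv by (simp add: convergent_LIMSEQ_iff)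
  have gb: "(cmod (g k w))\<^sup>2 \<le> N" for k w
    using V_bound[OF \<eta>[of k], of "(vec_Re w, - vec_Im w)"] by (simp add: g_def G_def \<eta>1 N_def)
  have Lb: "(cmod (L w))\<^sup>2 \<le> N" for w
  proof (cases "w \<in> - \<Omega>")
    case True
    have "(\<lambda>k. (cmod (g k w))\<^sup>2) \<longlonglongrightarrow> (cmod (lim (\<lambda>k. g k w)))\<^sup>2" using glim by (intro tendsto_intros)
    then have "(cmod (lim (\<lambda>k. g k w)))\<^sup>2 \<le> N" by (rule LIMSEQ_le_const2) (use gb in auto)
    then show ?thesis using True by (simp add: L_def)
  qed (use N in \<open>simp add: L_def\<close>)
  have Lm [measurable]: "L \<in> borel_measurable lebesgue"
  proof -
    have "(\<lambda>w. lim (\<lambda>k. g k w)) \<in> borel_measurable lebesgue" by (rule borel_measurable_lim_metric) simp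
    then show ?thesis unfolding L_def by measurable
  qed
  have indint: "integrable lebesgue (\<lambda>w. 4 * N * indicator (- \<Omega>) w :: real)"
    using fin \<Omega>c by (intro integrable_mult_right) simp
  have LL2: "L \<in> L2 lebesgue"
  proof -
    have "integrable lebesgue (\<lambda>w. (cmod (L w))\<^sup>2)"
    proof (rule Bochner_Integration.integrable_bound[OF indint])
      show "AE w in lebesgue. norm ((cmod (L w))\<^sup>2) \<le> norm (4 * N * indicator (- \<Omega>) w :: real)"
      proof (rule AE_I2)
        fix w show "norm ((cmod (L w))\<^sup>2) \<le> norm (4 * N * indicator (- \<Omega>) w :: real)"
          using Lb[of w] N by (cases "w \<in> \<Omega>") (auto simp: L_def)
      qed
    qed measurable
    then show ?thesis by (simp add: L2_def)
  qed
  have E'0: "(\<lambda>k. E' (\<lambda>w. g k w - L w)) \<longlonglongrightarrow> 0"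
  proof -
    have "(\<lambda>k. LINT w|lebesgue. indicator (- \<Omega>) w * (cmod (g k w - L w))\<^sup>2) \<longlonglongrightarrow> (LINT w|(lebesgue :: (complex^'n) measure). 0)"
    proof (rule integral_dominated_convergence[OF _ _ indint])
      show "AE w in lebesgue. (\<lambda>k. indicator (- \<Omega>) w * (cmod (g k w - L w))\<^sup>2) \<longlonglongrightarrow> 0"
      proof (rule AE_I2)
        fix w :: "complex^'n"
        show "(\<lambda>k. indicator (- \<Omega>) w * (cmod (g k w - L w))\<^sup>2) \<longlonglongrightarrow> 0"
        proof (cases "w \<in> \<Omega>")
          case False
          then have "L w = lim (\<lambda>k. g k w)" by (simp add: L_def)
          then have "(\<lambda>k. (cmod (g k w - L w))\<^sup>2) \<longlonglongrightarrow> 0\<^sup>2"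
            using glim[of w] by (intro tendsto_power tendsto_norm_zero LIM_zero) simp
          then show ?thesis using False by simp
        qed simp
      qed
      show "AE w in lebesgue. norm (indicator (- \<Omega>) w * (cmod (g k w - L w))\<^sup>2) \<le> 4 * N * indicator (- \<Omega>) w" for k
      proof (rule AE_I2)
        fix w
        have "(cmod (g k w - L w))\<^sup>2 \<le> 4 * N"
          using cmod_add_square_le[of "g k w" "- L w"] gb[of k w] Lb[of w] by simp
        then show "norm (indicator (- \<Omega>) w * (cmod (g k w - L w))\<^sup>2) \<le> 4 * N * indicator (- \<Omega>) w"
          by (auto simp: indicator_def)
      qed
    qed measurable
    then show ?thesis by (simp add: E'_def weighted_energy_def)
  qed
  define \<delta> where "\<delta> k = 2 * E (g k) + 2 * E' (\<lambda>w. g k w - L w)" for k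
  have \<delta>0: "\<delta> \<longlonglongrightarrow> 0"
  proof -
    have "(\<lambda>k. 2 * E (g k) + 2 * E' (\<lambda>w. g k w - L w)) \<longlonglongrightarrow> 2 * 0 + 2 * 0"
      by (intro tendsto_intros E0 E'0)
    then show ?thesis by (simp add: \<delta>_def[abs_def])
  qed
  have Gd: "G (\<lambda>t. f t - h t) = (\<lambda>w. G f w - G h w)" if "f \<in> L2 lborel" "h \<in> L2 lborel" for f h
    using G_diff[OF that] by auto
  have Esym: "weighted_energy M F (\<lambda>w. f w - h w) = weighted_energy M F (\<lambda>w. h w - f w)" for M :: "(complex^'n) measure" and F f h
    by (simp add: weighted_energy_def norm_minus_commute)
  have "N * sq_norm lborel (\<lambda>t. \<eta> j t - \<eta> k t) \<le> \<delta> j + \<delta> k" for j k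
  proof -
    have "N * sq_norm lborel (\<lambda>t. \<eta> j t - \<eta> k t) = sq_norm lebesgue (\<lambda>w. g j w - g k w)"
      using G_sq_norm[OF L2_diff[OF \<eta>[of j] \<eta>[of k]]] by (simp add: g_def Gd \<eta> N_def)
    also have "\<dots> = E (\<lambda>w. g j w - g k w) + E' (\<lambda>w. g j w - g k w)"
      using Esplit[OF L2_diff[OF gL2[of j] gL2[of k]]] by simp
    also have "E (\<lambda>w. g j w - g k w) \<le> 2 * E (g j) + 2 * E (g k)"
      using Etri[OF gL2[of j] L2_zero gL2[of k]] Esym[of lebesgue "indicator \<Omega>" "\<lambda>_. 0" "g k"] by (simp add: E_def)
    also have "E' (\<lambda>w. g j w - g k w) \<le> 2 * E' (\<lambda>w. g j w - L w) + 2 * E' (\<lambda>w. g k w - L w)"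
      using E'tri[OF gL2[of j] LL2 gL2[of k]] Esym[of lebesgue "indicator (- \<Omega>)" L "g k"] by (simp add: E'_def)
    finally show ?thesis by (simp add: \<delta>_def)
  qed
  from L2_CauchyI[OF N this \<delta>0] have "L2_Cauchy lborel \<eta>" .
  from L2_complete[OF \<eta> this] obtain \<xi> where \<xi>: "\<xi> \<in> L2 lborel" and lim: "(\<lambda>k. sq_norm lborel (\<lambda>t. \<eta> k t - \<xi> t)) \<longlonglongrightarrow> 0"
    by blast
  have "1 \<le> 2 * sq_norm lborel (\<lambda>t. \<eta> k t - \<xi> t) + 2 * sq_norm lborel \<xi>" for k
    using sq_norm_diff_le[OF \<eta>[of k] \<xi> L2_zero] \<eta>1[of k] by simp
  moreover have "(\<lambda>k. 2 * sq_norm lborel (\<lambda>t. \<eta> k t - \<xi> t) + 2 * sq_norm lborel \<xi>) \<longlonglongrightarrow> 2 * 0 + 2 * sq_norm lborel \<xi>"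
    by (intro tendsto_intros lim)
  ultimately have \<xi>1: "1 \<le> 2 * sq_norm lborel \<xi>"
    using LIMSEQ_le_const by fastforce
  have "E (G \<xi>) \<le> 2 * (N * sq_norm lborel (\<lambda>t. \<eta> k t - \<xi> t)) + 2 * E (g k)" for k
  proof -
    have "E (G \<xi>) \<le> 2 * E (\<lambda>w. G \<xi> w - g k w) + 2 * E (g k)"
      using Etri[OF G_L2[OF \<xi>] gL2[of k] L2_zero] by simp
    also have "E (\<lambda>w. G \<xi> w - g k w) = E (\<lambda>w. g k w - G \<xi> w)" unfolding E_def by (rule Esym)
    also have "\<dots> \<le> sq_norm lebesgue (\<lambda>w. g k w - G \<xi> w)" by (rule Ele[OF L2_diff[OF gL2 G_L2[OF \<xi>]]])
    also have "\<dots> = N * sq_norm lborel (\<lambda>t. \<eta> k t - \<xi> t)"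
      using G_sq_norm[OF L2_diff[OF \<eta>[of k] \<xi>]] by (simp add: g_def Gd \<eta> \<xi> N_def)
    finally show ?thesis by simp
  qed
  moreover have "(\<lambda>k. 2 * (N * sq_norm lborel (\<lambda>t. \<eta> k t - \<xi> t)) + 2 * E (g k)) \<longlonglongrightarrow> 2 * (N * 0) + 2 * 0"
    by (intro tendsto_intros lim E0)
  ultimately have "E (G \<xi>) \<le> 0" using LIMSEQ_le_const by fastforce
  then have "E (G \<xi>) = 0" using Enn[OF G_L2[OF \<xi>]] by simp
  then have "AE w in lebesgue. indicator \<Omega> w * (cmod (G \<xi> w))\<^sup>2 = 0"
    unfolding E_def weighted_energy_def
    by (subst (asm) integral_nonneg_eq_0_iff_AE) (auto intro!: weighted_integrable G_L2 \<xi> im i01)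
  then have ae: "AE w in lebesgue. w \<in> {w. G \<xi> w \<noteq> 0} \<longrightarrow> w \<in> - \<Omega>"
    by eventually_elim (auto simp: indicator_def split: if_splits)
  have op: "open {w. G \<xi> w \<noteq> 0}" by (rule open_Collect_neq[OF G_continuous[OF \<xi>] continuous_on_const])
  have "emeasure lborel {w. G \<xi> w \<noteq> 0} = emeasure lebesgue {w. G \<xi> w \<noteq> 0}" using op by simp
  also have "\<dots> \<le> emeasure lebesgue (- \<Omega>)" by (rule emeasure_mono_AE[OF ae \<Omega>c])
  finally have "emeasure lborel {w. G \<xi> w \<noteq> 0} < \<infinity>" using fin by simp
  then have "G \<xi> w = 0" for w by (rule G_finite_support_imp_zero[OF \<xi>])
  then have "sq_norm lebesgue (G \<xi>) = 0" by (simp add: sq_norm_def)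
  then show False using G_sq_norm[OF \<xi>] \<xi>1 N by (simp add: N_def)
qed

end

section \<open>The Fock space of a window\<close>

lemma AE_gauss: "(AE w in gauss. P w) \<longleftrightarrow> (AE w in (lebesgue :: (complex^'n) measure). P w)"
  unfolding gauss_def by (subst AE_density) (auto intro!: measurable_completion)

lemma sets_gauss [simp, measurable_cong]: "sets gauss = sets (lebesgue :: (complex^'n) measure)"
  by (simp add: gauss_def)

lemma measurable_gauss: "borel_measurable gauss = borel_measurable (lebesgue :: (complex^'n) measure)"
  by (rule measurable_cong_sets) simp_all

lemma gauss_integral:
  fixes f :: "complex^'n \<Rightarrow> real"
  assumes "f \<in> borel_measurable lebesgue"
  shows "integrable gauss f \<longleftrightarrow> integrable lebesgue (\<lambda>w. exp (- pi * (norm w)\<^sup>2) * f w)"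
    "integral\<^sup>L gauss f = (LINT w|lebesgue. exp (- pi * (norm w)\<^sup>2) * f w)"
proof -
  have m: "(\<lambda>w :: complex^'n. exp (- pi * (norm w)\<^sup>2)) \<in> borel_measurable lebesgue"
    by (rule measurable_completion) measurable
  show "integrable gauss f \<longleftrightarrow> integrable lebesgue (\<lambda>w. exp (- pi * (norm w)\<^sup>2) * f w)"
    unfolding gauss_def by (subst integrable_density[OF assms m]) auto
  show "integral\<^sup>L gauss f = (LINT w|lebesgue. exp (- pi * (norm w)\<^sup>2) * f w)"
    unfolding gauss_def by (subst integral_density[OF assms m]) auto
qed

text \<open>
  Passing to Borel representatives makes product measures usable; a Lebesgue measurable function
  need not be measurable for them.
\<close>

lemma L2_lebesgue_representative:
  fixes \<psi> :: "'a::euclidean_space \<Rightarrow> complex"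
  assumes "\<psi> \<in> L2 lebesgue"
  shows "\<exists>\<eta>\<in>L2 lborel. AE t in lebesgue. \<psi> t = \<eta> t"
proof -
  have m: "\<psi> \<in> borel_measurable lebesgue" using assms by (rule L2_measurable)
  obtain a where a: "a \<in> borel_measurable lborel" "AE t in lborel. Re (\<psi> t) = a t"
    using completion_ex_borel_measurable_real[OF measurable_compose[OF m borel_measurable_Re]] by blast
  obtain b where b: "b \<in> borel_measurable lborel" "AE t in lborel. Im (\<psi> t) = b t"
    using completion_ex_borel_measurable_real[OF measurable_compose[OF m borel_measurable_Im]] by blast
  define \<eta> where "\<eta> t = complex_of_real (a t) + \<i> * complex_of_real (b t)" for t
  have \<eta>m: "\<eta> \<in> borel_measurable lborel" unfolding \<eta>_def using a b by measurable
  have "AE t in lborel. \<psi> t = \<eta> t"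
    using a(2) b(2) by eventually_elim (simp add: \<eta>_def complex_eq_iff)
  then have ae: "AE t in lebesgue. \<psi> t = \<eta> t" by (rule AE_completion)
  have \<eta>l: "\<eta> \<in> borel_measurable lebesgue" using \<eta>m by (rule measurable_completion)
  have "integrable lebesgue (\<lambda>t. (cmod (\<eta> t))\<^sup>2)"
    using L2_integrable[OF assms]
  proof (rule integrable_cong_AE_imp)
    show "(\<lambda>t. (cmod (\<eta> t))\<^sup>2) \<in> borel_measurable lebesgue" using \<eta>l by simp
    show "AE t in lebesgue. (cmod (\<psi> t))\<^sup>2 = (cmod (\<eta> t))\<^sup>2" using ae by eventually_elim simp
  qed
  then have "integrable lborel (\<lambda>t. (cmod (\<eta> t))\<^sup>2)"
    using \<eta>m by (subst (asm) integrable_completion) auto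
  then have "\<eta> \<in> L2 lborel" using \<eta>m by (simp add: L2_def)
  with ae show ?thesis by blast
qed

lemma L2_lborel_imp_lebesgue:
  fixes \<psi> :: "'a::euclidean_space \<Rightarrow> complex"
  assumes "\<psi> \<in> L2 lborel" shows "\<psi> \<in> L2 lebesgue"
  using assms by (auto simp: L2_def integrable_completion intro: measurable_completion)

context gaussian_window
begin

lemma stft_eq_V:
  assumes \<psi>: "\<psi> \<in> L2 lebesgue" and \<eta>: "\<eta> \<in> L2 lborel" and ae: "AE t in lebesgue. \<psi> t = \<eta> t"
  shows "stft \<phi> \<psi> = V \<eta>"
proof
  fix z
  have [measurable]: "\<eta> \<in> borel_measurable borel" using \<eta> by (auto simp: L2_def)
  have m: "(\<lambda>t. \<eta> t * cnj (tf_shift z \<phi> t)) \<in> borel_measurable lborel" by measurable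
  have t: "(\<lambda>t. cnj (tf_shift z \<phi> t)) \<in> borel_measurable lebesgue"
    by (rule measurable_completion) measurable
  have "stft \<phi> \<psi> z = (LINT t|lebesgue. \<eta> t * cnj (tf_shift z \<phi> t))"
    unfolding stft_def l2_inner_def
  proof (rule integral_cong_AE)
    show "(\<lambda>t. \<psi> t * cnj (tf_shift z \<phi> t)) \<in> borel_measurable lebesgue"
      using L2_measurable[OF \<psi>] t by (rule borel_measurable_times)
    show "(\<lambda>t. \<eta> t * cnj (tf_shift z \<phi> t)) \<in> borel_measurable lebesgue"
      using m by (rule measurable_completion)
    show "AE t in lebesgue. \<psi> t * cnj (tf_shift z \<phi> t) = \<eta> t * cnj (tf_shift z \<phi> t)"
      using ae by eventually_elim simp
  qed
  also have "\<dots> = V \<eta> z" unfolding V_def l2_inner_def by (rule integral_completion[OF m])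
  finally show "stft \<phi> \<psi> z = V \<eta> z" .
qed

definition fock :: "(complex^'n \<Rightarrow> complex) set" where
  "fock = {H \<in> L2 gauss. \<exists>\<psi>\<in>L2 lborel. ae_eq gauss H (bargmann_map (V \<psi>))}"

lemma fock_eq_stft: "fock = {H \<in> L2 gauss. \<exists>\<psi>\<in>L2 lebesgue. ae_eq gauss H (bargmann_map (stft \<phi> \<psi>))}"
  unfolding fock_def
proof (intro Collect_cong conj_cong refl iffI)
  fix H assume "\<exists>\<psi>\<in>L2 lborel. ae_eq gauss H (bargmann_map (V \<psi>))"
  then obtain \<psi> where \<psi>: "\<psi> \<in> L2 lborel" "ae_eq gauss H (bargmann_map (V \<psi>))" by blast
  have "stft \<phi> \<psi> = V \<psi>" by (rule stft_eq_V[OF L2_lborel_imp_lebesgue[OF \<psi>(1)] \<psi>(1)]) simp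
  then show "\<exists>\<psi>\<in>L2 lebesgue. ae_eq gauss H (bargmann_map (stft \<phi> \<psi>))"
    using \<psi> L2_lborel_imp_lebesgue[OF \<psi>(1)] by force
next
  fix H assume "\<exists>\<psi>\<in>L2 lebesgue. ae_eq gauss H (bargmann_map (stft \<phi> \<psi>))"
  then obtain \<psi> where \<psi>: "\<psi> \<in> L2 lebesgue" "ae_eq gauss H (bargmann_map (stft \<phi> \<psi>))" by blast
  obtain \<eta> where \<eta>: "\<eta> \<in> L2 lborel" "AE t in lebesgue. \<psi> t = \<eta> t"
    using L2_lebesgue_representative[OF \<psi>(1)] by blast
  show "\<exists>\<psi>\<in>L2 lborel. ae_eq gauss H (bargmann_map (V \<psi>))"
    using \<psi>(2) \<eta>(1) unfolding stft_eq_V[OF \<psi>(1) \<eta>] by blast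
qed

definition bargmann_factor :: "complex^'n \<Rightarrow> complex" where
  "bargmann_factor w = exp (- complex_of_real pi * \<i> * complex_of_real (vec_Re w \<bullet> vec_Im w)) *
      complex_of_real (exp (pi / 2 * ((norm (vec_Re w))\<^sup>2 + (norm (vec_Im w))\<^sup>2)))"

lemma bargmann_V: "bargmann_map (V \<psi>) w = bargmann_factor w * G \<psi> w"
  by (simp add: bargmann_map_def bargmann_factor_def G_def Let_def)

text \<open>
  The Bargmann factor exactly compensates the Gaussian weight, so energies in the Fock space are
  energies of \<open>G \<psi>\<close> for Lebesgue measure.
\<close>

lemma bargmann_factor_norm: "exp (- pi * (norm w)\<^sup>2) * (cmod (bargmann_factor w))\<^sup>2 = 1"
proof -
  have "cmod (exp (- complex_of_real pi * \<i> * complex_of_real (vec_Re w \<bullet> vec_Im w))) = 1"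
    by (simp add: norm_exp_eq_Re)
  then have "cmod (bargmann_factor w) = exp (pi / 2 * (norm w)\<^sup>2)"
    unfolding bargmann_factor_def norm_vec_Re_Im[of w, symmetric] by (simp add: norm_mult)
  then have "(cmod (bargmann_factor w))\<^sup>2 = exp (pi * (norm w)\<^sup>2)"
    by (simp add: exp_double[symmetric])
  then show ?thesis by (simp add: exp_minus)
qed

lemma bargmann_measurable:
  assumes "\<psi> \<in> L2 lborel" shows "bargmann_map (V \<psi>) \<in> borel_measurable lebesgue"
proof -
  have "continuous_on UNIV bargmann_factor" unfolding bargmann_factor_def[abs_def] by (intro continuous_intros)
  then have "continuous_on UNIV (\<lambda>w. bargmann_factor w * G \<psi> w)"
    by (intro continuous_on_mult G_continuous assms)
  then have "bargmann_map (V \<psi>) \<in> borel_measurable borel"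
    unfolding bargmann_V[abs_def, symmetric] by (simp add: borel_measurable_continuous_onI bargmann_V[abs_def])
  then show ?thesis by (simp add: measurable_completion)
qed

lemma fock_energy:
  assumes \<psi>: "\<psi> \<in> L2 lborel" and H: "H \<in> borel_measurable lebesgue" and ae: "ae_eq gauss H (bargmann_map (V \<psi>))"
    and F: "F \<in> borel_measurable lebesgue"
  shows "weighted_energy gauss F H = weighted_energy lebesgue F (G \<psi>)"
proof -
  note [measurable] = H F
  have Gm: "G \<psi> \<in> borel_measurable lebesgue" using G_L2[OF \<psi>] by (rule L2_measurable)
  have "weighted_energy gauss F H = (LINT w|lebesgue. exp (- pi * (norm w)\<^sup>2) * (F w * (cmod (H w))\<^sup>2))"
    unfolding weighted_energy_def by (rule gauss_integral(2)) measurable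
  also have "\<dots> = (LINT w|lebesgue. F w * (cmod (G \<psi> w))\<^sup>2)"
  proof (rule integral_cong_AE)
    have m: "(\<lambda>w :: complex^'n. exp (- pi * (norm w)\<^sup>2)) \<in> borel_measurable lebesgue"
      by (rule measurable_completion) measurable
    show "(\<lambda>w. exp (- pi * (norm w)\<^sup>2) * (F w * (cmod (H w))\<^sup>2)) \<in> borel_measurable lebesgue"
      by (rule borel_measurable_times[OF m]) measurable
    show "(\<lambda>w. F w * (cmod (G \<psi> w))\<^sup>2) \<in> borel_measurable lebesgue" using Gm by measurable
    show "AE w in lebesgue. exp (- pi * (norm w)\<^sup>2) * (F w * (cmod (H w))\<^sup>2) = F w * (cmod (G \<psi> w))\<^sup>2"
      using ae unfolding ae_eq_def AE_gauss
    proof eventually_elim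
      case (elim w)
      have "exp (- pi * (norm w)\<^sup>2) * (F w * (cmod (H w))\<^sup>2) = (exp (- pi * (norm w)\<^sup>2) * (cmod (bargmann_factor w))\<^sup>2) * (F w * (cmod (G \<psi> w))\<^sup>2)"
        by (simp add: elim bargmann_V norm_mult power_mult_distrib)
      then show ?case unfolding bargmann_factor_norm by simp
    qed
  qed
  finally show ?thesis by (simp add: weighted_energy_def)
qed

lemma sq_norm_weighted: "sq_norm M f = weighted_energy M (\<lambda>_. 1) f"
  by (simp add: sq_norm_def weighted_energy_def)

lemma fock_sq_norm:
  assumes \<psi>: "\<psi> \<in> L2 lborel" and H: "H \<in> borel_measurable lebesgue" and ae: "ae_eq gauss H (bargmann_map (V \<psi>))"
  shows "sq_norm gauss H = sq_norm lborel \<phi> * sq_norm lborel \<psi>"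
  unfolding sq_norm_weighted[of gauss] fock_energy[OF assms borel_measurable_const]
  by (simp add: sq_norm_weighted[symmetric] G_sq_norm[OF \<psi>])

lemma bargmann_fock:
  assumes \<psi>: "\<psi> \<in> L2 lborel" shows "bargmann_map (V \<psi>) \<in> fock"
proof -
  have m: "bargmann_map (V \<psi>) \<in> borel_measurable lebesgue" by (rule bargmann_measurable[OF \<psi>])
  have "integrable gauss (\<lambda>w. (cmod (bargmann_map (V \<psi>) w))\<^sup>2)"
  proof (subst gauss_integral(1))
    show "(\<lambda>w. (cmod (bargmann_map (V \<psi>) w))\<^sup>2) \<in> borel_measurable lebesgue" using m by simp
    have "exp (- pi * (norm w)\<^sup>2) * (cmod (bargmann_map (V \<psi>) w))\<^sup>2 = (cmod (G \<psi> w))\<^sup>2" for w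
      using bargmann_factor_norm[of w] by (simp add: bargmann_V norm_mult power_mult_distrib flip: mult.assoc)
    then show "integrable lebesgue (\<lambda>w. exp (- pi * (norm w)\<^sup>2) * (cmod (bargmann_map (V \<psi>) w))\<^sup>2)"
      using L2_integrable[OF G_L2[OF \<psi>]] by simp
  qed
  then have "bargmann_map (V \<psi>) \<in> L2 gauss" using m by (simp add: L2_def measurable_gauss)
  then show ?thesis using \<psi> by (auto simp: fock_def ae_eq_def)
qed

lemma fock_subspace: "L2_subspace gauss fock"
  unfolding L2_subspace_def
proof (intro conjI ballI allI)
  show "fock \<subseteq> L2 gauss" by (auto simp: fock_def)
  have "bargmann_map (V (\<lambda>t. 0)) = (\<lambda>w. 0)" by (auto simp: bargmann_V G_def V_def l2_inner_def)
  then show "(\<lambda>w. 0) \<in> fock" using bargmann_fock[OF L2_zero] by simp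
next
  fix f g assume "f \<in> fock" "g \<in> fock"
  then obtain \<psi> \<eta> where *: "f \<in> L2 gauss" "g \<in> L2 gauss" "\<psi> \<in> L2 lborel" "\<eta> \<in> L2 lborel"
    "ae_eq gauss f (bargmann_map (V \<psi>))" "ae_eq gauss g (bargmann_map (V \<eta>))" by (auto simp: fock_def)
  have "ae_eq gauss (\<lambda>w. f w + g w) (bargmann_map (V (\<lambda>t. \<psi> t + \<eta> t)))"
    using *(5,6) unfolding ae_eq_def
    by eventually_elim (simp add: bargmann_V G_add *(3,4) distrib_left)
  then show "(\<lambda>w. f w + g w) \<in> fock"
    using L2_add[OF *(1,2)] L2_add[OF *(3,4)] by (auto simp: fock_def)
next
  fix c f assume "f \<in> fock"
  then obtain \<psi> where *: "f \<in> L2 gauss" "\<psi> \<in> L2 lborel" "ae_eq gauss f (bargmann_map (V \<psi>))"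
    by (auto simp: fock_def)
  have "ae_eq gauss (\<lambda>w. c * f w) (bargmann_map (V (\<lambda>t. c * \<psi> t)))"
    using *(3) unfolding ae_eq_def by eventually_elim (simp add: bargmann_V G_cmult)
  then show "(\<lambda>w. c * f w) \<in> fock"
    using L2_cmult[OF *(1)] L2_cmult[OF *(2)] by (auto simp: fock_def)
qed

lemma fock_diff_sq_norm:
  assumes "f \<in> L2 gauss" "g \<in> L2 gauss" "\<psi> \<in> L2 lborel" "\<eta> \<in> L2 lborel"
    "ae_eq gauss f (bargmann_map (V \<psi>))" "ae_eq gauss g (bargmann_map (V \<eta>))"
  shows "sq_norm gauss (\<lambda>w. f w - g w) = sq_norm lborel \<phi> * sq_norm lborel (\<lambda>t. \<psi> t - \<eta> t)"
proof (rule fock_sq_norm)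
  show "(\<lambda>t. \<psi> t - \<eta> t) \<in> L2 lborel" by (rule L2_diff[OF assms(3,4)])
  show "(\<lambda>w. f w - g w) \<in> borel_measurable lebesgue"
    using L2_measurable[OF L2_diff[OF assms(1,2)]] by (simp add: measurable_gauss)
  show "ae_eq gauss (\<lambda>w. f w - g w) (bargmann_map (V (\<lambda>t. \<psi> t - \<eta> t)))"
    using assms(5,6) unfolding ae_eq_def
    by eventually_elim (simp add: bargmann_V G_diff assms(3,4) right_diff_distrib)
qed

text \<open>
  Up to a constant factor, \<open>\<psi> \<mapsto> bargmann_map (V \<psi>)\<close> is an isometry from a complete space, so its
  image is closed.
\<close>

lemma fock_closed: "L2_closed gauss fock"
  unfolding L2_closed_def
proof (intro allI impI)
  fix f assume f: "\<forall>k. f k \<in> fock" and C: "L2_Cauchy gauss f"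
  have "\<forall>k. \<exists>\<psi>. f k \<in> L2 gauss \<and> \<psi> \<in> L2 lborel \<and> ae_eq gauss (f k) (bargmann_map (V \<psi>))"
    using f by (auto simp: fock_def)
  from choice[OF this] obtain \<psi> where fL2: "\<And>k. f k \<in> L2 gauss" and \<psi>: "\<And>k. \<psi> k \<in> L2 lborel"
    and ae: "\<And>k. ae_eq gauss (f k) (bargmann_map (V (\<psi> k)))" by blast
  have "L2_Cauchy lborel \<psi>"
    unfolding L2_Cauchy_def
  proof (intro allI impI)
    fix e :: real assume "0 < e"
    then have "0 < sq_norm lborel \<phi> * e" using nonzero by simp
    then obtain K where "\<forall>j\<ge>K. \<forall>k\<ge>K. sq_norm gauss (\<lambda>x. f j x - f k x) < sq_norm lborel \<phi> * e"
      using C unfolding L2_Cauchy_def by blast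
    then show "\<exists>K. \<forall>j\<ge>K. \<forall>k\<ge>K. sq_norm lborel (\<lambda>x. \<psi> j x - \<psi> k x) < e"
      using nonzero by (auto simp: fock_diff_sq_norm[OF fL2 fL2 \<psi> \<psi> ae ae])
  qed
  from L2_complete[OF \<psi> this] obtain \<eta> where \<eta>: "\<eta> \<in> L2 lborel"
    and lim: "(\<lambda>k. sq_norm lborel (\<lambda>t. \<psi> k t - \<eta> t)) \<longlonglongrightarrow> 0" by blast
  have B: "bargmann_map (V \<eta>) \<in> fock" by (rule bargmann_fock[OF \<eta>])
  then have BL: "bargmann_map (V \<eta>) \<in> L2 gauss" by (simp add: fock_def)
  have "(\<lambda>k. sq_norm lborel \<phi> * sq_norm lborel (\<lambda>t. \<psi> k t - \<eta> t)) \<longlonglongrightarrow> sq_norm lborel \<phi> * 0"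
    by (intro tendsto_intros lim)
  then have "(\<lambda>k. sq_norm gauss (\<lambda>w. f k w - bargmann_map (V \<eta>) w)) \<longlonglongrightarrow> 0"
    using fock_diff_sq_norm[OF fL2 BL \<psi> \<eta> ae] by (simp add: ae_eq_def)
  with B show "\<exists>g\<in>fock. (\<lambda>k. sq_norm gauss (\<lambda>x. f k x - g x)) \<longlonglongrightarrow> 0" by blast
qed

lemma fock_coercive_indicator:
  assumes \<Omega>: "\<Omega> \<in> sets (lebesgue :: (complex^'n) measure)" and fin: "emeasure lebesgue (- \<Omega>) < \<infinity>"
  shows "\<exists>c. coercive_on gauss fock (indicator \<Omega>) c"
proof -
  obtain c where c: "0 < c" "\<And>\<psi>. \<psi> \<in> L2 lborel \<Longrightarrow> c * sq_norm lebesgue (G \<psi>) \<le> weighted_energy lebesgue (indicator \<Omega>) (G \<psi>)"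
    using G_energy_coercive[OF assms] by blast
  have "c * sq_norm gauss H \<le> weighted_energy gauss (indicator \<Omega>) H" if HF: "H \<in> fock" for H
  proof -
    obtain \<psi> where \<psi>: "\<psi> \<in> L2 lborel" "ae_eq gauss H (bargmann_map (V \<psi>))" and H: "H \<in> L2 gauss"
      using HF by (auto simp: fock_def)
    have Hm: "H \<in> borel_measurable lebesgue" using L2_measurable[OF H] by (simp add: measurable_gauss)
    have im: "(indicator \<Omega> :: complex^'n \<Rightarrow> real) \<in> borel_measurable lebesgue" using \<Omega> by measurable
    show ?thesis
      using c(2)[OF \<psi>(1)] fock_sq_norm[OF \<psi>(1) Hm \<psi>(2)] fock_energy[OF \<psi>(1) Hm \<psi>(2) im] G_sq_norm[OF \<psi>(1)]
      by simp
  qed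
  then show ?thesis using c(1) by (auto simp: coercive_on_def)
qed

end

section \<open>Hermite functions\<close>

lemma poly_le_exp_square:
  fixes p :: "real poly"
  assumes "0 < \<epsilon>"
  shows "\<exists>K\<ge>0. \<forall>s. \<bar>poly p s\<bar> \<le> K * exp (\<epsilon> * s\<^sup>2)"
  using assms
proof (induction p arbitrary: \<epsilon>)
  case 0
  then show ?case by (intro exI[of _ 0]) simp
next
  case (pCons a p)
  have h: "0 < \<epsilon> / 2" using pCons.prems by simp
  obtain K where K: "0 \<le> K" "\<And>s. \<bar>poly p s\<bar> \<le> K * exp (\<epsilon> / 2 * s\<^sup>2)" using pCons.IH[OF h] by blast
  have s: "\<bar>s\<bar> \<le> (1 + 2 / \<epsilon>) * exp (\<epsilon> / 2 * s\<^sup>2)" for s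
  proof -
    have "\<bar>s\<bar> \<le> 1 + s\<^sup>2" using zero_le_power2[of "\<bar>s\<bar> - 1"] by (simp add: power2_eq_square algebra_simps) 
    also have "\<dots> \<le> (1 + 2 / \<epsilon>) * (1 + \<epsilon> / 2 * s\<^sup>2)"
      using pCons.prems by (simp add: field_simps)
    also have "\<dots> \<le> (1 + 2 / \<epsilon>) * exp (\<epsilon> / 2 * s\<^sup>2)"
      using pCons.prems by (intro mult_left_mono exp_ge_add_one_self) simp
    finally show ?thesis .
  qed
  have "\<bar>poly (pCons a p) s\<bar> \<le> (\<bar>a\<bar> + (1 + 2 / \<epsilon>) * K) * exp (\<epsilon> * s\<^sup>2)" for s
  proof -
    have "\<bar>s * poly p s\<bar> \<le> ((1 + 2 / \<epsilon>) * exp (\<epsilon> / 2 * s\<^sup>2)) * (K * exp (\<epsilon> / 2 * s\<^sup>2))"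
      unfolding abs_mult using s K pCons.prems by (intro mult_mono) auto
    also have "\<dots> = (1 + 2 / \<epsilon>) * K * exp (\<epsilon> * s\<^sup>2)"
      by (simp flip: exp_add)
    finally have 1: "\<bar>s * poly p s\<bar> \<le> (1 + 2 / \<epsilon>) * K * exp (\<epsilon> * s\<^sup>2)" .
    have "\<bar>a\<bar> * 1 \<le> \<bar>a\<bar> * exp (\<epsilon> * s\<^sup>2)" using pCons.prems by (intro mult_left_mono) auto
    with 1 abs_triangle_ineq[of a "s * poly p s"] show ?thesis by (simp add: distrib_right)
  qed
  moreover have "0 \<le> \<bar>a\<bar> + (1 + 2 / \<epsilon>) * K" using K pCons.prems by simp
  ultimately show ?case by blast
qed

text \<open>
  Each derivative replaces the polynomial \<open>p\<close> by \<open>p' - 4 \<pi> u p\<close>, whose degree is one higher, so the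
  polynomial never vanishes.
\<close>

lemma deriv_gaussian_poly:
  "\<exists>p :: real poly. p \<noteq> 0 \<and> (deriv ^^ k) (\<lambda>u. exp (- 2 * pi * u\<^sup>2)) = (\<lambda>s. poly p s * exp (- 2 * pi * s\<^sup>2))"
proof (induction k)
  case 0
  show ?case by (rule exI[of _ 1]) auto
next
  case (Suc k)
  then obtain p where p: "p \<noteq> 0" "(deriv ^^ k) (\<lambda>u. exp (- 2 * pi * u\<^sup>2)) = (\<lambda>s. poly p s * exp (- 2 * pi * s\<^sup>2))"
    by blast
  define q where "q = pderiv p - [:0, 4 * pi:] * p"
  have "q \<noteq> 0"
  proof
    assume "q = 0"
    then have "degree (pderiv p) = degree ([:0, 4 * pi:] * p)" by (simp add: q_def)
    moreover have "degree ([:0, 4 * pi:] * p) = 1 + degree p"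
      using p(1) by (subst degree_mult_eq) auto
    ultimately show False by (simp add: degree_pderiv)
  qed
  moreover have "(deriv ^^ Suc k) (\<lambda>u. exp (- 2 * pi * u\<^sup>2)) = (\<lambda>s. poly q s * exp (- 2 * pi * s\<^sup>2))"
  proof
    fix s
    have "((\<lambda>s. poly p s * exp (- 2 * pi * s\<^sup>2)) has_real_derivative poly q s * exp (- 2 * pi * s\<^sup>2)) (at s)"
      unfolding q_def by (auto intro!: derivative_eq_intros simp: algebra_simps power2_eq_square)
    then show "(deriv ^^ Suc k) (\<lambda>u. exp (- 2 * pi * u\<^sup>2)) s = poly q s * exp (- 2 * pi * s\<^sup>2)"
      by (simp only: funpow.simps comp_apply p(2) DERIV_imp_deriv)
  qed
  ultimately show ?case by blast
qed

lemma hermite_raw_poly: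
  "\<exists>p :: real poly. p \<noteq> 0 \<and> hermite_raw k = (\<lambda>s. poly p s * exp (- pi * s\<^sup>2))"
proof -
  obtain p :: "real poly" where p: "p \<noteq> 0" "(deriv ^^ k) (\<lambda>u. exp (- 2 * pi * u\<^sup>2)) = (\<lambda>s. poly p s * exp (- 2 * pi * s\<^sup>2))"
    using deriv_gaussian_poly by blast
  have "exp (pi * s\<^sup>2) * exp (- 2 * pi * s\<^sup>2) = exp (- pi * s\<^sup>2)" for s :: real
    by (simp flip: exp_add)
  then have "hermite_raw k s = poly p s * exp (- pi * s\<^sup>2)" for s
    unfolding hermite_raw_def p(2) by (simp add: mult.left_commute)
  then show ?thesis using p(1) by blast
qed

lemma continuous_AE_zero:
  fixes f :: "'a::euclidean_space \<Rightarrow> 'b::real_normed_vector"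
  assumes f: "continuous_on UNIV f" and ae: "AE x in lborel. f x = 0"
  shows "f x = 0"
proof -
  have op: "open {x. f x \<noteq> 0}" by (rule open_Collect_neq[OF f continuous_on_const])
  have "{x. f x \<noteq> 0} \<in> null_sets lborel"
    using ae op AE_iff_null[of lborel "\<lambda>x. f x = 0"] by simp
  then have "negligible {x. f x \<noteq> 0}" by (simp add: negligible_iff_null_sets null_sets_completionI)
  then have "{x. f x \<noteq> 0} = {}" using op open_not_negligible by blast
  then show ?thesis by auto
qed

text \<open>
  Since \<open>\<pi> > 1\<close>, the polynomial factor is absorbed by \<open>exp ((\<pi> - 1) s\<^sup>2)\<close>. The normalizing integral is
  positive because a continuous function that vanishes almost everywhere is zero, whereas a nonzero
  polynomial has finitely many roots.
\<close>

lemma hermite_window: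
  "continuous_on UNIV (hermite k)"
  "\<exists>K\<ge>0. \<forall>s. \<bar>hermite k s\<bar> \<le> K * exp (- s\<^sup>2)"
  "\<exists>s. hermite k s \<noteq> 0"
proof -
  obtain p :: "real poly" where p: "p \<noteq> 0" "hermite_raw k = (\<lambda>s. poly p s * exp (- pi * s\<^sup>2))"
    using hermite_raw_poly by blast
  define c where "c = sqrt (LINT u|lebesgue. (hermite_raw k u)\<^sup>2)"
  have hc: "hermite k s = hermite_raw k s / c" for s by (simp add: hermite_def c_def)
  have cont: "continuous_on UNIV (hermite_raw k)" unfolding p(2) by (intro continuous_intros)
  obtain K where K: "0 \<le> K" "\<And>s. \<bar>poly p s\<bar> \<le> K * exp ((pi - 1) * s\<^sup>2)"
    using poly_le_exp_square[of "pi - 1" p] pi_gt3 by auto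
  have bound: "\<bar>hermite_raw k s\<bar> \<le> K * exp (- s\<^sup>2)" for s
  proof -
    have "\<bar>hermite_raw k s\<bar> \<le> (K * exp ((pi - 1) * s\<^sup>2)) * exp (- pi * s\<^sup>2)"
      unfolding p(2) using K(2)[of s] by (simp add: abs_mult)
    also have "\<dots> = K * exp (- s\<^sup>2)" by (simp add: mult.assoc algebra_simps flip: exp_add)
    finally show ?thesis .
  qed
  have "finite {s. poly p s = 0}" using p(1) by (rule poly_roots_finite)
  then have "\<exists>s. poly p s \<noteq> 0" using infinite_UNIV_char_0[where 'a=real] by (metis (mono_tags) UNIV_I finite_subset mem_Collect_eq subsetI)
  then obtain s0 where s0: "hermite_raw k s0 \<noteq> 0" unfolding p(2) by auto
  have meas: "(\<lambda>u. (hermite_raw k u)\<^sup>2) \<in> borel_measurable lborel"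
    using borel_measurable_continuous_onI[OF cont] by simp
  have int: "integrable lborel (\<lambda>u. (hermite_raw k u)\<^sup>2)"
  proof -
    have "(\<lambda>u. complex_of_real (hermite_raw k u)) \<in> L2 lborel"
    proof (rule L2_gaussian_bound)
      fix u :: real
      have "K * exp (- u\<^sup>2) \<le> K * exp (- u\<^sup>2 / 4)" using K(1) by (intro mult_left_mono) auto
      with bound[of u] show "cmod (complex_of_real (hermite_raw k u)) \<le> K * exp (- (norm u)\<^sup>2 / 4)" by simp
    qed (use borel_measurable_continuous_onI[OF cont] in simp)
    from L2_integrable[OF this] show ?thesis by simp
  qed
  have c: "0 < c"
  proof (rule ccontr)
    assume "\<not> 0 < c"
    moreover have "0 \<le> c" by (simp add: c_def)
    ultimately have "c = 0" by linarith
    then have "(LINT u|lebesgue. (hermite_raw k u)\<^sup>2) = 0" by (simp only: c_def real_sqrt_eq_0_iff)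
    then have "(LINT u|lborel. (hermite_raw k u)\<^sup>2) = 0" by (simp only: integral_completion[OF meas])
    then have "AE u in lborel. (hermite_raw k u)\<^sup>2 = 0"
      using integral_nonneg_eq_0_iff_AE[OF int] by simp
    then have "AE u in lborel. hermite_raw k u = 0" by simp
    from continuous_AE_zero[OF cont this] s0 show False by blast
  qed
  show "continuous_on UNIV (hermite k)"
    unfolding hc[abs_def] using c by (intro continuous_intros cont) simp
  have "\<bar>hermite k s\<bar> \<le> (K / c) * exp (- s\<^sup>2)" for s
    using bound[of s] c by (simp add: hc divide_right_mono)
  then show "\<exists>K\<ge>0. \<forall>s. \<bar>hermite k s\<bar> \<le> K * exp (- s\<^sup>2)" using K(1) c by (intro exI[of _ "K / c"]) simp
  show "\<exists>s. hermite k s \<noteq> 0" using s0 c by (auto simp: hc)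
qed

lemma gaussian_window_hermite:
  fixes n :: "nat^'n"
  shows "\<exists>C. gaussian_window (hermite_nd n) C"
proof -
  have "\<forall>k. \<exists>K. 0 \<le> K \<and> (\<forall>s. \<bar>hermite k s\<bar> \<le> K * exp (- s\<^sup>2))" using hermite_window(2) by blast
  from choice[OF this] obtain K where K: "\<And>k. 0 \<le> K k" "\<And>k s. \<bar>hermite k s\<bar> \<le> K k * exp (- s\<^sup>2)" by blast
  define C where "C = (\<Prod>j\<in>UNIV. K (n $ j))"
  have cont: "continuous_on UNIV (hermite_nd n)"
    unfolding hermite_nd_def[abs_def]
    by (intro continuous_on_of_real continuous_on_prod continuous_on_compose2[OF hermite_window(1)] continuous_intros) auto
  have decay: "cmod (hermite_nd n t) \<le> C * exp (- (norm t)\<^sup>2)" for t :: "real^'n"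
  proof -
    have "cmod (hermite_nd n t) = (\<Prod>j\<in>UNIV. \<bar>hermite (n $ j) (t $ j)\<bar>)"
      by (simp only: hermite_nd_def norm_of_real abs_prod)
    also have "\<dots> \<le> (\<Prod>j\<in>UNIV. K (n $ j) * exp (- (t $ j)\<^sup>2))"
      by (intro prod_mono) (simp add: K)
    also have "\<dots> = C * exp (\<Sum>j\<in>UNIV. - (t $ j)\<^sup>2)"
      by (simp add: C_def prod.distrib exp_sum)
    also have "(\<Sum>j\<in>UNIV. - (t $ j)\<^sup>2) = - (norm t)\<^sup>2"
      by (simp add: norm_vec_def L2_set_def sum_negf sum_nonneg)
    finally show ?thesis .
  qed
  have "\<forall>k. \<exists>s. hermite k s \<noteq> 0" using hermite_window(3) by blast
  from choice[OF this] obtain s where s: "\<And>k. hermite k (s k) \<noteq> 0" by blast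
  have nz: "hermite_nd n (\<chi> j. s (n $ j)) \<noteq> 0" using s by (simp add: hermite_nd_def)
  have m: "hermite_nd n \<in> borel_measurable borel" by (rule borel_measurable_continuous_onI[OF cont])
  have L2: "hermite_nd n \<in> L2 lborel"
  proof (rule L2_gaussian_bound[OF m])
    fix t :: "real^'n"
    have "0 \<le> C" by (simp add: C_def prod_nonneg K)
    then have "C * exp (- (norm t)\<^sup>2) \<le> C * exp (- (norm t)\<^sup>2 / 4)" by (intro mult_left_mono) auto
    with decay[of t] show "cmod (hermite_nd n t) \<le> C * exp (- (norm t)\<^sup>2 / 4)" by linarith
  qed
  have "sq_norm lborel (hermite_nd n) \<noteq> 0"
  proof
    assume "sq_norm lborel (hermite_nd n) = 0"
    then have "AE t in lborel. hermite_nd n t = 0" using sq_norm_eq_0_iff[OF L2] by simp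
    from continuous_AE_zero[OF cont this] nz show False by blast
  qed
  then have "0 < sq_norm lborel (hermite_nd n)" using sq_norm_nonneg[of lborel "hermite_nd n"] by linarith
  with cont decay have "gaussian_window (hermite_nd n) C" by unfold_locales auto
  then show ?thesis ..
qed

text \<open>
  Along a ray the cosine takes the values \<open>1\<close> and \<open>-1\<close> at arbitrarily large norms.
\<close>

lemma oscillating_no_limit:
  "\<nexists>L. ((\<lambda>z :: 'a::euclidean_space. \<bar>3 / 4 + cos (norm z) / 4\<bar>) \<longlongrightarrow> L) at_infinity"
proof
  assume "\<exists>L. ((\<lambda>z :: 'a. \<bar>3 / 4 + cos (norm z) / 4\<bar>) \<longlongrightarrow> L) at_infinity"
  then obtain L where L: "((\<lambda>z :: 'a. \<bar>3 / 4 + cos (norm z) / 4\<bar>) \<longlongrightarrow> L) at_infinity" by blast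
  obtain e :: 'a where e: "norm e = 1" using norm_Basis nonempty_Basis by blast
  define z where "z a k = (a + 2 * pi * real k) *\<^sub>R e" for a k
  have "filterlim (\<lambda>k. a + 2 * pi * real k) at_top sequentially" for a
    by (intro filterlim_tendsto_add_at_top[OF tendsto_const] filterlim_tendsto_pos_mult_at_top[OF tendsto_const]
        filterlim_real_sequentially) simp
  then have inf: "filterlim (z a) at_infinity sequentially" if "0 \<le> a" for a
    using that e unfolding filterlim_at_infinity_conv_norm_at_top by (simp add: z_def)
  have norm_z: "norm (z a k) = a + 2 * pi * real k" if "0 \<le> a" for a k
    using that e by (simp add: z_def)
  have cosz: "cos (norm (z a k)) = cos a" if "0 \<le> a" for a k
  proof -
    have "2 * pi * real k = 2 * real k * pi" by simp
    then show ?thesis by (simp only: norm_z[OF that] cos_add cos_2npi sin_2npi)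
  qed
  have lim: "L = \<bar>3 / 4 + cos a / 4\<bar>" if "0 \<le> a" for a
    using filterlim_compose[OF L inf[OF that]] by (simp add: cosz[OF that] LIMSEQ_const_iff)
  show False using lim[of 0] lim[of pi] by simp
qed

section \<open>Toeplitz operators on polyanalytic Fock spaces\<close>

theorem proposition4p12:
  fixes n :: "nat^'n"
  shows "(\<forall>\<Omega> \<in> sets (lebesgue :: (complex^'n) measure).
            emeasure lebesgue (- \<Omega>) < \<infinity> \<longrightarrow>
            l2_isomorphism gauss (fock2 n) (toeplitz n (indicator \<Omega>)))
       \<and> (\<exists>F :: complex^'n \<Rightarrow> real.
            continuous_on UNIV F \<and>
            (\<lambda>z. complex_of_real (F z)) \<in> Linf lebesgue \<and>
            (\<nexists>L. ((\<lambda>z. \<bar>F z\<bar>) \<longlongrightarrow> L) at_infinity) \<and>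
            l2_isomorphism gauss (fock2 n) (toeplitz n (\<lambda>z. complex_of_real (F z))))"
proof (intro conjI ballI impI)
  obtain C where "gaussian_window (hermite_nd n) C" using gaussian_window_hermite by blast
  then interpret gaussian_window "hermite_nd n" C .
  have fock: "fock2 n = fock" by (simp add: fock2_def fock_eq_stft)
  have iso: "l2_isomorphism gauss (fock2 n) (toeplitz n (\<lambda>z. complex_of_real (F z)))"
    if "F \<in> borel_measurable lebesgue" "\<And>z. 0 \<le> F z \<and> F z \<le> 1" "coercive_on gauss fock F c" for F c
    unfolding toeplitz_def[abs_def] fock
    by (rule l2_isomorphism_compression[OF fock_subspace fock_closed _ that(2,3)])
      (simp add: that(1) measurable_gauss)
  {
    fix \<Omega> :: "(complex^'n) set"
    assume \<Omega>: "\<Omega> \<in> sets lebesgue" and fin: "emeasure lebesgue (- \<Omega>) < \<infinity>"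
    obtain c where c: "coercive_on gauss fock (indicator \<Omega>) c" using fock_coercive_indicator[OF \<Omega> fin] by blast
    have im: "(indicator \<Omega> :: complex^'n \<Rightarrow> real) \<in> borel_measurable lebesgue" using \<Omega> by measurable
    have "(\<lambda>z. complex_of_real (indicator \<Omega> z)) = indicator \<Omega>" by (auto simp: indicator_def)
    with iso[OF im _ c] show "l2_isomorphism gauss (fock2 n) (toeplitz n (indicator \<Omega>))"
      by (simp add: indicator_def)
  next
    define F where "F z = 3 / 4 + cos (norm z) / 4" for z :: "complex^'n"
    have F: "1 / 2 \<le> F z" "F z \<le> 1" for z
      using cos_le_one[of "norm z"] cos_ge_minus_one[of "norm z"] unfolding F_def by linarith+
    have cont: "continuous_on UNIV F" unfolding F_def[abs_def] by (intro continuous_intros) auto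
    have m: "F \<in> borel_measurable lebesgue"
      by (rule measurable_completion) (simp add: borel_measurable_continuous_onI[OF cont])
    have "coercive_on gauss fock F (1 / 2)"
      unfolding coercive_on_def
    proof (intro conjI ballI)
      fix H assume "H \<in> fock"
      then have H: "H \<in> L2 gauss" by (simp add: fock_def)
      have "1 / 2 * sq_norm gauss H = (LINT w|gauss. 1 / 2 * (cmod (H w))\<^sup>2)" by (simp add: sq_norm_def)
      also have "\<dots> \<le> weighted_energy gauss F H"
        unfolding weighted_energy_def
      proof (rule integral_mono)
        show "integrable gauss (\<lambda>w. F w * (cmod (H w))\<^sup>2)"
          using H m F by (intro weighted_integrable) (auto simp: measurable_gauss intro: order_trans[OF _ F(1)])
        show "1 / 2 * (cmod (H w))\<^sup>2 \<le> F w * (cmod (H w))\<^sup>2" for w using F(1) by (rule mult_right_mono) simp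
      qed (use L2_integrable[OF H] in simp)
      finally show "1 / 2 * sq_norm gauss H \<le> weighted_energy gauss F H" .
    qed simp
    then have "l2_isomorphism gauss (fock2 n) (toeplitz n (\<lambda>z. complex_of_real (F z)))"
      by (rule iso[OF m, rotated]) (use F in \<open>auto intro: order_trans[OF _ F(1)]\<close>)
    moreover have "(\<lambda>z. complex_of_real (F z)) \<in> Linf lebesgue"
    proof -
      have "cmod (complex_of_real (F z)) \<le> 1" for z using F[of z] by simp
      then show ?thesis using m by (auto simp: Linf_def)
    qed
    moreover have "\<nexists>L. ((\<lambda>z. \<bar>F z\<bar>) \<longlongrightarrow> L) at_infinity"
      unfolding F_def by (rule oscillating_no_limit)
    ultimately show "\<exists>F :: complex^'n \<Rightarrow> real.
            continuous_on UNIV F \<and>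
            (\<lambda>z. complex_of_real (F z)) \<in> Linf lebesgue \<and>
            (\<nexists>L. ((\<lambda>z. \<bar>F z\<bar>) \<longlongrightarrow> L) at_infinity) \<and>
            l2_isomorphism gauss (fock2 n) (toeplitz n (\<lambda>z. complex_of_real (F z)))"
      using cont by blast
  }
qed

end
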